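(* Let $0<\alpha<1$, $m\in L^\infty(\Omega)$, $m\le0$ a.e. in $\Omega$, and suppose that $\Omega^0:=\operatorname{int}\{x\in\Omega:m(x)=0\}$ is a nonempty connected $C^{1,1}$ domain compactly contained in $\Omega$, and that $m<0$ a.e. in $\Omega\setminus\overline{\Omega^0}$. Suppose there exist $\rho_0>0$ and $m_{\rho_0}^->0$ such that $$\mathcal C_{\rho_0}\subset\Omega^-\qquad\text{and}\qquad -m(x)\ge m_{\rho_0}^-\ \text{ for a.e. }x\in\mathcal C_{\rho_0}.$$ Then there exists $\varepsilon>0$, with $\varepsilon\le\lambda_{1,\Omega^0}-\lambda_{1,\Omega}$, such that for every $\lambda\in(\lambda_{1,\Omega^0}-\varepsilon,\lambda_{1,\Omega^0})$ the solution $u_\lambda^-$ has compact support in $\Omega$. More precisely, there exists $\rho\in(0,\rho_0)$, independent of such $\lambda$ sufficiently close to $\lambda_{1,\Omega^0}$, such that $u_\lambda^-=0$ in $\mathcal C_\rho$; consequently $$\operatorname{supp}u_\lambda^-\subset\{x\in\Omega:\operatorname{dist}(x,\partial\Omega)\ge\rho\}\Subset\Omega .$$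
   Context: $\Omega\subset\mathbb R^N$, $N\ge1$, is a bounded connected domain with sufficiently smooth boundary; $\Omega^-=\{x\in\Omega:m(x)<0\}$; $\mathcal C_\rho=\{x\in\Omega:\operatorname{dist}(x,\partial\Omega)<\rho\}$. $\lambda_{1,D}$ denotes the first Dirichlet eigenvalue of $-\Delta$ in a domain $D$. Problem $(P_\lambda)$: $-\Delta u=\lambda u+m(x)|u|^{\alpha-1}u$ in $\Omega$, $u=0$ on $\partial\Omega$ (weak solutions in $H_0^1(\Omega)$). $H_\lambda(u)=\int_\Omega(|\nabla u|^2-\lambda u^2)dx$, $M(u)=\int_\Omega m|u|^{\alpha+1}dx$, $E_\lambda(u)=\frac12H_\lambda(u)-\frac1{\alpha+1}M(u)$, and $\mathcal N_\lambda^-=\{u\in H_0^1(\Omega)\setminus\{0\}:H_\lambda(u)=M(u),\ H_\lambda(u)-\alpha M(u)<0\}$. For $\lambda\in(\lambda_{1,\Omega},\lambda_{1,\Omega^0})$, $u_\lambda^-$ denotes a non-negative weak solution of $(P_\lambda)$ belonging to $\mathcal N_\lambda^-$ with $E_\lambda(u_\lambda^-)=\inf_{\mathcal N_\lambda^-}E_\lambda$ (the solution constructed in the paper; such solutions exist for all these $\lambda$, are continuous on $\overline\Omega$, and one is fixed for each $\lambda$). *)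

theory Defs
  imports "HOL-Analysis.Analysis"
begin

subsection \<open>Domains and their boundaries\<close>

definition compactly_contained :: "'a::euclidean_space set \<Rightarrow> 'a set \<Rightarrow> bool" where
  "compactly_contained A B \<longleftrightarrow> compact (closure A) \<and> closure A \<subseteq> B"

definition C11_function :: "('a::euclidean_space \<Rightarrow> real) \<Rightarrow> bool" where
  "C11_function f \<longleftrightarrow>
     (\<exists>g L. (\<forall>x. (f has_derivative (\<lambda>h. g x \<bullet> h)) (at x)) \<and> L-lipschitz_on UNIV g)"

text \<open>Near each boundary point \<open>p\<close> the set \<open>D\<close> is, in the direction \<open>e\<close>, the strict epigraph
  of a \<open>C\<^sup>1\<^sup>,\<^sup>1\<close> function on the hyperplane orthogonal to \<open>e\<close>. The function \<open>\<gamma>\<close> is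
  defined on the whole space but only evaluated on that hyperplane; in dimension 1 the
  hyperplane is \<open>{0}\<close>.\<close>

definition C11_boundary :: "'a::euclidean_space set \<Rightarrow> bool" where
  "C11_boundary D \<longleftrightarrow>
     (\<forall>p\<in>frontier D. \<exists>e r \<gamma>. norm e = 1 \<and> r > 0 \<and> C11_function \<gamma> \<and>
        D \<inter> ball p r = {x \<in> ball p r. x \<bullet> e > \<gamma> (x - (x \<bullet> e) *\<^sub>R e)})"

definition C11_domain :: "'a::euclidean_space set \<Rightarrow> bool" where
  "C11_domain D \<longleftrightarrow> open D \<and> connected D \<and> D \<noteq> {} \<and> C11_boundary D"

definition boundary_strip :: "'a::euclidean_space set \<Rightarrow> real \<Rightarrow> 'a set" where
  "boundary_strip D \<rho> = {x \<in> D. infdist x (frontier D) < \<rho>}"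

definition supp_on :: "'a::euclidean_space set \<Rightarrow> ('a \<Rightarrow> real) \<Rightarrow> 'a set" where
  "supp_on D u = closure {x \<in> D. u x \<noteq> 0}"


subsection \<open>The Sobolev space \<open>H\<^sub>0\<^sup>1\<close>\<close>

primrec C_k :: "nat \<Rightarrow> ('a::euclidean_space \<Rightarrow> real) \<Rightarrow> bool" where
  "C_k 0 f \<longleftrightarrow> continuous_on UNIV f"
| "C_k (Suc k) f \<longleftrightarrow> f differentiable_on UNIV \<and>
     (\<forall>b\<in>Basis. C_k k (\<lambda>x. frechet_derivative f (at x) b))"

definition test_functions :: "'a::euclidean_space set \<Rightarrow> ('a \<Rightarrow> real) set" where
  "test_functions D = {\<phi>. (\<forall>k. C_k k \<phi>) \<and> compactly_contained {x. \<phi> x \<noteq> 0} D}"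

definition gradient :: "('a::euclidean_space \<Rightarrow> real) \<Rightarrow> 'a \<Rightarrow> 'a" where
  "gradient f x = (\<Sum>b\<in>Basis. frechet_derivative f (at x) b *\<^sub>R b)"

definition square_integrable ::
  "'a::euclidean_space set \<Rightarrow> ('a \<Rightarrow> 'b::euclidean_space) \<Rightarrow> bool" where
  "square_integrable D f \<longleftrightarrow> f \<in> borel_measurable (lebesgue_on D) \<and>
     integrable (lebesgue_on D) (\<lambda>x. (norm (f x))\<^sup>2)"

definition essentially_bounded :: "'a::euclidean_space set \<Rightarrow> ('a \<Rightarrow> real) \<Rightarrow> bool" where
  "essentially_bounded D f \<longleftrightarrow> f \<in> borel_measurable (lebesgue_on D) \<and>
     (\<exists>C. AE x in lebesgue_on D. \<bar>f x\<bar> \<le> C)"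

text \<open>Sobolev functions are represented by ordinary functions, whose values outside \<open>D\<close> and
  on null sets are immaterial.\<close>

definition has_weak_gradient ::
  "'a::euclidean_space set \<Rightarrow> ('a \<Rightarrow> real) \<Rightarrow> ('a \<Rightarrow> 'a) \<Rightarrow> bool" where
  "has_weak_gradient D u g \<longleftrightarrow> square_integrable D u \<and> square_integrable D g \<and>
     (\<forall>\<phi>\<in>test_functions D. \<forall>b\<in>Basis.
        (\<integral>x. u x * (gradient \<phi> x \<bullet> b) \<partial>lebesgue_on D)
          = - (\<integral>x. (g x \<bullet> b) * \<phi> x \<partial>lebesgue_on D))"

definition H1 :: "'a::euclidean_space set \<Rightarrow> ('a \<Rightarrow> real) set" where
  "H1 D = {u. \<exists>g. has_weak_gradient D u g}"

text \<open>For open \<open>D\<close> the weak gradient is unique up to null sets, so the integrals below do not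
  depend on the choice made here.\<close>

definition weak_gradient :: "'a::euclidean_space set \<Rightarrow> ('a \<Rightarrow> real) \<Rightarrow> 'a \<Rightarrow> 'a" where
  "weak_gradient D u = (SOME g. has_weak_gradient D u g)"

definition H10 :: "'a::euclidean_space set \<Rightarrow> ('a \<Rightarrow> real) set" where
  "H10 D = {u \<in> H1 D. \<exists>\<phi>. (\<forall>n::nat. \<phi> n \<in> test_functions D) \<and>
     (\<lambda>n. \<integral>x. (u x - \<phi> n x)\<^sup>2 + (norm (weak_gradient D u x - gradient (\<phi> n) x))\<^sup>2
            \<partial>lebesgue_on D) \<longlonglongrightarrow> 0}"

abbreviation zero_on :: "'a::euclidean_space set \<Rightarrow> ('a \<Rightarrow> real) \<Rightarrow> bool" where
  "zero_on D u \<equiv> (AE x in lebesgue_on D. u x = 0)"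


subsection \<open>The boundary value problem and its variational structure\<close>

definition dirichlet_eigenvalue :: "'a::euclidean_space set \<Rightarrow> real \<Rightarrow> bool" where
  "dirichlet_eigenvalue D \<mu> \<longleftrightarrow> (\<exists>u\<in>H10 D. \<not> zero_on D u \<and>
     (\<forall>v\<in>H10 D. (\<integral>x. weak_gradient D u x \<bullet> weak_gradient D v x \<partial>lebesgue_on D)
                  = \<mu> * (\<integral>x. u x * v x \<partial>lebesgue_on D)))"

definition first_eigenvalue :: "'a::euclidean_space set \<Rightarrow> real" where
  "first_eigenvalue D = (LEAST \<mu>. dirichlet_eigenvalue D \<mu>)"

text \<open>The nonlinearity \<open>\<bar>u\<bar>\<^sup>\<alpha>\<^sup>-\<^sup>1 u\<close> vanishes where \<open>u = 0\<close>, since \<open>0 powr a = 0\<close>.\<close>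

definition weak_solution ::
  "'a::euclidean_space set \<Rightarrow> ('a \<Rightarrow> real) \<Rightarrow> real \<Rightarrow> real \<Rightarrow> ('a \<Rightarrow> real) \<Rightarrow> bool" where
  "weak_solution D m \<alpha> \<mu> u \<longleftrightarrow> u \<in> H10 D \<and>
     (\<forall>v\<in>H10 D. (\<integral>x. weak_gradient D u x \<bullet> weak_gradient D v x \<partial>lebesgue_on D)
        = (\<integral>x. (\<mu> * u x + m x * \<bar>u x\<bar> powr (\<alpha> - 1) * u x) * v x \<partial>lebesgue_on D))"

definition H_form :: "'a::euclidean_space set \<Rightarrow> real \<Rightarrow> ('a \<Rightarrow> real) \<Rightarrow> real" where
  "H_form D \<mu> u = (\<integral>x. (norm (weak_gradient D u x))\<^sup>2 - \<mu> * (u x)\<^sup>2 \<partial>lebesgue_on D)"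

definition M_form ::
  "'a::euclidean_space set \<Rightarrow> ('a \<Rightarrow> real) \<Rightarrow> real \<Rightarrow> ('a \<Rightarrow> real) \<Rightarrow> real" where
  "M_form D m \<alpha> u = (\<integral>x. m x * \<bar>u x\<bar> powr (\<alpha> + 1) \<partial>lebesgue_on D)"

definition energy ::
  "'a::euclidean_space set \<Rightarrow> ('a \<Rightarrow> real) \<Rightarrow> real \<Rightarrow> real \<Rightarrow> ('a \<Rightarrow> real) \<Rightarrow> real" where
  "energy D m \<alpha> \<mu> u = 1 / 2 * H_form D \<mu> u - 1 / (\<alpha> + 1) * M_form D m \<alpha> u"

definition nehari_minus ::
  "'a::euclidean_space set \<Rightarrow> ('a \<Rightarrow> real) \<Rightarrow> real \<Rightarrow> real \<Rightarrow> ('a \<Rightarrow> real) set" where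
  "nehari_minus D m \<alpha> \<mu> = {u \<in> H10 D. \<not> zero_on D u \<and>
     H_form D \<mu> u = M_form D m \<alpha> u \<and> H_form D \<mu> u - \<alpha> * M_form D m \<alpha> u < 0}"

text \<open>The solution is taken as its representative that is continuous up to the boundary. On
  \<open>nehari_minus\<close> the energy equals \<open>(\<alpha> - 1) / (2 * (\<alpha> + 1)) * M_form D m \<alpha> u\<close>, which is
  positive for \<open>0 < \<alpha> < 1\<close>, so the infimum of reals is a genuine one.\<close>

definition nehari_minus_solution ::
  "'a::euclidean_space set \<Rightarrow> ('a \<Rightarrow> real) \<Rightarrow> real \<Rightarrow> real \<Rightarrow> ('a \<Rightarrow> real) \<Rightarrow> bool" where
  "nehari_minus_solution D m \<alpha> \<mu> u \<longleftrightarrow>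
     weak_solution D m \<alpha> \<mu> u \<and> u \<in> nehari_minus D m \<alpha> \<mu> \<and>
     energy D m \<alpha> \<mu> u = (INF w\<in>nehari_minus D m \<alpha> \<mu>. energy D m \<alpha> \<mu> w) \<and>
     (\<forall>x\<in>D. 0 \<le> u x) \<and> continuous_on (closure D) u"

end

theory Submission
  imports Defs "HOL-Library.Diagonal_Subsequence" "HOL-Complex_Analysis.Great_Picard"
begin

text \<open>The square \<open>w = u\<^sup>2\<close> of a solution, extended by zero, satisfies
  \<open>\<Delta> w \<ge> 2 \<bar>m\<bar> w powr \<beta> - 2 \<mu> w\<close> with \<open>\<beta> = (\<alpha> + 1) / 2 < 1\<close> in the sense of
  distributions on the whole space: test the equation with \<open>u \<phi>\<close>, where \<open>\<phi>\<close> need not vanish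
  on the boundary.

  On the Nehari set the energy is a multiple of \<open>- M u\<close>. Dilating a nearly optimal function
  of the inner domain by \<open>1 + s\<close> makes the quadratic form negative of order \<open>s\<close>, while
  \<open>M\<close> becomes of order \<open>s powr (\<alpha> + 1)\<close> only. So the minimal energy, and with it the integral
  of \<open>w powr \<beta>\<close> over the boundary strip, tends to zero as \<open>\<mu>\<close> approaches the eigenvalue of
  the inner domain. The mean value inequality turns this into a uniform bound for \<open>w\<close> inside
  the strip, and where \<open>w\<close> is small the absorption \<open>w powr \<beta>\<close> dominates; iterating on
  shrinking balls then forces \<open>w = 0\<close> near the boundary.\<close>

subsection \<open>Smooth functions\<close>

text \<open>Multiplying \<open>u\<close> by a smooth function keeps it in the energy space, and the
  extra term, the function times the squared gradient, has a sign; this is why the square obeys an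
  inequality across the frontier. Balls may then leave the domain. The zero extension is known to be
  continuous only inside, which suffices because pointwise bounds are sought only where it is
  positive. The obstacle is uniformity in \<open>\<mu>\<close>: each solution is bounded, but no
  common bound is at hand. What is controlled uniformly near the frontier is the integral of
  \<open>w powr \<beta>\<close>, with an exponent below 1, so the mean value inequality for
  \<open>w\<close> must first be brought down to that exponent. The orders then fit: an energy of
  order \<open>s powr (\<alpha> + 1)\<close> becomes, through the power \<open>1 / \<beta>\<close>,
  a bound of order \<open>s^2\<close> for \<open>w\<close>. All averages use kernels built from exp
  (- 1 / s) and its derivatives. The mean value inequality thus comes from differentiating a single
  volume integral in the radius, with neither spherical means nor boundary integrals.\<close>

definition smooth :: "('a::euclidean_space \<Rightarrow> real) \<Rightarrow> bool" where
  "smooth f \<longleftrightarrow> (\<forall>k. C_k k f)"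

definition pd :: "'a::euclidean_space \<Rightarrow> ('a \<Rightarrow> real) \<Rightarrow> 'a \<Rightarrow> real" where
  "pd b f x = frechet_derivative f (at x) b"

lemma C_k_Suc_pd:
  "C_k (Suc k) f \<longleftrightarrow> (\<forall>x. f differentiable (at x)) \<and> (\<forall>b\<in>Basis. C_k k (pd b f))"
  unfolding C_k.simps by (simp add: differentiable_on_def pd_def[abs_def])

declare C_k.simps(2) [simp del]

lemma C_k_Suc_imp: "C_k (Suc k) f \<Longrightarrow> C_k k f"
proof (induction k arbitrary: f)
  case 0
  then show ?case
    by (auto simp: C_k_Suc_pd differentiable_on_def intro!: differentiable_imp_continuous_on)
next
  case (Suc k)
  then show ?case
    unfolding C_k_Suc_pd by blast
qed

lemma frechet_derivative_eqI:
  "(f has_derivative f') (at x) \<Longrightarrow> frechet_derivative f (at x) = f'"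
  using frechet_derivative_at by fastforce

lemma pd_eqI: "(f has_derivative f') (at x) \<Longrightarrow> pd b f x = f' b"
  by (simp add: pd_def frechet_derivative_eqI)

lemma differentiable_has_derivative_pd:
  assumes "f differentiable (at x)"
  shows "(f has_derivative (\<lambda>h. frechet_derivative f (at x) h)) (at x)"
  using assms frechet_derivative_works by blast

lemma pd_add:
  assumes "f differentiable (at x)" "g differentiable (at x)"
  shows "pd b (\<lambda>x. f x + g x) x = pd b f x + pd b g x"
proof -
  have "((\<lambda>x. f x + g x) has_derivative
      (\<lambda>h. frechet_derivative f (at x) h + frechet_derivative g (at x) h)) (at x)"
    by (intro has_derivative_add differentiable_has_derivative_pd assms)
  from pd_eqI[OF this] show ?thesis by (simp add: pd_def)
qed

lemma pd_mult:
  assumes "f differentiable (at x)" "g differentiable (at x)"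
  shows "pd b (\<lambda>x. f x * g x) x = f x * pd b g x + pd b f x * g x"
proof -
  have "((\<lambda>x. f x * g x) has_derivative
      (\<lambda>h. f x * frechet_derivative g (at x) h + frechet_derivative f (at x) h * g x)) (at x)"
    by (intro has_derivative_mult differentiable_has_derivative_pd assms)
  from pd_eqI[OF this] show ?thesis by (simp add: pd_def)
qed

lemma C_k_const: "C_k k (\<lambda>x. c)"
proof (induction k arbitrary: c)
  case (Suc k)
  have "pd b (\<lambda>x. c) = (\<lambda>x. 0)" for b :: 'a
    by (rule ext, subst pd_eqI) (auto intro: has_derivative_const)
  with Suc show ?case unfolding C_k_Suc_pd by auto
qed auto

lemma C_k_add: "C_k k f \<Longrightarrow> C_k k g \<Longrightarrow> C_k k (\<lambda>x. f x + g x)"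
proof (induction k arbitrary: f g)
  case 0
  then show ?case by (auto intro: continuous_intros)
next
  case (Suc k)
  have "pd b (\<lambda>x. f x + g x) = (\<lambda>x. pd b f x + pd b g x)" for b
    using Suc.prems by (intro ext pd_add) (auto simp: C_k_Suc_pd)
  with Suc show ?case unfolding C_k_Suc_pd by auto
qed

lemma C_k_mult: "C_k k f \<Longrightarrow> C_k k g \<Longrightarrow> C_k k (\<lambda>x. f x * g x)"
proof (induction k arbitrary: f g)
  case 0
  then show ?case by (auto intro: continuous_intros)
next
  case (Suc k)
  have eq: "pd b (\<lambda>x. f x * g x) = (\<lambda>x. f x * pd b g x + pd b f x * g x)" for b
    using Suc.prems by (intro ext pd_mult) (auto simp: C_k_Suc_pd)
  have "C_k k (\<lambda>x. f x * pd b g x + pd b f x * g x)" if "b \<in> Basis" for b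
    using Suc.prems that by (intro C_k_add Suc.IH) (auto simp: C_k_Suc_imp, auto simp: C_k_Suc_pd)
  with Suc.prems show ?case unfolding C_k_Suc_pd eq by auto
qed

lemma smooth_const: "smooth (\<lambda>x. c)"
  by (simp add: smooth_def C_k_const)

lemma smooth_add: "smooth f \<Longrightarrow> smooth g \<Longrightarrow> smooth (\<lambda>x. f x + g x)"
  by (simp add: smooth_def C_k_add)

lemma smooth_mult: "smooth f \<Longrightarrow> smooth g \<Longrightarrow> smooth (\<lambda>x. f x * g x)"
  by (simp add: smooth_def C_k_mult)

lemma smooth_diff: "smooth f \<Longrightarrow> smooth g \<Longrightarrow> smooth (\<lambda>x. f x - g x)"
  using smooth_add[of f "\<lambda>x. -1 * g x"] smooth_mult[OF smooth_const, of g "-1"] by simp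

lemma smooth_sum: "(\<And>i. i \<in> I \<Longrightarrow> smooth (f i)) \<Longrightarrow> smooth (\<lambda>x. \<Sum>i\<in>I. f i x)"
  by (induction I rule: infinite_finite_induct) (auto intro: smooth_const smooth_add)

lemma smooth_prod: "(\<And>i. i \<in> I \<Longrightarrow> smooth (f i)) \<Longrightarrow> smooth (\<lambda>x. \<Prod>i\<in>I. f i x)"
  by (induction I rule: infinite_finite_induct) (auto intro: smooth_const smooth_mult)

lemma smooth_differentiable: "smooth f \<Longrightarrow> f differentiable (at x)"
  unfolding smooth_def using C_k_Suc_pd by blast

lemma smooth_pd: "smooth f \<Longrightarrow> b \<in> Basis \<Longrightarrow> smooth (pd b f)"
  unfolding smooth_def using C_k_Suc_pd by blast

lemma smooth_continuous_on: "smooth f \<Longrightarrow> continuous_on S f"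
  unfolding smooth_def using C_k.simps(1) continuous_on_subset by blast

text \<open>\<open>C_k k\<close> is obtained by descending from \<open>C_k (Suc k)\<close>, so the
  order 0 needs no separate argument.\<close>

lemma smoothI_pd:
  assumes "\<And>x. f differentiable (at x)" "\<And>b. b \<in> Basis \<Longrightarrow> smooth (pd b f)"
  shows "smooth f"
  unfolding smooth_def
proof
  fix k show "C_k k f"
    using assms C_k_Suc_imp C_k_Suc_pd smooth_def by metis
qed

lemma smooth_inner_left: "smooth (\<lambda>x. x \<bullet> c)"
proof (rule smoothI_pd)
  have d: "((\<lambda>x. x \<bullet> c) has_derivative (\<lambda>h. h \<bullet> c)) (at x)" for x
    by (auto intro!: derivative_eq_intros)
  then show "(\<lambda>x. x \<bullet> c) differentiable at x" for x
    using differentiable_def by blast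
  show "smooth (pd b (\<lambda>x. x \<bullet> c))" for b
    using d by (subst ext[of _ "\<lambda>_. b \<bullet> c"]) (auto intro!: smooth_const pd_eqI)
qed

lemma has_derivative_scaleR_at: "((\<lambda>x::'a::real_normed_vector. c *\<^sub>R x) has_derivative (\<lambda>h. c *\<^sub>R h)) (at x)"
  by (auto intro!: derivative_eq_intros)

lemma pd_scale:
  assumes "f differentiable (at (c *\<^sub>R x))"
  shows "pd b (\<lambda>x. f (c *\<^sub>R x)) x = c * pd b f (c *\<^sub>R x)"
    and "(\<lambda>x. f (c *\<^sub>R x)) differentiable (at x)"
proof -
  let ?D = "frechet_derivative f (at (c *\<^sub>R x))"
  have D: "(f has_derivative ?D) (at (c *\<^sub>R x))"
    using assms differentiable_has_derivative_pd by blast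
  have *: "((\<lambda>x. f (c *\<^sub>R x)) has_derivative (\<lambda>h. ?D (c *\<^sub>R h))) (at x)"
    by (rule has_derivative_compose[OF has_derivative_scaleR_at D])
  have "?D (c *\<^sub>R b) = c * ?D b"
    using has_derivative_linear[OF D] by (simp add: linear_scale)
  then show "pd b (\<lambda>x. f (c *\<^sub>R x)) x = c * pd b f (c *\<^sub>R x)"
    using pd_eqI[OF *, of b] by (simp add: pd_def)
  show "(\<lambda>x. f (c *\<^sub>R x)) differentiable (at x)"
    using * differentiable_def by blast
qed

lemma C_k_scale: "C_k k f \<Longrightarrow> C_k k (\<lambda>x. f (c *\<^sub>R x))"
proof (induction k arbitrary: f)
  case 0
  then show ?case
    by (auto intro!: continuous_intros continuous_on_compose2[of UNIV f])
next
  case (Suc k)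
  have "pd b (\<lambda>x. f (c *\<^sub>R x)) = (\<lambda>x. c * pd b f (c *\<^sub>R x))" for b
    using Suc.prems by (intro ext pd_scale) (auto simp: C_k_Suc_pd)
  with Suc show ?case unfolding C_k_Suc_pd
    by (auto intro!: pd_scale C_k_mult C_k_const)
qed

lemma smooth_scale: "smooth f \<Longrightarrow> smooth (\<lambda>x. f (c *\<^sub>R x))"
  by (simp add: smooth_def C_k_scale)

text \<open>Carrying a whole sequence in which each function is the derivative of the previous one
  keeps the induction in one shape: a partial derivative of the composite is a smooth factor times
  the next member, and \<open>n\<close> is left arbitrary.\<close>

lemma C_k_chain:
  fixes g :: "nat \<Rightarrow> real \<Rightarrow> real"
  assumes "\<And>n s. (g n has_real_derivative g (Suc n) s) (at s)" and q: "smooth q"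
  shows "C_k k (\<lambda>x. g n (q x))"
proof (induction k arbitrary: n)
  case 0
  have "continuous_on UNIV (g n)"
    using assms(1) DERIV_isCont continuous_at_imp_continuous_on by blast
  then show ?case
    using q by (auto intro: continuous_on_compose2 smooth_continuous_on)
next
  case (Suc k)
  have d: "((\<lambda>x. g n (q x)) has_derivative (\<lambda>h. frechet_derivative q (at x) h * g (Suc n) (q x))) (at x)" for x
    using has_derivative_compose[OF differentiable_has_derivative_pd[OF smooth_differentiable[OF q]]
        assms(1)[of n, unfolded has_field_derivative_def]] by (simp add: mult.commute)
  have pd: "pd b (\<lambda>x. g n (q x)) = (\<lambda>x. pd b q x * g (Suc n) (q x))" for b
    using pd_eqI[OF d] by (auto simp: pd_def)
  show ?case
    unfolding C_k_Suc_pd pd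
    using d q Suc by (auto simp: differentiable_def intro!: C_k_mult smooth_pd[unfolded smooth_def, rule_format])
      (use smooth_pd smooth_def in blast)
qed

section \<open>Gradients as vectors, and test functions\<close>

lemma gradient_inner: "b \<in> Basis \<Longrightarrow> gradient f x \<bullet> b = pd b f x"
  by (simp add: gradient_def pd_def inner_sum_left inner_Basis if_distrib cong: if_cong)

lemma gradient_eqI:
  assumes "(f has_derivative (\<lambda>h. g \<bullet> h)) (at x)"
  shows "gradient f x = g"
  by (rule euclidean_eqI) (simp add: gradient_inner pd_eqI[OF assms])

lemma gradient_has_derivative:
  assumes "f differentiable (at x)"
  shows "(f has_derivative (\<lambda>h. gradient f x \<bullet> h)) (at x)"
proof -
  let ?D = "frechet_derivative f (at x)"
  have "?D h = gradient f x \<bullet> h" for h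
  proof -
    have "?D h = ?D (\<Sum>b\<in>Basis. (h \<bullet> b) *\<^sub>R b)"
      by (simp add: euclidean_representation)
    also have "\<dots> = (\<Sum>b\<in>Basis. (h \<bullet> b) * ?D b)"
      using linear_frechet_derivative[OF assms] by (simp add: linear_sum linear_scale)
    also have "\<dots> = gradient f x \<bullet> h"
      by (simp add: gradient_def inner_sum_left mult.commute inner_commute[of h])
    finally show ?thesis .
  qed
  then show ?thesis
    using differentiable_has_derivative_pd[OF assms] by presburger
qed

lemma smooth_gradient_continuous: "smooth f \<Longrightarrow> continuous_on S (gradient f)"
  unfolding gradient_def using smooth_continuous_on[OF smooth_pd]
  by (auto simp: pd_def[abs_def] intro!: continuous_intros)

lemma gradient_mult:
  assumes "f differentiable (at x)" "g differentiable (at x)"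
  shows "gradient (\<lambda>x. f x * g x) x = f x *\<^sub>R gradient g x + g x *\<^sub>R gradient f x"
  by (rule euclidean_eqI) (simp add: gradient_inner pd_mult[OF assms] inner_add_left)

lemma gradient_add:
  assumes "f differentiable (at x)" "g differentiable (at x)"
  shows "gradient (\<lambda>x. f x + g x) x = gradient f x + gradient g x"
  by (rule euclidean_eqI) (simp add: gradient_inner pd_add[OF assms] inner_add_left)

lemma gradient_const: "gradient (\<lambda>x. c) x = 0"
  by (rule gradient_eqI) simp

lemma gradient_cmult:
  assumes "f differentiable (at x)"
  shows "gradient (\<lambda>x. c * f x) x = c *\<^sub>R gradient f x"
  using gradient_mult[of "\<lambda>_. c" x f] assms by (simp add: gradient_const)

lemma gradient_diff:
  assumes "f differentiable (at x)" "g differentiable (at x)"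
  shows "gradient (\<lambda>x. f x - g x) x = gradient f x - gradient g x"
  using gradient_add[of f x "\<lambda>x. (-1) * g x"] gradient_cmult[of g x "-1"] assms
  by (simp add: differentiable_minus)

lemma gradient_scale:
  assumes "f differentiable (at (c *\<^sub>R x))"
  shows "gradient (\<lambda>x. f (c *\<^sub>R x)) x = c *\<^sub>R gradient f (c *\<^sub>R x)"
  by (rule euclidean_eqI) (simp add: gradient_inner pd_scale[OF assms])

text \<open>The complement of \<open>K\<close> is open, so \<open>f\<close> vanishes on a whole
  neighbourhood of \<open>x\<close>, not only at \<open>x\<close>.\<close>

lemma gradient_zero_outside:
  assumes "closed K" "\<And>y. y \<notin> K \<Longrightarrow> f y = 0" "x \<notin> K"
  shows "gradient f x = 0"
proof (rule gradient_eqI)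
  have "((\<lambda>y. 0::real) has_derivative (\<lambda>h. 0 \<bullet> h)) (at x)" by simp
  then show "(f has_derivative (\<lambda>h. 0 \<bullet> h)) (at x)"
    by (rule has_derivative_transform_within_open[of _ _ _ UNIV "- K"]) (use assms in auto)
qed

text \<open>Any compact set off which the function vanishes may replace the closure of its support,
  so that a witness can be named freely for sums, products and dilates.\<close>

lemma test_functions_iff:
  "\<phi> \<in> test_functions D \<longleftrightarrow>
     smooth \<phi> \<and> (\<exists>K. compact K \<and> K \<subseteq> D \<and> (\<forall>x. x \<notin> K \<longrightarrow> \<phi> x = 0))"
proof
  assume "\<phi> \<in> test_functions D"
  then show "smooth \<phi> \<and> (\<exists>K. compact K \<and> K \<subseteq> D \<and> (\<forall>x. x \<notin> K \<longrightarrow> \<phi> x = 0))"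
    using closure_subset[of "{x. \<phi> x \<noteq> 0}"]
    by (auto simp: test_functions_def smooth_def compactly_contained_def
        intro!: exI[of _ "closure {x. \<phi> x \<noteq> 0}"])
next
  assume *: "smooth \<phi> \<and> (\<exists>K. compact K \<and> K \<subseteq> D \<and> (\<forall>x. x \<notin> K \<longrightarrow> \<phi> x = 0))"
  then obtain K where K: "compact K" "K \<subseteq> D" "\<And>x. x \<notin> K \<Longrightarrow> \<phi> x = 0" by blast
  then have "closure {x. \<phi> x \<noteq> 0} \<subseteq> K"
    by (intro closure_minimal) (auto intro: compact_imp_closed)
  then show "\<phi> \<in> test_functions D"
    using * K(1,2) compact_Int_closed[of K "closure {x. \<phi> x \<noteq> 0}"]
    by (auto simp: test_functions_def smooth_def compactly_contained_def Int_absorb1)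
qed

lemma test_functionsE:
  assumes "\<phi> \<in> test_functions D"
  obtains K where "compact K" "K \<subseteq> D" "\<And>x. x \<notin> K \<Longrightarrow> \<phi> x = 0"
    "\<And>x. x \<notin> K \<Longrightarrow> gradient \<phi> x = 0"
  using assms gradient_zero_outside compact_imp_closed unfolding test_functions_iff by metis

lemma test_functions_smooth: "\<phi> \<in> test_functions D \<Longrightarrow> smooth \<phi>"
  by (simp add: test_functions_iff)

lemma test_functions_mono: "\<phi> \<in> test_functions D \<Longrightarrow> D \<subseteq> D' \<Longrightarrow> \<phi> \<in> test_functions D'"
  unfolding test_functions_iff by blast

lemma test_functions_mult:
  assumes "\<phi> \<in> test_functions D" "smooth \<psi>"
  shows "(\<lambda>x. \<phi> x * \<psi> x) \<in> test_functions D"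
  using assms unfolding test_functions_iff by (auto intro: smooth_mult)

lemma test_functions_cmult:
  assumes "\<phi> \<in> test_functions D"
  shows "(\<lambda>x. c * \<phi> x) \<in> test_functions D"
  using assms unfolding test_functions_iff by (auto intro: smooth_mult smooth_const)

lemma test_functions_add:
  assumes "\<phi> \<in> test_functions D" "\<psi> \<in> test_functions D"
  shows "(\<lambda>x. \<phi> x + \<psi> x) \<in> test_functions D"
proof -
  obtain K L where "compact K" "K \<subseteq> D" "\<And>x. x \<notin> K \<Longrightarrow> \<phi> x = 0"
    "compact L" "L \<subseteq> D" "\<And>x. x \<notin> L \<Longrightarrow> \<psi> x = 0"
    using assms unfolding test_functions_iff by metis
  then show ?thesis
    using assms unfolding test_functions_iff
    by (auto intro!: smooth_add exI[of _ "K \<union> L"])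
qed

lemma test_functions_diff:
  assumes "\<phi> \<in> test_functions D" "\<psi> \<in> test_functions D"
  shows "(\<lambda>x. \<phi> x - \<psi> x) \<in> test_functions D"
  using test_functions_add[OF assms(1) test_functions_cmult[OF assms(2), of "-1"]] by simp

subsection \<open>Smooth bumps\<close>

text \<open>Polynomials in 1 / s times exp (- 1 / s), cut off at 0: a class closed under
  differentiation, each member of which tends to 0 at the origin.\<close>

definition flat_term :: "real poly \<Rightarrow> real \<Rightarrow> real" where
  "flat_term p s = (if s > 0 then poly p (1 / s) * exp (- (1 / s)) else 0)"

lemma poly_exp_tendsto_0: "((\<lambda>x::real. poly p x * exp (- x)) \<longlongrightarrow> 0) at_top"
proof -
  have "((\<lambda>x::real. \<Sum>i\<le>degree p. coeff p i * (x ^ i / exp x)) \<longlongrightarrow> (\<Sum>i\<le>degree p. coeff p i * 0)) at_top"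
    by (intro tendsto_sum tendsto_mult tendsto_const tendsto_power_div_exp_0)
  then show ?thesis
    by (simp add: poly_altdef sum_distrib_right exp_minus divide_inverse mult.assoc)
qed

lemma flat_term_tendsto_0: "(flat_term p \<longlongrightarrow> 0) (at 0)"
proof -
  have "((\<lambda>s. poly p (inverse s) * exp (- inverse s)) \<longlongrightarrow> 0) (at_right (0::real))"
    by (rule filterlim_compose[OF poly_exp_tendsto_0 filterlim_inverse_at_top_right])
  then have "(flat_term p \<longlongrightarrow> 0) (at_right 0)"
    by (rule Lim_transform_eventually)
      (auto simp: eventually_at_filter flat_term_def inverse_eq_divide)
  moreover have "(flat_term p \<longlongrightarrow> 0) (at_left 0)"
    by (rule Lim_transform_eventually[OF tendsto_const[of 0]])
      (auto simp: eventually_at_filter flat_term_def)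
  ultimately show ?thesis
    by (simp add: filterlim_split_at)
qed

text \<open>The chain rule in the variable X = 1 / s: differentiating p(X) exp (- X) in s gives X^2
  (p - p') exp (- X), and \<open>[:0, 0, 1:]\<close> is X^2.\<close>

definition flat_step :: "real poly \<Rightarrow> real poly" where
  "flat_step p = [:0, 0, 1:] * (p - pderiv p)"

lemma flat_term_deriv: "(flat_term p has_real_derivative flat_term (flat_step p) s) (at s)"
proof -
  consider "s > 0" | "s < 0" | "s = 0" by linarith
  then show ?thesis
  proof cases
    case 1
    have "((\<lambda>s. poly p (1 / s) * exp (- (1 / s))) has_real_derivative flat_term (flat_step p) s) (at s)"
      using 1
      by (auto intro!: derivative_eq_intros DERIV_chain2[OF poly_DERIV] simp: flat_term_def flat_step_def)
        (simp add: field_simps power2_eq_square)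
    then show ?thesis
      by (rule has_field_derivative_transform_within[of _ _ _ _ s]) (use 1 in \<open>auto simp: flat_term_def dist_real_def\<close>)
  next
    case 2
    have "((\<lambda>s. 0) has_real_derivative 0) (at s)" by simp
    then have "(flat_term p has_real_derivative 0) (at s)"
      by (rule has_field_derivative_transform_within[of _ _ _ _ "-s"]) (use 2 in \<open>auto simp: flat_term_def dist_real_def\<close>)
    then show ?thesis using 2 by (simp add: flat_term_def)
  next
    case 3
    \<comment> \<open>Dividing by h multiplies the polynomial by X = 1 / h, so the difference
      quotient at 0 is again a member of the class.\<close>
    have "((\<lambda>h. flat_term (pCons 0 p) h) \<longlongrightarrow> 0) (at 0)"
      by (rule flat_term_tendsto_0)
    then have "((\<lambda>h. (flat_term p (0 + h) - flat_term p 0) / h) \<longlongrightarrow> 0) (at 0)"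
      by (rule Lim_transform_eventually) (auto simp: flat_term_def eventually_at_filter)
    then show ?thesis
      using 3 unfolding DERIV_def by (simp add: flat_term_def)
  qed
qed

text \<open>The \<open>n\<close>-th derivative of exp (- 1 / s) extended by zero. Indexing by the
  order of differentiation is the form that \<open>C_k_chain\<close> asks for.\<close>

definition flat :: "nat \<Rightarrow> real \<Rightarrow> real" where
  "flat n = flat_term ((flat_step ^^ n) 1)"

lemma flat_deriv: "(flat n has_real_derivative flat (Suc n) s) (at s)"
  by (simp add: flat_def flat_term_deriv)

lemma flat_continuous: "continuous_on S (flat n)"
  using flat_deriv DERIV_isCont continuous_at_imp_continuous_on by blast

lemma flat_nonpos: "s \<le> 0 \<Longrightarrow> flat n s = 0"
  by (simp add: flat_def flat_term_def)

text \<open>Boundedness on s \<le> 1 is enough, since the argument of a bump never exceeds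
  1.\<close>

lemma flat_bounded: "\<exists>B>0. \<forall>s\<le>1. \<bar>flat n s\<bar> \<le> B"
proof -
  have "compact (flat n ` {0..1})"
    by (intro compact_continuous_image flat_continuous) auto
  then obtain B where "B > 0" "\<forall>y\<in>flat n ` {0..1}. norm y \<le> B"
    using compact_imp_bounded bounded_pos by metis
  then show ?thesis
    using flat_nonpos[of _ n] by (intro exI[of _ B]) (force simp: not_le)
qed

lemma flat_0: "flat 0 s = (if s > 0 then exp (- (1 / s)) else 0)"
  by (simp add: flat_def flat_term_def)

lemma flat_1: "flat (Suc 0) s = (if s > 0 then exp (- (1 / s)) / s^2 else 0)"
  by (simp add: flat_def flat_term_def flat_step_def pderiv_1 power2_eq_square)

lemma flat_0_nonneg: "flat 0 s \<ge> 0" and flat_1_nonneg: "flat (Suc 0) s \<ge> 0"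
  by (auto simp: flat_0 flat_1)

lemma flat_0_le_1: "flat 0 s \<le> 1"
  by (auto simp: flat_0)

lemma flat_0_pos: "s > 0 \<Longrightarrow> flat 0 s > 0"
  by (simp add: flat_0)

text \<open>The bump is dominated by the kernel of the mean value formula. This lets a term of order
  zero be absorbed into the average itself.\<close>

lemma flat_0_le_flat_1: "s \<le> 1 \<Longrightarrow> flat 0 s \<le> flat (Suc 0) s"
  using power_le_one[of s 2]
  by (auto simp: flat_0 flat_1 field_simps mult_left_le_one_le)

lemma flat_0_mono: "s \<le> t \<Longrightarrow> flat 0 s \<le> flat 0 t"
  by (rule DERIV_nonneg_imp_nondecreasing) (use flat_deriv flat_1_nonneg in auto)

lemma smooth_flat_comp: "smooth q \<Longrightarrow> smooth (\<lambda>x. flat n (q x))"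
  unfolding smooth_def[of "\<lambda>x. flat n (q x)"] by (intro allI C_k_chain[of flat] flat_deriv)

text \<open>The squared norm makes this a polynomial, so the bump is smooth at its centre as
  well.\<close>

definition bump_arg :: "'a::euclidean_space \<Rightarrow> real \<Rightarrow> 'a \<Rightarrow> real" where
  "bump_arg x0 r z = 1 - (norm (z - x0))\<^sup>2 / r\<^sup>2"

definition bump :: "'a::euclidean_space \<Rightarrow> real \<Rightarrow> 'a \<Rightarrow> real" where
  "bump x0 r z = flat 0 (bump_arg x0 r z)"

lemma smooth_bump_arg: "smooth (bump_arg x0 r)"
proof -
  have eq: "bump_arg x0 r = (\<lambda>z. 1 - (\<Sum>b\<in>Basis. ((z \<bullet> b) - x0 \<bullet> b) * ((z \<bullet> b) - x0 \<bullet> b)) * (1 / r\<^sup>2))"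
    unfolding bump_arg_def power2_norm_eq_inner
    by (subst euclidean_inner) (auto simp: inner_diff_left)
  show ?thesis unfolding eq
    by (intro smooth_diff smooth_mult smooth_sum smooth_const smooth_inner_left)
qed

lemma smooth_bump: "smooth (bump x0 r)"
  using smooth_flat_comp[OF smooth_bump_arg, of 0 x0 r] by (simp add: bump_def[abs_def])

lemma bump_arg_le_1: "bump_arg x0 r z \<le> 1"
  by (simp add: bump_arg_def)

lemma bump_arg_pos_iff: "r > 0 \<Longrightarrow> bump_arg x0 r z > 0 \<longleftrightarrow> z \<in> ball x0 r"
proof -
  assume r: "r > 0"
  have "bump_arg x0 r z > 0 \<longleftrightarrow> (norm (z - x0))\<^sup>2 < r\<^sup>2"
    using r by (simp add: bump_arg_def field_simps)
  also have "\<dots> \<longleftrightarrow> norm (z - x0) < r"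
    using r by (metis norm_ge_zero power_less_imp_less_base power_strict_mono less_imp_le zero_less_numeral)
  finally show ?thesis by (simp add: dist_norm norm_minus_commute)
qed

lemma bump_nonneg: "bump x0 r z \<ge> 0" and bump_le_1: "bump x0 r z \<le> 1"
  by (auto simp: bump_def flat_0_nonneg flat_0_le_1)

lemma bump_pos: "r > 0 \<Longrightarrow> z \<in> ball x0 r \<Longrightarrow> bump x0 r z > 0"
  by (simp add: bump_def bump_arg_pos_iff flat_0_pos)

lemma flat_bump_outside: "r > 0 \<Longrightarrow> z \<notin> ball x0 r \<Longrightarrow> flat n (bump_arg x0 r z) = 0"
  using bump_arg_pos_iff[of r x0 z] by (simp add: flat_nonpos)

lemma bump_outside: "r > 0 \<Longrightarrow> z \<notin> ball x0 r \<Longrightarrow> bump x0 r z = 0"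
  by (simp add: bump_def flat_bump_outside)

lemma bump_test_function:
  assumes "r > 0" "cball x0 r \<subseteq> D"
  shows "bump x0 r \<in> test_functions D"
  unfolding test_functions_iff using assms
  by (auto intro!: smooth_bump exI[of _ "cball x0 r"] bump_outside)

lemma bump_arg_deriv:
  "(bump_arg x0 r has_derivative (\<lambda>h. - 2 * ((z - x0) \<bullet> h) / r\<^sup>2)) (at z)"
  unfolding bump_arg_def[abs_def] power2_norm_eq_inner divide_inverse
  by (auto intro!: derivative_eq_intros simp: inner_commute)

lemma flat_bump_deriv:
  "((\<lambda>z. flat n (bump_arg x0 r z)) has_derivative
     (\<lambda>h. flat (Suc n) (bump_arg x0 r z) * (- 2 * ((z - x0) \<bullet> h) / r\<^sup>2))) (at z)"
  using has_derivative_compose[OF bump_arg_deriv flat_deriv[unfolded has_field_derivative_def]] .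

lemma pd_bump: "pd b (bump x0 r) z = - 2 / r\<^sup>2 * (((z - x0) \<bullet> b) * flat (Suc 0) (bump_arg x0 r z))"
  unfolding bump_def[abs_def] by (subst pd_eqI[OF flat_bump_deriv]) simp

definition laplacian :: "('a::euclidean_space \<Rightarrow> real) \<Rightarrow> 'a \<Rightarrow> real" where
  "laplacian f x = (\<Sum>b\<in>Basis. pd b (pd b f) x)"

text \<open>Left in terms of the first and second derivative of the profile, so that it can be
  matched term by term with the radius derivative of the kernel \<open>flat 1\<close>.\<close>

lemma laplacian_bump:
  "laplacian (bump x0 r) (z::'a::euclidean_space) =
     - 2 / r\<^sup>2 * (real DIM('a) * flat (Suc 0) (bump_arg x0 r z)
                  - 2 * ((norm (z - x0))\<^sup>2 / r\<^sup>2) * flat (Suc (Suc 0)) (bump_arg x0 r z))"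
proof -
  have *: "pd b (pd b (bump x0 r)) z = - 2 / r\<^sup>2 * (flat (Suc 0) (bump_arg x0 r z)
      + ((z - x0) \<bullet> b) * (flat (Suc (Suc 0)) (bump_arg x0 r z) * (- 2 * ((z - x0) \<bullet> b) / r\<^sup>2)))"
    if b: "b \<in> Basis" for b
  proof -
    have "((\<lambda>z. - 2 / r\<^sup>2 * (((z - x0) \<bullet> b) * flat (Suc 0) (bump_arg x0 r z))) has_derivative
      (\<lambda>h. - 2 / r\<^sup>2 * ((h \<bullet> b) * flat (Suc 0) (bump_arg x0 r z) + ((z - x0) \<bullet> b) *
        (flat (Suc (Suc 0)) (bump_arg x0 r z) * (- 2 * ((z - x0) \<bullet> h) / r\<^sup>2))))) (at z)"
      by (rule derivative_eq_intros flat_bump_deriv refl | simp add: algebra_simps)+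
    from pd_eqI[OF this, of b] b show ?thesis
      unfolding pd_bump[abs_def] by simp
  qed
  have "laplacian (bump x0 r) z = (\<Sum>b\<in>Basis. - 2 / r\<^sup>2 * (flat (Suc 0) (bump_arg x0 r z)
      - 2 / r\<^sup>2 * flat (Suc (Suc 0)) (bump_arg x0 r z) * (((z - x0) \<bullet> b) * ((z - x0) \<bullet> b))))"
    unfolding laplacian_def by (rule sum.cong) (simp_all only: *, simp_all add: divide_inverse)
  also have "\<dots> = - 2 / r\<^sup>2 * (real DIM('a) * flat (Suc 0) (bump_arg x0 r z)
      - 2 / r\<^sup>2 * flat (Suc (Suc 0)) (bump_arg x0 r z) * (\<Sum>b\<in>Basis. ((z - x0) \<bullet> b) * ((z - x0) \<bullet> b)))"
    unfolding sum_distrib_left[symmetric] sum_subtractf by simp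
  also have "(\<Sum>b\<in>Basis. ((z - x0) \<bullet> b) * ((z - x0) \<bullet> b)) = (norm (z - x0))\<^sup>2"
    unfolding power2_norm_eq_inner by (subst (3) euclidean_inner) simp
  finally show ?thesis by (simp add: field_simps)
qed

subsection \<open>Square integrable functions\<close>

text \<open>Parametrised by the measure because test functions are handled over the whole space and
  solutions over \<open>lebesgue_on D\<close>. Functions are not identified almost everywhere, so
  \<open>l2\<close> is only a seminorm.\<close>

definition L2 :: "'a measure \<Rightarrow> ('a \<Rightarrow> 'b::euclidean_space) \<Rightarrow> bool" where
  "L2 M f \<longleftrightarrow> f \<in> borel_measurable M \<and> integrable M (\<lambda>x. (norm (f x))\<^sup>2)"

definition l2 :: "'a measure \<Rightarrow> ('a \<Rightarrow> 'b::euclidean_space) \<Rightarrow> real" where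
  "l2 M f = sqrt (\<integral>x. (norm (f x))\<^sup>2 \<partial>M)"

lemma square_integrable_L2: "square_integrable D f \<longleftrightarrow> L2 (lebesgue_on D) f"
  by (simp add: square_integrable_def L2_def)

lemma L2_measurable [measurable_dest]: "L2 M f \<Longrightarrow> f \<in> borel_measurable M"
  by (simp add: L2_def)

lemma L2_square_integrable: "L2 M f \<Longrightarrow> integrable M (\<lambda>x. (norm (f x))\<^sup>2)"
  by (simp add: L2_def)

lemma l2_nonneg [simp]: "l2 M f \<ge> 0"
  by (simp add: l2_def)

lemma l2_square: "(l2 M f)\<^sup>2 = (\<integral>x. (norm (f x))\<^sup>2 \<partial>M)"
  by (simp add: l2_def)

lemma l2_square_real: "(l2 M f)\<^sup>2 = (\<integral>x. f x * f x \<partial>M)" for f :: "_ \<Rightarrow> real"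
  unfolding l2_square by (simp add: power2_eq_square[symmetric])

lemma norm_inner_le_squares: "\<bar>a \<bullet> b\<bar> \<le> (norm a)\<^sup>2 + (norm (b::'a::real_inner))\<^sup>2"
proof -
  have "2 * (norm a * norm b) \<le> (norm a)\<^sup>2 + (norm b)\<^sup>2"
    using sum_squares_bound[of "norm a" "norm b"] by (simp add: algebra_simps)
  moreover have "0 \<le> norm a * norm b" by simp
  ultimately show ?thesis using Cauchy_Schwarz_ineq2[of a b] by linarith
qed

lemma L2_inner_integrable:
  assumes "L2 M f" "L2 M g"
  shows "integrable M (\<lambda>x. f x \<bullet> g x)"
proof (rule Bochner_Integration.integrable_bound)
  show "integrable M (\<lambda>x. (norm (f x))\<^sup>2 + (norm (g x))\<^sup>2)"
    using assms by (simp add: L2_def)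
  show "(\<lambda>x. f x \<bullet> g x) \<in> borel_measurable M"
    using assms[THEN L2_measurable] by measurable
  show "AE x in M. norm (f x \<bullet> g x) \<le> norm ((norm (f x))\<^sup>2 + (norm (g x))\<^sup>2)"
    using norm_inner_le_squares by auto
qed

lemma L2_add:
  assumes "L2 M f" "L2 M g"
  shows "L2 M (\<lambda>x. f x + g x)"
  unfolding L2_def
proof
  show "(\<lambda>x. f x + g x) \<in> borel_measurable M"
    using assms[THEN L2_measurable] by measurable
  have "(\<lambda>x. (norm (f x + g x))\<^sup>2) = (\<lambda>x. (norm (f x))\<^sup>2 + (norm (g x))\<^sup>2 + 2 * (f x \<bullet> g x))"
    by (simp add: power2_norm_eq_inner inner_add_left inner_add_right inner_commute algebra_simps)
  then show "integrable M (\<lambda>x. (norm (f x + g x))\<^sup>2)"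
    using assms L2_inner_integrable[OF assms] by (simp add: L2_def)
qed

lemma L2_scaleR: "L2 M f \<Longrightarrow> L2 M (\<lambda>x. c *\<^sub>R f x)"
  by (auto simp: L2_def power_mult_distrib intro: borel_measurable_scaleR)

lemma L2_diff:
  assumes "L2 M f" "L2 M g"
  shows "L2 M (\<lambda>x. f x - g x)"
  using L2_add[OF assms(1) L2_scaleR[OF assms(2), of "-1"]] by simp

lemma L2_cmult: "L2 M (f::_ \<Rightarrow> real) \<Longrightarrow> L2 M (\<lambda>x. c * f x)"
  using L2_scaleR[of M f c] by simp

lemma L2_le:
  assumes g: "L2 M g" and f: "f \<in> borel_measurable M" and le: "\<And>x. norm (f x) \<le> C * norm (g x)" and C: "0 \<le> C"
  shows "L2 M f" "l2 M f \<le> C * l2 M g"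
proof -
  have le2: "(norm (f x))\<^sup>2 \<le> C\<^sup>2 * (norm (g x))\<^sup>2" for x
    using power_mono[OF le[of x], of 2] by (simp add: power_mult_distrib)
  have i: "integrable M (\<lambda>x. C\<^sup>2 * (norm (g x))\<^sup>2)"
    using g by (simp add: L2_def)
  have i2: "integrable M (\<lambda>x. (norm (f x))\<^sup>2)"
  proof (rule Bochner_Integration.integrable_bound[OF i])
    show "(\<lambda>x. (norm (f x))\<^sup>2) \<in> borel_measurable M"
      using f by measurable
  qed (use le2 in \<open>auto intro!: AE_I2\<close>)
  then show "L2 M f" using f by (simp add: L2_def)
  have "(\<integral>x. (norm (f x))\<^sup>2 \<partial>M) \<le> (\<integral>x. C\<^sup>2 * (norm (g x))\<^sup>2 \<partial>M)"
    by (rule integral_mono[OF i2 i le2])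
  then have "(l2 M f)\<^sup>2 \<le> (C * l2 M g)\<^sup>2"
    by (simp add: l2_square power_mult_distrib)
  then show "l2 M f \<le> C * l2 M g"
    by (rule power2_le_imp_le) (use C in simp)
qed

lemma L2_bounded_scaleR:
  assumes "L2 M f" "h \<in> borel_measurable M" "\<And>x. \<bar>h x\<bar> \<le> B"
  shows "L2 M (\<lambda>x. h x *\<^sub>R f x)" "l2 M (\<lambda>x. h x *\<^sub>R f x) \<le> B * l2 M f"
proof -
  have B: "0 \<le> B" using assms(3) abs_ge_zero order_trans by blast
  have m: "(\<lambda>x. h x *\<^sub>R f x) \<in> borel_measurable M"
    using L2_measurable[OF assms(1)] assms(2) by measurable
  have "norm (h x *\<^sub>R f x) \<le> B * norm (f x)" for x
    using assms(3) by (simp add: mult_right_mono)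
  from L2_le[OF assms(1) m this B]
  show "L2 M (\<lambda>x. h x *\<^sub>R f x)" "l2 M (\<lambda>x. h x *\<^sub>R f x) \<le> B * l2 M f" by blast+
qed

text \<open>Positivity of the quadratic form in two real parameters.\<close>

lemma L2_Cauchy_Schwarz:
  assumes f: "L2 M f" and g: "L2 M g"
  shows "\<bar>\<integral>x. f x \<bullet> g x \<partial>M\<bar> \<le> l2 M f * l2 M g"
proof -
  let ?a = "\<integral>x. (norm (f x))\<^sup>2 \<partial>M" and ?b = "\<integral>x. f x \<bullet> g x \<partial>M" and ?c = "\<integral>x. (norm (g x))\<^sup>2 \<partial>M"
  have i: "integrable M (\<lambda>x. (norm (f x))\<^sup>2)" "integrable M (\<lambda>x. (norm (g x))\<^sup>2)"
      "integrable M (\<lambda>x. f x \<bullet> g x)"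
    using f g L2_inner_integrable[OF f g] by (auto simp: L2_def)
  have q: "0 \<le> s\<^sup>2 * ?a - 2 * s * t * ?b + t\<^sup>2 * ?c" for s t
  proof -
    have "0 \<le> (\<integral>x. (norm (s *\<^sub>R f x - t *\<^sub>R g x))\<^sup>2 \<partial>M)" by simp
    also have "(\<lambda>x. (norm (s *\<^sub>R f x - t *\<^sub>R g x))\<^sup>2)
        = (\<lambda>x. s\<^sup>2 * (norm (f x))\<^sup>2 - 2 * s * t * (f x \<bullet> g x) + t\<^sup>2 * (norm (g x))\<^sup>2)"
      by (rule ext, simp only: power2_norm_eq_inner inner_diff_left inner_diff_right inner_scaleR_left
          inner_scaleR_right inner_commute[of "g _" "f _"])
        (simp add: power2_eq_square algebra_simps)
    finally show ?thesis using i by simp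
  qed
  have a0: "0 \<le> ?a" "0 \<le> ?c" by simp_all
  have "?b\<^sup>2 \<le> ?a * ?c"
  proof (cases "?c = 0")
    case True
    have "?b = 0"
    proof (rule ccontr)
      assume "?b \<noteq> 0"
      \<comment> \<open>With \<open>?c\<close> equal to 0 this parameter makes the form equal to
        -1.\<close>
      then show False
        using q[of 1 "(?a + 1) / (2 * ?b)"] True by (simp add: field_simps)
    qed
    then show ?thesis by (simp add: True)
  next
    case False
    \<comment> \<open>The parameters s = \<open>?c\<close> and t = \<open>?b\<close> turn the form
      into this product.\<close>
    have "0 \<le> ?c * (?a * ?c - ?b\<^sup>2)"
      using q[of ?c ?b] by (simp add: power2_eq_square algebra_simps)
    then show ?thesis
      using False a0(2) by (simp add: zero_le_mult_iff del: Bochner_Integration.integral_nonneg)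
  qed
  then have "\<bar>?b\<bar> \<le> sqrt (?a * ?c)"
    using real_le_rsqrt[of "\<bar>?b\<bar>"] by simp
  then show ?thesis by (simp add: l2_def real_sqrt_mult)
qed

lemma l2_triangle:
  assumes f: "L2 M f" and g: "L2 M g"
  shows "l2 M (\<lambda>x. f x + g x) \<le> l2 M f + l2 M g"
proof -
  have i: "integrable M (\<lambda>x. (norm (f x))\<^sup>2)" "integrable M (\<lambda>x. (norm (g x))\<^sup>2)"
      "integrable M (\<lambda>x. f x \<bullet> g x)"
    using f g L2_inner_integrable[OF f g] by (auto simp: L2_def)
  have "(l2 M (\<lambda>x. f x + g x))\<^sup>2 = (\<integral>x. (norm (f x))\<^sup>2 + (norm (g x))\<^sup>2 + 2 * (f x \<bullet> g x) \<partial>M)"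
    unfolding l2_square
    by (rule Bochner_Integration.integral_cong)
      (auto simp: power2_norm_eq_inner inner_add_left inner_add_right inner_commute)
  also have "\<dots> = (l2 M f)\<^sup>2 + (l2 M g)\<^sup>2 + 2 * (\<integral>x. f x \<bullet> g x \<partial>M)"
    using i by (simp add: l2_square)
  also have "\<dots> \<le> (l2 M f + l2 M g)\<^sup>2"
    using L2_Cauchy_Schwarz[OF f g] by (simp add: power2_sum)
  finally show ?thesis
    by (rule power2_le_imp_le) simp
qed

lemma l2_scaleR: "l2 M (\<lambda>x. c *\<^sub>R f x) = \<bar>c\<bar> * l2 M f"
  by (simp add: l2_def power_mult_distrib real_sqrt_mult)

lemma l2_minus_commute: "l2 M (\<lambda>x. f x - g x) = l2 M (\<lambda>x. g x - f x)"
  by (simp add: l2_def norm_minus_commute)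

lemma l2_triangle_diff:
  assumes "L2 M f" "L2 M g" "L2 M h"
  shows "l2 M (\<lambda>x. f x - h x) \<le> l2 M (\<lambda>x. f x - g x) + l2 M (\<lambda>x. g x - h x)"
  using l2_triangle[OF L2_diff[OF assms(1,2)] L2_diff[OF assms(2,3)]] by simp

lemma l2_le_diff:
  assumes "L2 M f" "L2 M g"
  shows "l2 M f \<le> l2 M g + l2 M (\<lambda>x. f x - g x)"
  using l2_triangle[OF assms(2) L2_diff[OF assms]] by simp

lemma l2_tendsto:
  assumes f: "L2 M f" "\<And>n. L2 M (F n)" "(\<lambda>n. l2 M (\<lambda>x. F n x - f x)) \<longlonglongrightarrow> 0"
  shows "(\<lambda>n. l2 M (F n)) \<longlonglongrightarrow> l2 M f"
proof (rule LIM_zero_cancel, rule Lim_null_comparison[OF _ f(3)])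
  show "\<forall>\<^sub>F n in sequentially. norm (l2 M (F n) - l2 M f) \<le> l2 M (\<lambda>x. F n x - f x)"
  proof (rule always_eventually, rule allI)
    fix n
    show "norm (l2 M (F n) - l2 M f) \<le> l2 M (\<lambda>x. F n x - f x)"
      using l2_le_diff[OF f(1) f(2)[of n]] l2_le_diff[OF f(2)[of n] f(1)] l2_minus_commute[of M f "F n"]
      by (auto simp: abs_if)
  qed
qed

lemma L2_inner_tendsto:
  assumes f: "L2 M f" "\<And>n. L2 M (F n)" "(\<lambda>n. l2 M (\<lambda>x. F n x - f x)) \<longlonglongrightarrow> 0"
    and g: "L2 M g" "\<And>n. L2 M (G n)" "(\<lambda>n. l2 M (\<lambda>x. G n x - g x)) \<longlonglongrightarrow> 0"
  shows "(\<lambda>n. \<integral>x. F n x \<bullet> G n x \<partial>M) \<longlonglongrightarrow> (\<integral>x. f x \<bullet> g x \<partial>M)"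
proof (rule LIM_zero_cancel, rule Lim_null_comparison)
  let ?e = "\<lambda>n. l2 M (\<lambda>x. F n x - f x) * l2 M (G n) + l2 M f * l2 M (\<lambda>x. G n x - g x)"
  show "?e \<longlonglongrightarrow> 0"
    using tendsto_add[OF tendsto_mult[OF f(3) l2_tendsto[OF g]] tendsto_mult[OF tendsto_const g(3)], of "l2 M f"]
    by simp
  show "\<forall>\<^sub>F n in sequentially. norm ((\<integral>x. F n x \<bullet> G n x \<partial>M) - (\<integral>x. f x \<bullet> g x \<partial>M)) \<le> ?e n"
  proof (rule always_eventually, rule allI)
    fix n
    have "(\<integral>x. F n x \<bullet> G n x \<partial>M) - (\<integral>x. f x \<bullet> g x \<partial>M)
        = (\<integral>x. (F n x - f x) \<bullet> G n x \<partial>M) + (\<integral>x. f x \<bullet> (G n x - g x) \<partial>M)"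
      using L2_inner_integrable[OF f(2)[of n] g(2)[of n]] L2_inner_integrable[OF f(1) g(1)]
        L2_inner_integrable[OF f(1) g(2)[of n]]
      by (simp add: inner_diff_left inner_diff_right)
    also have "norm \<dots> \<le> ?e n"
      unfolding real_norm_def
      by (rule order_trans[OF abs_triangle_ineq])
        (intro add_mono L2_Cauchy_Schwarz L2_diff f g)
    finally show "norm ((\<integral>x. F n x \<bullet> G n x \<partial>M) - (\<integral>x. f x \<bullet> g x \<partial>M)) \<le> ?e n" .
  qed
qed

lemma L2_inner_tendsto_real:
  fixes f g :: "'a \<Rightarrow> real"
  assumes "L2 M f" "\<And>n. L2 M (F n)" "(\<lambda>n. l2 M (\<lambda>x. F n x - f x)) \<longlonglongrightarrow> 0"
    and "L2 M g" "\<And>n. L2 M (G n)" "(\<lambda>n. l2 M (\<lambda>x. G n x - g x)) \<longlonglongrightarrow> 0"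
  shows "(\<lambda>n. \<integral>x. F n x * G n x \<partial>M) \<longlonglongrightarrow> (\<integral>x. f x * g x \<partial>M)"
  using L2_inner_tendsto[OF assms] by (simp add: inner_real_def)

lemma L2_Cauchy_Schwarz_real:
  fixes f g :: "'a \<Rightarrow> real"
  assumes f: "L2 M f" and g: "L2 M g"
  shows "\<bar>\<integral>x. f x * g x \<partial>M\<bar> \<le> l2 M f * l2 M g"
  using L2_Cauchy_Schwarz[OF assms] by (simp add: inner_real_def)

lemma L2_mult_integrable:
  fixes f g :: "'a \<Rightarrow> real"
  shows "L2 M f \<Longrightarrow> L2 M g \<Longrightarrow> integrable M (\<lambda>x. f x * g x)"
  using L2_inner_integrable[of M f g] by (simp add: inner_real_def)

text \<open>Fatou's lemma as lower semicontinuity of the norm. Membership of the limit is part of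
  the conclusion, which \<open>L2_complete\<close> uses to identify its limit.\<close>

lemma L2_Fatou:
  fixes F :: "nat \<Rightarrow> 'a \<Rightarrow> 'b::euclidean_space"
  assumes F: "\<And>n. L2 M (F n)" and f: "f \<in> borel_measurable M"
    and lim: "AE x in M. (\<lambda>n. F n x) \<longlonglongrightarrow> f x"
    and B: "\<forall>\<^sub>F n in sequentially. l2 M (F n) \<le> B" and "0 \<le> B"
  shows "L2 M f" "l2 M f \<le> B"
proof -
  have mF [measurable]: "F n \<in> borel_measurable M" for n using F L2_measurable by blast
  note f [measurable]
  have "(\<integral>\<^sup>+x. ennreal ((norm (f x))\<^sup>2) \<partial>M) = (\<integral>\<^sup>+x. liminf (\<lambda>n. ennreal ((norm (F n x))\<^sup>2)) \<partial>M)"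
  proof (rule nn_integral_cong_AE)
    show "AE x in M. ennreal ((norm (f x))\<^sup>2) = liminf (\<lambda>n. ennreal ((norm (F n x))\<^sup>2))"
      using lim
    proof eventually_elim
      case (elim x)
      then have "(\<lambda>n. ennreal ((norm (F n x))\<^sup>2)) \<longlonglongrightarrow> ennreal ((norm (f x))\<^sup>2)"
        by (intro tendsto_intros tendsto_ennrealI)
      from lim_imp_Liminf[OF sequentially_bot this] show ?case by (rule sym)
    qed
  qed
  also have "\<dots> \<le> liminf (\<lambda>n. \<integral>\<^sup>+x. ennreal ((norm (F n x))\<^sup>2) \<partial>M)"
    by (rule nn_integral_liminf) measurable
  also have "\<dots> \<le> ennreal (B\<^sup>2)"
  proof (rule Liminf_le)
    show "\<forall>\<^sub>F n in sequentially. (\<integral>\<^sup>+x. ennreal ((norm (F n x))\<^sup>2) \<partial>M) \<le> ennreal (B\<^sup>2)"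
      using B
    proof eventually_elim
      case (elim n)
      have "(\<integral>\<^sup>+x. ennreal ((norm (F n x))\<^sup>2) \<partial>M) = ennreal ((l2 M (F n))\<^sup>2)"
        using F[of n] by (subst nn_integral_eq_integral) (auto simp: L2_def l2_square)
      also have "\<dots> \<le> ennreal (B\<^sup>2)"
        by (intro ennreal_leI power_mono elim) simp
      finally show ?case .
    qed
  qed simp
  finally have le: "(\<integral>\<^sup>+x. ennreal ((norm (f x))\<^sup>2) \<partial>M) \<le> ennreal (B\<^sup>2)" .
  have i: "integrable M (\<lambda>x. (norm (f x))\<^sup>2)"
    by (rule integrableI_bounded) (use le_less_trans[OF le ennreal_less_top] in auto)
  then show "L2 M f" using f by (simp add: L2_def)
  have "ennreal (\<integral>x. (norm (f x))\<^sup>2 \<partial>M) \<le> ennreal (B\<^sup>2)"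
    using le by (subst (asm) nn_integral_eq_integral[OF i]) auto
  then have "(l2 M f)\<^sup>2 \<le> B\<^sup>2" by (simp add: l2_square)
  then show "l2 M f \<le> B" using \<open>0 \<le> B\<close> power2_le_imp_le by blast
qed

text \<open>Riesz-Fischer: a subsequence with geometrically small increments converges almost
  everywhere, and Fatou along it controls the distance of every late member to the limit.\<close>

lemma L2_complete:
  fixes F :: "nat \<Rightarrow> 'a \<Rightarrow> 'b::euclidean_space"
  assumes F: "\<And>n. L2 M (F n)"
    and Cauchy: "\<And>e. e > 0 \<Longrightarrow> \<exists>N. \<forall>m\<ge>N. \<forall>n\<ge>N. l2 M (\<lambda>x. F m x - F n x) \<le> e"
  obtains f where "L2 M f" "(\<lambda>n. l2 M (\<lambda>x. F n x - f x)) \<longlonglongrightarrow> 0"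
proof -
  have mF [measurable]: "F n \<in> borel_measurable M" for n using F L2_measurable by blast
  have "\<exists>N. \<forall>k. (\<forall>m\<ge>N k. \<forall>n\<ge>N k. l2 M (\<lambda>x. F m x - F n x) \<le> (1/2) ^ k)"
    using Cauchy[of "(1/2) ^ _"] by (intro choice allI) simp
  then obtain N where N: "\<And>k m n. m \<ge> N k \<Longrightarrow> n \<ge> N k \<Longrightarrow> l2 M (\<lambda>x. F m x - F n x) \<le> (1/2) ^ k"
    by blast
  \<comment> \<open>The sum makes the indices monotone and at least \<open>N k\<close>; the added k
    makes them at least k, so the subsequence eventually passes any index.\<close>
  define s where "s k = (\<Sum>i\<le>k. N i) + k" for k
  have sN: "N k \<le> s k" for k
    unfolding s_def using member_le_sum[of k "{..k}" N] by simp
  have smono: "s k \<le> s (Suc k)" and sk: "k \<le> s k" for k by (simp_all add: s_def)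
  define d where "d k x = F (s (Suc k)) x - F (s k) x" for k x
  have dL2: "L2 M (d k)" for k unfolding d_def[abs_def] by (intro L2_diff F)
  then have [measurable]: "d k \<in> borel_measurable M" for k using L2_measurable by blast
  have dl2: "l2 M (d k) \<le> (1/2) ^ k" for k
    unfolding d_def[abs_def] by (intro N) (meson sN smono order_trans)+
  \<comment> \<open>The squared norms are at most 4^-k, so even with the weight 2^k their sum is
    finite. The weight is what later turns summable squares into a summable sequence.\<close>
  have "(\<integral>\<^sup>+x. (\<Sum>k. ennreal (2 ^ k * (norm (d k x))\<^sup>2)) \<partial>M) = (\<Sum>k. \<integral>\<^sup>+x. ennreal (2 ^ k * (norm (d k x))\<^sup>2) \<partial>M)"
    by (rule nn_integral_suminf) measurable
  also have "\<dots> \<le> (\<Sum>k. ennreal ((1/2) ^ k))"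
  proof (rule suminf_le)
    fix k
    have "(\<integral>\<^sup>+x. ennreal (2 ^ k * (norm (d k x))\<^sup>2) \<partial>M) = ennreal (2 ^ k * (l2 M (d k))\<^sup>2)"
      using dL2[of k] by (subst nn_integral_eq_integral) (auto simp: L2_def l2_square)
    also have "\<dots> \<le> ennreal (2 ^ k * ((1/2) ^ k)\<^sup>2)"
      by (intro ennreal_leI mult_left_mono power_mono dl2) auto
    also have "2 ^ k * ((1/2) ^ k)\<^sup>2 = ((1/2) ^ k :: real)"
      by (simp add: power2_eq_square power_one_over)
    finally show "(\<integral>\<^sup>+x. ennreal (2 ^ k * (norm (d k x))\<^sup>2) \<partial>M) \<le> ennreal ((1/2) ^ k)" .
  qed auto
  also have "\<dots> < \<infinity>"
    by (subst suminf_ennreal2) (simp_all add: summable_geometric less_top[symmetric])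
  finally have fin: "AE x in M. (\<Sum>k. ennreal (2 ^ k * (norm (d k x))\<^sup>2)) \<noteq> \<infinity>"
    by (intro nn_integral_noteq_infinite) auto
  have conv: "AE x in M. convergent (\<lambda>k. F (s k) x)"
    using fin
  proof eventually_elim
    case (elim x)
    have "summable (\<lambda>k. 2 ^ k * (norm (d k x))\<^sup>2)"
      using elim by (intro summable_suminf_not_top) auto
    then have sm: "summable (\<lambda>k. (1/2) ^ k + 2 ^ k * (norm (d k x))\<^sup>2)"
      by (intro summable_add summable_geometric) auto
    have "summable (\<lambda>k. d k x)"
    proof (rule summable_comparison_test'[OF sm])
      fix k :: nat
      let ?a = "norm (d k x)"
      \<comment> \<open>Either \<open>?a\<close> is below 2^-k, or 2^k times \<open>?a\<close> is at
        least 1 and the weighted square dominates.\<close>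
      have "?a \<le> (1/2) ^ k + 2 ^ k * ?a\<^sup>2"
      proof (cases "?a \<le> (1/2) ^ k")
        case True
        then show ?thesis by (simp add: add_increasing2)
      next
        case False
        then have "1 \<le> 2 ^ k * ?a" by (simp add: field_simps power_one_over)
        then have "?a * 1 \<le> ?a * (2 ^ k * ?a)" by (intro mult_left_mono) auto
        then have "?a \<le> 2 ^ k * ?a\<^sup>2" by (simp add: power2_eq_square algebra_simps)
        then show ?thesis by (simp add: add_increasing)
      qed
      then show "norm (d k x) \<le> (1/2) ^ k + 2 ^ k * (norm (d k x))\<^sup>2" by simp
    qed
    then have "convergent (\<lambda>n. (\<Sum>k<n. d k x) + F (s 0) x)"
      using summable_iff_convergent convergent_add convergent_const by blast
    moreover have "(\<Sum>k<n. d k x) = F (s n) x - F (s 0) x" for n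
      unfolding d_def by (rule sum_lessThan_telescope)
    ultimately show ?case by simp
  qed
  define f where "f x = lim (\<lambda>k. F (s k) x)" for x
  have mf [measurable]: "f \<in> borel_measurable M"
    unfolding f_def[abs_def] by measurable
  have lim: "AE x in M. (\<lambda>k. F (s k) x) \<longlonglongrightarrow> f x"
    using conv by eventually_elim (simp add: f_def convergent_LIMSEQ_iff)
  have tail: "L2 M (\<lambda>x. F n x - f x) \<and> l2 M (\<lambda>x. F n x - f x) \<le> (1/2) ^ k" if n: "n \<ge> N k" for n k
  proof -
    have "L2 M (\<lambda>x. F n x - f x)" "l2 M (\<lambda>x. F n x - f x) \<le> (1/2) ^ k"
    proof (rule_tac[!] L2_Fatou[where F = "\<lambda>j x. F n x - F (s j) x" and B = "(1/2) ^ k"])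
      show ev: "\<forall>\<^sub>F j in sequentially. l2 M (\<lambda>x. F n x - F (s j) x) \<le> (1/2) ^ k"
        using eventually_ge_at_top[of "N k"]
      proof eventually_elim
        case (elim j)
        show ?case by (rule N[OF n]) (use sk[of j] elim in linarith)
      qed
      show "\<forall>\<^sub>F j in sequentially. l2 M (\<lambda>x. F n x - F (s j) x) \<le> (1/2) ^ k" by (rule ev)
      show "AE x in M. (\<lambda>j. F n x - F (s j) x) \<longlonglongrightarrow> F n x - f x"
        using lim by eventually_elim (intro tendsto_intros)
      then show "AE x in M. (\<lambda>j. F n x - F (s j) x) \<longlonglongrightarrow> F n x - f x" .
    qed (auto intro: L2_diff F)
    then show ?thesis by blast
  qed
  have "L2 M f"
    using L2_diff[OF F[of "N 0"] tail[of 0 "N 0", THEN conjunct1]] by simp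
  moreover have "(\<lambda>n. l2 M (\<lambda>x. F n x - f x)) \<longlonglongrightarrow> 0"
  proof (rule LIMSEQ_I)
    fix e :: real assume "e > 0"
    then obtain k where k: "(1/2) ^ k < e"
      using real_arch_pow_inv[of e "1/2"] by auto
    show "\<exists>no. \<forall>n\<ge>no. norm (l2 M (\<lambda>x. F n x - f x) - 0) < e"
      using tail[of k] k by (intro exI[of _ "N k"]) fastforce
  qed
  ultimately show thesis by (rule that)
qed

subsection \<open>Differentiation under the integral sign\<close>

text \<open>Dominated convergence for difference quotients, bounded by \<open>G\<close> through the
  mean value theorem. Measurability of \<open>F' t0\<close> is a consequence, since it is a
  pointwise limit of integrable quotients.\<close>

lemma integral_has_real_derivative:
  fixes F :: "real \<Rightarrow> 'a \<Rightarrow> real"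
  assumes "\<delta> > 0"
    and der: "\<And>t x. \<bar>t - t0\<bar> < \<delta> \<Longrightarrow> ((\<lambda>t. F t x) has_real_derivative F' t x) (at t)"
    and bd: "\<And>t x. \<bar>t - t0\<bar> < \<delta> \<Longrightarrow> \<bar>F' t x\<bar> \<le> G x"
    and G: "integrable M G" and F: "\<And>t. \<bar>t - t0\<bar> < \<delta> \<Longrightarrow> integrable M (F t)"
  shows "integrable M (F' t0)"
    and "((\<lambda>t. \<integral>x. F t x \<partial>M) has_real_derivative (\<integral>x. F' t0 x \<partial>M)) (at t0)"
proof -
  \<comment> \<open>Replacing a quotient by 0 when its increment is too large makes the domination
    hold for every index; the limit does not notice.\<close>
  define s where "s X i x = (if \<bar>X i\<bar> < \<delta> then (F (t0 + X i) x - F t0 x) / X i else 0)"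
    for X :: "nat \<Rightarrow> real" and i x
  have s_int: "integrable M (s X i)" for X i
    unfolding s_def[abs_def] using F[of "t0 + X i"] F[of t0] \<open>\<delta> > 0\<close>
    by (cases "\<bar>X i\<bar> < \<delta>") auto
  have s_lim: "(\<lambda>i. s X i x) \<longlonglongrightarrow> F' t0 x" if X: "\<And>i. X i \<noteq> 0" "X \<longlonglongrightarrow> 0" for X x
  proof (rule Lim_transform_eventually)
    have "((\<lambda>h. (F (t0 + h) x - F t0 x) / h) \<longlongrightarrow> F' t0 x) (at 0)"
      using der[of t0 x] \<open>\<delta> > 0\<close> by (simp add: DERIV_def)
    then show "(\<lambda>i. (F (t0 + X i) x - F t0 x) / X i) \<longlonglongrightarrow> F' t0 x"
      using X by (auto simp: tendsto_at_iff_sequentially o_def)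
    have "\<forall>\<^sub>F i in sequentially. \<bar>X i\<bar> < \<delta>"
      using order_tendstoD(2)[OF tendsto_rabs_zero[OF X(2)] \<open>\<delta> > 0\<close>] .
    then show "\<forall>\<^sub>F i in sequentially. (F (t0 + X i) x - F t0 x) / X i = s X i x"
      by eventually_elim (simp add: s_def)
  qed
  have G0: "0 \<le> G x" for x
    using bd[of t0 x] \<open>\<delta> > 0\<close> abs_ge_zero order_trans by (metis abs_zero diff_self)
  have s_bd: "\<bar>s X i x\<bar> \<le> G x" if "X i \<noteq> 0" for X i x
  proof (cases "\<bar>X i\<bar> < \<delta>")
    case True
    define h where "h = X i"
    have h: "h \<noteq> 0" "\<bar>h\<bar> < \<delta>" using that True by (auto simp: h_def)
    have "\<bar>F (t0 + h) x - F t0 x\<bar> \<le> G x * \<bar>h\<bar>"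
    proof -
      have "norm (F (t0 + h) x - F t0 x) \<le> G x * norm (t0 + h - t0)"
      proof (rule field_differentiable_bound[where S = "ball t0 \<delta>" and f' = "\<lambda>t. F' t x"])
        show "((\<lambda>t. F t x) has_field_derivative F' z x) (at z within ball t0 \<delta>)"
          and "norm (F' z x) \<le> G x" if "z \<in> ball t0 \<delta>" for z
        proof -
          have z: "\<bar>z - t0\<bar> < \<delta>" using that by (simp add: dist_real_def abs_minus_commute)
          show "((\<lambda>t. F t x) has_field_derivative F' z x) (at z within ball t0 \<delta>)"
            by (rule has_field_derivative_at_within[OF der[OF z]])
          show "norm (F' z x) \<le> G x" using bd[OF z] by simp
        qed
        show "t0 + h \<in> ball t0 \<delta>" "t0 \<in> ball t0 \<delta>"
          using h \<open>\<delta> > 0\<close> by (simp_all add: dist_real_def)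
      qed simp
      then show ?thesis by simp
    qed
    then show ?thesis using h by (simp add: s_def h_def field_simps)
  qed (simp add: s_def G0)
  \<comment> \<open>One concrete null sequence avoiding 0, used to see that the derivative is
    measurable.\<close>
  define X0 where "X0 i = 1 / real (Suc i)" for i
  have X0: "X0 i \<noteq> 0" "X0 \<longlonglongrightarrow> 0" for i
    using LIMSEQ_Suc[OF lim_1_over_n] by (auto simp: X0_def[abs_def])
  have m: "F' t0 \<in> borel_measurable M"
    by (rule borel_measurable_LIMSEQ_metric[of "s X0"]) (use s_int s_lim[OF X0] in auto)
  show "integrable M (F' t0)"
    by (rule Bochner_Integration.integrable_bound[OF G m]) (use bd[of t0] \<open>\<delta> > 0\<close> G0 in auto)
  show "((\<lambda>t. \<integral>x. F t x \<partial>M) has_real_derivative (\<integral>x. F' t0 x \<partial>M)) (at t0)"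
    unfolding DERIV_def tendsto_at_iff_sequentially
  proof (intro allI impI)
    fix X :: "nat \<Rightarrow> real"
    assume "\<forall>i. X i \<in> UNIV - {0}" "X \<longlonglongrightarrow> 0"
    then have X: "\<And>i. X i \<noteq> 0" "X \<longlonglongrightarrow> 0" by auto
    have "(\<lambda>i. \<integral>x. s X i x \<partial>M) \<longlonglongrightarrow> (\<integral>x. F' t0 x \<partial>M)"
      by (rule integral_dominated_convergence[OF m _ G])
        (use s_int s_lim[OF X] s_bd[OF X(1)] in auto)
    moreover have "\<forall>\<^sub>F i in sequentially. (\<integral>x. s X i x \<partial>M)
        = ((\<lambda>h. ((\<integral>x. F (t0 + h) x \<partial>M) - (\<integral>x. F t0 x \<partial>M)) / h) \<circ> X) i"
      using order_tendstoD(2)[OF tendsto_rabs_zero[OF X(2)] \<open>\<delta> > 0\<close>]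
    proof eventually_elim
      case (elim i)
      then show ?case
        using F[of "t0 + X i"] F[of t0] \<open>\<delta> > 0\<close> by (simp add: s_def)
    qed
    ultimately show "((\<lambda>h. ((\<integral>x. F (t0 + h) x \<partial>M) - (\<integral>x. F t0 x \<partial>M)) / h) \<circ> X)
        \<longlonglongrightarrow> (\<integral>x. F' t0 x \<partial>M)"
      by (rule Lim_transform_eventually)
  qed
qed

subsection \<open>Integrals over the whole space\<close>

lemma lborel_integral_translation:
  fixes f :: "'a::euclidean_space \<Rightarrow> 'b::euclidean_space"
  assumes "f \<in> borel_measurable borel"
  shows "(\<integral>x. f (x + c) \<partial>lborel) = (\<integral>x. f x \<partial>lborel)"
proof -
  have "(\<integral>x. f x \<partial>lborel) = (\<integral>x. f x \<partial>distr lborel borel ((+) c))"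
    by (simp add: lborel_distr_plus)
  also have "\<dots> = (\<integral>x. f (c + x) \<partial>lborel)"
    by (rule integral_distr) (use assms in auto)
  finally show ?thesis by (simp add: add.commute)
qed

lemma lborel_integral_affine:
  fixes f :: "'a::euclidean_space \<Rightarrow> real"
  assumes [measurable]: "f \<in> borel_measurable borel" and "c > 0"
  shows "(\<integral>x. f x \<partial>lborel) = c ^ DIM('a) * (\<integral>x. f (t + c *\<^sub>R x) \<partial>lborel)"
proof -
  have "(\<integral>x. f x \<partial>lborel)
      = (\<integral>x. f x \<partial>density (distr lborel borel (\<lambda>x. t + c *\<^sub>R x)) (\<lambda>_. ennreal (\<bar>c\<bar> ^ DIM('a))))"
    using lborel_affine[of c t] \<open>c > 0\<close> by simp
  also have "\<dots> = c ^ DIM('a) * (\<integral>x. f (t + c *\<^sub>R x) \<partial>lborel)"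
    using \<open>c > 0\<close> by (subst integral_real_density) (auto simp: integral_distr)
  finally show ?thesis .
qed

lemma integrable_compact_support:
  fixes f :: "'a::euclidean_space \<Rightarrow> 'b::euclidean_space"
  assumes "continuous_on UNIV f" "compact K" "\<And>x. x \<notin> K \<Longrightarrow> f x = 0"
  shows "integrable lborel f"
proof -
  have "integrable lborel (\<lambda>x. indicator K x *\<^sub>R f x)"
    by (rule borel_integrable_compact[OF assms(2) continuous_on_subset[OF assms(1)]]) simp
  also have "(\<lambda>x. indicator K x *\<^sub>R f x) = f"
    using assms(3) by (auto simp: indicator_def)
  finally show ?thesis .
qed

lemma bounded_compact_support:
  fixes f :: "'a::euclidean_space \<Rightarrow> 'b::euclidean_space"
  assumes "continuous_on UNIV f" "compact K" "\<And>x. x \<notin> K \<Longrightarrow> f x = 0"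
  obtains B where "B > 0" "\<And>x. norm (f x) \<le> B"
proof -
  have "compact (f ` K)"
    using assms compact_continuous_image continuous_on_subset by blast
  then obtain B where "B > 0" "\<forall>y\<in>f ` K. norm y \<le> B"
    using compact_imp_bounded bounded_pos by metis
  then show thesis
    using assms(3) by (intro that[of B]) (metis image_eqI norm_zero less_imp_le)+
qed

lemma L2_compact_support:
  fixes f :: "'a::euclidean_space \<Rightarrow> 'b::euclidean_space"
  assumes "continuous_on UNIV f" "compact K" "\<And>x. x \<notin> K \<Longrightarrow> f x = 0"
  shows "L2 lborel f"
  unfolding L2_def
proof
  show "f \<in> borel_measurable lborel"
    using assms(1) borel_measurable_continuous_onI by simp
  show "integrable lborel (\<lambda>x. (norm (f x))\<^sup>2)"
    by (rule integrable_compact_support[of _ K]) (use assms in \<open>auto intro!: continuous_intros\<close>)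
qed

text \<open>The integral of a translate does not depend on the translation, while its derivative in
  the direction \<open>b\<close> is the integral of the partial derivative.\<close>

lemma integral_pd_eq_0:
  fixes f :: "'a::euclidean_space \<Rightarrow> real"
  assumes f: "smooth f" and K: "compact K" "\<And>x. x \<notin> K \<Longrightarrow> f x = 0" and b: "b \<in> Basis"
  shows "(\<integral>x. pd b f x \<partial>lborel) = 0"
proof -
  have c: "continuous_on UNIV f" "continuous_on UNIV (pd b f)"
    using f b smooth_continuous_on smooth_pd by blast+
  have pd0: "pd b f x = 0" if "x \<notin> K" for x
    using gradient_zero_outside[OF compact_imp_closed[OF K(1)] K(2) that] b gradient_inner[of b f x] by simp
  obtain B where B: "\<And>x. norm (pd b f x) \<le> B"
    using bounded_compact_support[OF c(2) K(1) pd0] by metis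
  obtain R where R: "\<And>x. x \<in> K \<Longrightarrow> norm x \<le> R"
    using compact_imp_bounded[OF K(1)] bounded_iff by metis
  have der: "((\<lambda>t. f (x + t *\<^sub>R b)) has_real_derivative pd b f (x + t *\<^sub>R b)) (at t)" for t x
  proof -
    let ?D = "frechet_derivative f (at (x + t *\<^sub>R b))"
    have 1: "((\<lambda>t. x + t *\<^sub>R b) has_derivative (\<lambda>h. h *\<^sub>R b)) (at t)"
      by (auto intro!: derivative_eq_intros)
    have D: "(f has_derivative ?D) (at (x + t *\<^sub>R b))"
      using differentiable_has_derivative_pd[OF smooth_differentiable[OF f]] by blast
    have "((\<lambda>t. f (x + t *\<^sub>R b)) has_derivative (\<lambda>h. ?D (h *\<^sub>R b))) (at t)"
      using has_derivative_compose[OF 1 D] .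
    moreover have "?D (h *\<^sub>R b) = pd b f (x + t *\<^sub>R b) * h" for h
      using has_derivative_linear[OF D] by (simp add: linear_scale pd_def)
    ultimately show ?thesis
      by (simp add: has_field_derivative_def)
  qed
  have tr: "f \<in> borel_measurable borel"
    using c(1) by (rule borel_measurable_continuous_onI)
  have int: "integrable lborel (\<lambda>x. f (x + t *\<^sub>R b))" for t
  proof (rule integrable_compact_support)
    show "continuous_on UNIV (\<lambda>x. f (x + t *\<^sub>R b))"
      by (intro continuous_on_compose2[OF c(1)] continuous_intros) auto
    show "compact ((\<lambda>x. x - t *\<^sub>R b) ` K)"
      by (intro compact_continuous_image K(1) continuous_intros)
    show "f (x + t *\<^sub>R b) = 0" if "x \<notin> (\<lambda>x. x - t *\<^sub>R b) ` K" for x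
      using K(2)[of "x + t *\<^sub>R b"] that image_eqI[of x "\<lambda>x. x - t *\<^sub>R b" "x + t *\<^sub>R b" K] by auto
  qed
  \<comment> \<open>For parameters below 1 in modulus the translated supports stay in the ball of
    radius \<open>R + 1\<close>, which gives the integrable majorant.\<close>
  have "((\<lambda>t. \<integral>x. f (x + t *\<^sub>R b) \<partial>lborel) has_real_derivative (\<integral>x. pd b f (x + 0 *\<^sub>R b) \<partial>lborel)) (at 0)"
  proof (rule integral_has_real_derivative(2)[where \<delta> = 1 and G = "\<lambda>x. B * indicator (cball (0::'a) (R + 1)) x"])
    show "\<bar>pd b f (x + t *\<^sub>R b)\<bar> \<le> B * indicator (cball (0::'a) (R + 1)) x" if "\<bar>t - 0\<bar> < 1" for t x
    proof (cases "norm x \<le> R + 1")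
      case False
      have "norm x \<le> norm (x + t *\<^sub>R b) + norm (t *\<^sub>R b)"
        using norm_triangle_ineq4[of "x + t *\<^sub>R b" "t *\<^sub>R b"] by simp
      then have "norm (x + t *\<^sub>R b) > R" using False that b by simp
      then have "x + t *\<^sub>R b \<notin> K" using R by fastforce
      then show ?thesis using pd0 False by simp
    qed (use B in simp)
    show "integrable lborel (\<lambda>x. B * indicator (cball (0::'a) (R + 1)) x)"
      by (intro integrable_mult_right integrable_real_indicator) (use emeasure_lborel_cball_finite[of "0::'a" "R + 1"] in auto)
  qed (use der int in auto)
  moreover have "(\<integral>x. f (x + t *\<^sub>R b) \<partial>lborel) = (\<integral>x. f x \<partial>lborel)" for t
    by (rule lborel_integral_translation[OF tr])
  ultimately show ?thesis
    using DERIV_unique[OF _ DERIV_const] by simp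
qed

text \<open>Vanishing is required of the products only, so one factor may be smooth without compact
  support.\<close>

lemma integral_by_parts:
  fixes f g :: "'a::euclidean_space \<Rightarrow> real"
  assumes f: "smooth f" and g: "smooth g"
    and K: "compact K" "\<And>x. x \<notin> K \<Longrightarrow> f x * g x = 0" "\<And>x. x \<notin> K \<Longrightarrow> pd b f x * g x = 0"
      "\<And>x. x \<notin> K \<Longrightarrow> f x * pd b g x = 0" and b: "b \<in> Basis"
  shows "(\<integral>x. f x * pd b g x \<partial>lborel) = - (\<integral>x. pd b f x * g x \<partial>lborel)"
proof -
  have "0 = (\<integral>x. pd b (\<lambda>x. f x * g x) x \<partial>lborel)"
    by (rule integral_pd_eq_0[symmetric, OF smooth_mult[OF f g] K(1) K(2) b])
  also have "\<dots> = (\<integral>x. f x * pd b g x + pd b f x * g x \<partial>lborel)"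
    using f g smooth_differentiable by (auto intro!: Bochner_Integration.integral_cong pd_mult)
  also have "\<dots> = (\<integral>x. f x * pd b g x \<partial>lborel) + (\<integral>x. pd b f x * g x \<partial>lborel)"
    by (intro Bochner_Integration.integral_add integrable_compact_support[OF _ K(1)])
      (use K(3,4) in \<open>auto intro!: continuous_on_mult smooth_continuous_on[OF f] smooth_continuous_on[OF g]
         smooth_continuous_on[OF smooth_pd[OF f b]] smooth_continuous_on[OF smooth_pd[OF g b]]\<close>)
  finally show ?thesis by simp
qed

text \<open>Testing the increment against itself turns the derivative bound into a bound for the
  increment without a double integral.\<close>

lemma l2_increment_le:
  fixes \<Phi> \<Psi> :: "real \<Rightarrow> 'a::euclidean_space \<Rightarrow> real"
  assumes ab: "l < a" "a < b" "b < u"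
    and der: "\<And>t x. l < t \<Longrightarrow> t < u \<Longrightarrow> ((\<lambda>t. \<Phi> t x) has_real_derivative \<Psi> t x) (at t)"
    and cont: "\<And>t. l < t \<Longrightarrow> t < u \<Longrightarrow> continuous_on UNIV (\<Phi> t)" "\<And>t. l < t \<Longrightarrow> t < u \<Longrightarrow> continuous_on UNIV (\<Psi> t)"
    and K: "compact K" "\<And>t x. l < t \<Longrightarrow> t < u \<Longrightarrow> x \<notin> K \<Longrightarrow> \<Phi> t x = 0"
      "\<And>t x. l < t \<Longrightarrow> t < u \<Longrightarrow> x \<notin> K \<Longrightarrow> \<Psi> t x = 0"
    and bd: "\<And>t x. l < t \<Longrightarrow> t < u \<Longrightarrow> \<bar>\<Psi> t x\<bar> \<le> B"
    and c: "\<And>t. a < t \<Longrightarrow> t < b \<Longrightarrow> l2 lborel (\<Psi> t) \<le> c"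
  shows "l2 lborel (\<lambda>x. \<Phi> b x - \<Phi> a x) \<le> (b - a) * c"
proof -
  define g where "g x = \<Phi> b x - \<Phi> a x" for x
  have contg: "continuous_on UNIV g"
    unfolding g_def[abs_def] using ab by (intro continuous_intros cont) auto
  have g0: "g x = 0" if "x \<notin> K" for x
    using K(2) that ab by (simp add: g_def)
  have gL2: "L2 lborel g"
    by (rule L2_compact_support[OF contg K(1) g0])
  have \<Phi>L2: "L2 lborel (\<Phi> t)" if "l < t" "t < u" for t
    by (rule L2_compact_support[OF cont(1)[OF that] K(1) K(2)[OF that]])
  have \<Psi>L2: "L2 lborel (\<Psi> t)" if "l < t" "t < u" for t
    by (rule L2_compact_support[OF cont(2)[OF that] K(1) K(3)[OF that]])
  define P where "P t = (\<integral>x. g x * \<Phi> t x \<partial>lborel)" for t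
  have P: "(P has_real_derivative (\<integral>x. g x * \<Psi> t x \<partial>lborel)) (at t)" if t: "l < t" "t < u" for t
    unfolding P_def[abs_def]
  proof (rule integral_has_real_derivative(2)[where \<delta> = "min (t - l) (u - t)" and G = "\<lambda>x. \<bar>g x\<bar> * B"])
    show "integrable lborel (\<lambda>x. \<bar>g x\<bar> * B)"
      by (rule integrable_compact_support[OF _ K(1)]) (simp_all add: g0 continuous_on_mult_right continuous_on_rabs contg)
    fix s assume s: "\<bar>s - t\<bar> < min (t - l) (u - t)"
    then have su: "l < s" "s < u" by auto
    show "((\<lambda>t. g x * \<Phi> t x) has_real_derivative g x * \<Psi> s x) (at s)" for x
      by (intro DERIV_cmult der su)
    show "\<bar>g x * \<Psi> s x\<bar> \<le> \<bar>g x\<bar> * B" for x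
      unfolding abs_mult by (intro mult_left_mono bd su) auto
    show "integrable lborel (\<lambda>x. g x * \<Phi> s x)"
      by (intro L2_mult_integrable gL2 \<Phi>L2 su)
  qed (use t in auto)
  obtain z where z: "a < z" "z < b" "P b - P a = (b - a) * (\<integral>x. g x * \<Psi> z x \<partial>lborel)"
    using MVT2[OF ab(2), of P "\<lambda>t. \<integral>x. g x * \<Psi> t x \<partial>lborel"] P ab by auto
  have "P b - P a = (\<integral>x. g x * g x \<partial>lborel)"
    unfolding P_def using ab
    by (subst Bochner_Integration.integral_diff[symmetric])
      (auto intro!: L2_mult_integrable gL2 \<Phi>L2 simp: g_def algebra_simps)
  then have "(l2 lborel g)\<^sup>2 = P b - P a"
    by (simp add: l2_square_real)
  also have "\<dots> \<le> (b - a) * (l2 lborel g * c)"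
  proof -
    have "(\<integral>x. g x * \<Psi> z x \<partial>lborel) \<le> l2 lborel g * l2 lborel (\<Psi> z)"
      using L2_Cauchy_Schwarz_real[OF gL2 \<Psi>L2[of z]] z ab by auto
    also have "\<dots> \<le> l2 lborel g * c"
      by (intro mult_left_mono c z) auto
    finally show ?thesis using z ab by (simp add: mult_left_mono)
  qed
  finally have *: "l2 lborel g * l2 lborel g \<le> l2 lborel g * ((b - a) * c)"
    by (simp add: power2_eq_square algebra_simps)
  have c0: "0 \<le> c" using c[OF z(1,2)] l2_nonneg order_trans by blast
  show ?thesis
  proof (cases "l2 lborel g = 0")
    case True
    then show ?thesis using c0 ab by (simp add: g_def[abs_def])
  next
    case False
    then have "l2 lborel g > 0" using l2_nonneg[of lborel g] by linarith
    with * show ?thesis by (simp add: g_def[abs_def])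
  qed
qed

subsection \<open>Weak gradients\<close>

lemma borel_measurable_lebesgue_on:
  "f \<in> borel_measurable borel \<Longrightarrow> f \<in> borel_measurable (lebesgue_on D)"
  by (intro measurable_restrict_space1 measurable_completion) simp

text \<open>The bridge between the two settings: weak gradients live on
  \<open>lebesgue_on D\<close>, whereas translations and dilations act on
  \<open>lborel\<close>.\<close>

lemma lebesgue_on_integral_support:
  fixes f :: "'a::euclidean_space \<Rightarrow> 'b::euclidean_space"
  assumes "f \<in> borel_measurable borel" "open D" "\<And>x. x \<notin> D \<Longrightarrow> f x = 0"
  shows "integral\<^sup>L (lebesgue_on D) f = integral\<^sup>L lborel f"
    and "integrable (lebesgue_on D) f \<longleftrightarrow> integrable lborel f"
proof -
  have D: "D \<inter> space lebesgue \<in> sets lebesgue" using assms(2) by simp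
  have eq: "(\<lambda>x. indicator D x *\<^sub>R f x) = f"
    using assms(3) by (auto simp: indicator_def)
  show "integral\<^sup>L (lebesgue_on D) f = integral\<^sup>L lborel f"
    using integral_restrict_space[OF D, of f] assms(1) by (simp add: eq integral_completion)
  show "integrable (lebesgue_on D) f \<longleftrightarrow> integrable lborel f"
    using integrable_restrict_space[OF D, of f] assms(1) by (simp add: eq integrable_completion)
qed

lemma L2_lebesgue_on_support:
  fixes f :: "'a::euclidean_space \<Rightarrow> 'b::euclidean_space"
  assumes f: "f \<in> borel_measurable borel" and D: "open D" "\<And>x. x \<notin> D \<Longrightarrow> f x = 0"
  shows "L2 (lebesgue_on D) f \<longleftrightarrow> L2 lborel f" "l2 (lebesgue_on D) f = l2 lborel f"
proof -
  have m: "(\<lambda>x. (norm (f x))\<^sup>2) \<in> borel_measurable borel" using f by measurable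
  show "L2 (lebesgue_on D) f \<longleftrightarrow> L2 lborel f" "l2 (lebesgue_on D) f = l2 lborel f"
    using lebesgue_on_integral_support[OF m D(1)] D(2) f borel_measurable_lebesgue_on[OF f]
    by (simp_all add: L2_def l2_def)
qed

lemma test_function_L2:
  assumes "\<phi> \<in> test_functions D"
  shows "L2 lborel \<phi>" "L2 lborel (gradient \<phi>)"
proof -
  obtain K where K: "compact K" "\<And>x. x \<notin> K \<Longrightarrow> \<phi> x = 0" "\<And>x. x \<notin> K \<Longrightarrow> gradient \<phi> x = 0"
    using test_functionsE[OF assms] by metis
  note s = test_functions_smooth[OF assms]
  show "L2 lborel \<phi>" by (rule L2_compact_support[OF smooth_continuous_on[OF s] K(1,2)])
  show "L2 lborel (gradient \<phi>)" by (rule L2_compact_support[OF smooth_gradient_continuous[OF s] K(1,3)])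
qed

lemma test_function_borel:
  assumes "\<phi> \<in> test_functions D"
  shows "\<phi> \<in> borel_measurable borel" "gradient \<phi> \<in> borel_measurable borel"
  using test_function_L2[OF assms, THEN L2_measurable] by simp_all

lemma test_function_lebesgue_on:
  assumes "\<phi> \<in> test_functions D" and D: "open D"
  shows "L2 (lebesgue_on D) \<phi>" "L2 (lebesgue_on D) (gradient \<phi>)"
    "l2 (lebesgue_on D) \<phi> = l2 lborel \<phi>" "l2 (lebesgue_on D) (gradient \<phi>) = l2 lborel (gradient \<phi>)"
proof -
  obtain K where "K \<subseteq> D" "\<And>x. x \<notin> K \<Longrightarrow> \<phi> x = 0" "\<And>x. x \<notin> K \<Longrightarrow> gradient \<phi> x = 0"
    using test_functionsE[OF assms(1)] by metis
  then have 0: "\<And>x. x \<notin> D \<Longrightarrow> \<phi> x = 0" "\<And>x. x \<notin> D \<Longrightarrow> gradient \<phi> x = 0" by auto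
  show "L2 (lebesgue_on D) \<phi>" "L2 (lebesgue_on D) (gradient \<phi>)"
    "l2 (lebesgue_on D) \<phi> = l2 lborel \<phi>" "l2 (lebesgue_on D) (gradient \<phi>) = l2 lborel (gradient \<phi>)"
    using L2_lebesgue_on_support[OF test_function_borel(1)[OF assms(1)] D 0(1)]
      L2_lebesgue_on_support[OF test_function_borel(2)[OF assms(1)] D 0(2)]
      test_function_L2[OF assms(1)] by blast+
qed

lemma test_functions_parts:
  assumes f: "f \<in> test_functions D" and g: "smooth g" and b: "b \<in> Basis" and D: "open D"
  shows "(\<integral>x. f x * (gradient g x \<bullet> b) \<partial>lebesgue_on D) = - (\<integral>x. (gradient f x \<bullet> b) * g x \<partial>lebesgue_on D)"
proof -
  obtain K where K: "compact K" "K \<subseteq> D" "\<And>x. x \<notin> K \<Longrightarrow> f x = 0" "\<And>x. x \<notin> K \<Longrightarrow> gradient f x = 0"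
    using test_functionsE[OF f] by metis
  note sf = test_functions_smooth[OF f]
  have c: "continuous_on UNIV f" "continuous_on UNIV (pd b f)" "continuous_on UNIV g" "continuous_on UNIV (pd b g)"
    using sf g b smooth_continuous_on smooth_pd by blast+
  have m: "(\<lambda>x. f x * pd b g x) \<in> borel_measurable borel" "(\<lambda>x. pd b f x * g x) \<in> borel_measurable borel"
    by (intro borel_measurable_continuous_onI continuous_on_mult c)+
  have pf: "pd b f x = 0" if "x \<notin> K" for x
    using K(4)[OF that] gradient_inner[OF b, of f x] by simp
  have "(\<integral>x. f x * pd b g x \<partial>lborel) = - (\<integral>x. pd b f x * g x \<partial>lborel)"
    by (rule integral_by_parts[OF sf g K(1)]) (use K(3) pf b in auto)
  moreover have "f x * pd b g x = 0" "pd b f x * g x = 0" if "x \<notin> D" for x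
    using K(2,3) pf that by auto
  ultimately show ?thesis
    using lebesgue_on_integral_support(1)[OF m(1) D] lebesgue_on_integral_support(1)[OF m(2) D]
    by (simp add: gradient_inner[OF b])
qed

lemma has_weak_gradient_limit:
  assumes D: "open D" and u: "L2 (lebesgue_on D) u" and g: "L2 (lebesgue_on D) g"
    and \<psi>: "\<And>n::nat. \<psi> n \<in> test_functions D"
    and lim: "(\<lambda>n. l2 (lebesgue_on D) (\<lambda>x. \<psi> n x - u x)) \<longlonglongrightarrow> 0"
      "(\<lambda>n. l2 (lebesgue_on D) (\<lambda>x. gradient (\<psi> n) x - g x)) \<longlonglongrightarrow> 0"
  shows "has_weak_gradient D u g"
  unfolding has_weak_gradient_def square_integrable_L2
proof (intro conjI u g ballI)
  fix \<phi> b assume \<phi>: "\<phi> \<in> test_functions D" and b: "(b::'a) \<in> Basis"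
  let ?M = "lebesgue_on D"
  note \<phi>L = test_function_lebesgue_on[OF \<phi> D]
  note \<psi>L = test_function_lebesgue_on[OF \<psi> D]
  have L: "L2 ?M (\<lambda>x. \<phi> x *\<^sub>R b)"
    using \<phi>L(1) by (simp add: L2_def power_mult_distrib b borel_measurable_scaleR)
  have L': "L2 ?M (\<lambda>x. gradient \<phi> x \<bullet> b)"
  proof -
    have "(\<lambda>x. gradient \<phi> x \<bullet> b) \<in> borel_measurable ?M"
      using L2_measurable[OF \<phi>L(2)] by measurable
    moreover have "integrable ?M (\<lambda>x. (norm (gradient \<phi> x \<bullet> b))\<^sup>2)"
    proof (rule Bochner_Integration.integrable_bound[OF L2_square_integrable[OF \<phi>L(2)]])
      show "(\<lambda>x. (norm (gradient \<phi> x \<bullet> b))\<^sup>2) \<in> borel_measurable ?M"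
        using L2_measurable[OF \<phi>L(2)] by measurable
      show "AE x in ?M. norm ((norm (gradient \<phi> x \<bullet> b))\<^sup>2) \<le> norm ((norm (gradient \<phi> x))\<^sup>2)"
        using Basis_le_norm[OF b] by (auto intro!: power_mono simp: abs_le_square_iff[symmetric])
    qed
    ultimately show ?thesis by (simp add: L2_def)
  qed
  have "(\<lambda>n. \<integral>x. \<psi> n x * (gradient \<phi> x \<bullet> b) \<partial>?M) \<longlonglongrightarrow> (\<integral>x. u x * (gradient \<phi> x \<bullet> b) \<partial>?M)"
    by (rule L2_inner_tendsto_real[OF u \<psi>L(1) lim(1) L' L']) (simp add: l2_def)
  moreover have "(\<lambda>n. \<integral>x. \<psi> n x * (gradient \<phi> x \<bullet> b) \<partial>?M) = (\<lambda>n. - (\<integral>x. gradient (\<psi> n) x \<bullet> (\<phi> x *\<^sub>R b) \<partial>?M))"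
    using test_functions_parts[OF \<psi> test_functions_smooth[OF \<phi>] b D] by (simp add: mult.commute)
  moreover have "(\<lambda>n. - (\<integral>x. gradient (\<psi> n) x \<bullet> (\<phi> x *\<^sub>R b) \<partial>?M)) \<longlonglongrightarrow> - (\<integral>x. g x \<bullet> (\<phi> x *\<^sub>R b) \<partial>?M)"
    by (intro tendsto_minus L2_inner_tendsto[OF g \<psi>L(2) lim(2) L L]) (simp add: l2_def)
  ultimately show "(\<integral>x. u x * (gradient \<phi> x \<bullet> b) \<partial>?M) = - (\<integral>x. (g x \<bullet> b) * \<phi> x \<partial>?M)"
    using LIMSEQ_unique by (fastforce simp: mult.commute)
qed

section \<open>Fundamental lemma of the calculus of variations and uniqueness of weak
  gradients\<close>

definition box_bump :: "'a::euclidean_space \<Rightarrow> 'a \<Rightarrow> nat \<Rightarrow> 'a \<Rightarrow> real" where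
  "box_bump a c n z = (\<Prod>b\<in>Basis. flat 0 (real (Suc n) * (z \<bullet> b - a \<bullet> b)) * flat 0 (real (Suc n) * (c \<bullet> b - z \<bullet> b)))"

lemma box_bump_outside: "z \<notin> box a c \<Longrightarrow> box_bump a c n z = 0"
  by (force simp: box_bump_def mem_box flat_nonpos not_less mult_nonneg_nonpos)

lemma box_bump_bounds: "0 \<le> box_bump a c n z" "box_bump a c n z \<le> 1"
  by (auto simp: box_bump_def flat_0_nonneg flat_0_le_1 intro!: prod_nonneg prod_le_1 mult_le_one)

lemma box_bump_test_function: "cbox a c \<subseteq> D \<Longrightarrow> box_bump a c n \<in> test_functions D"
  unfolding test_functions_iff
proof (intro conjI exI[of _ "cbox a c"])
  show "smooth (box_bump a c n)"
    unfolding box_bump_def[abs_def]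
    by (intro smooth_prod smooth_mult smooth_flat_comp smooth_diff smooth_const smooth_inner_left)
  show "\<forall>x. x \<notin> cbox a c \<longrightarrow> box_bump a c n x = 0"
    using box_subset_cbox[of a c] by (blast intro: box_bump_outside)
qed auto

text \<open>Inside the open box every factor is exp (- 1 / ((n + 1) s)) with fixed s > 0 and tends
  to 1; outside, the product is 0 for every n.\<close>

lemma box_bump_tendsto: "(\<lambda>n. box_bump a c n z) \<longlonglongrightarrow> indicator (box a c) z"
proof (cases "z \<in> box a c")
  case True
  have 1: "(\<lambda>n. flat 0 (real (Suc n) * s)) \<longlonglongrightarrow> 1" if "s > 0" for s
  proof -
    have "(\<lambda>n. exp (- ((1 / s) * (1 / real (Suc n))))) \<longlonglongrightarrow> exp (- ((1 / s) * 0))"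
      by (intro tendsto_intros LIMSEQ_Suc lim_1_over_n)
    then show ?thesis using that by (simp add: flat_0 mult.commute)
  qed
  have "(\<lambda>n. box_bump a c n z) \<longlonglongrightarrow> (\<Prod>b\<in>(Basis::'a set). 1 * 1)"
    unfolding box_bump_def using True
    by (intro tendsto_prod tendsto_mult 1) (auto simp: mem_box)
  then show ?thesis using True by simp
qed (simp add: box_bump_outside)

text \<open>Open boxes form an intersection-stable generator of the Borel sets, and the sets over
  which \<open>f\<close> integrates to 0 form a Dynkin system.\<close>

lemma AE_zero_if_box_integrals_zero:
  fixes f :: "'a::euclidean_space \<Rightarrow> real"
  assumes f: "integrable lborel f" and box: "\<And>a b. (LINT x:box a b|lborel. f x) = 0"
  shows "AE x in lborel. f x = 0"
proof (rule sigma_finite_measure.density_zero[OF sigma_finite_lborel f])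
  fix A :: "'a set" assume A: "A \<in> sets lborel"
  have si: "set_integrable lborel B f" if "B \<in> sets lborel" for B
    using integrable_mult_indicator[OF that f] by (simp add: set_integrable_def)
  \<comment> \<open>The case of complements needs the integral over the whole space, which is the
    limit over growing boxes.\<close>
  have U: "(LINT x|lborel. f x) = 0"
  proof -
    let ?B = "\<lambda>n::nat. box (- real n *\<^sub>R One) (real n *\<^sub>R One) :: 'a set"
    have "(\<lambda>n. LINT x|lborel. indicator (?B n) x *\<^sub>R f x) \<longlonglongrightarrow> (LINT x|lborel. f x)"
    proof (rule integral_dominated_convergence[where w = "\<lambda>x. \<bar>f x\<bar>"])
      show "AE x in lborel. (\<lambda>n. indicator (?B n) x *\<^sub>R f x) \<longlonglongrightarrow> f x"
      proof (rule AE_I2, rule tendsto_eventually)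
        fix x :: 'a
        have "x \<in> ?B n" if "n > norm x" for n
          unfolding mem_box
        proof
          fix i :: 'a assume i: "i \<in> Basis"
          show "- real n *\<^sub>R One \<bullet> i < x \<bullet> i \<and> x \<bullet> i < real n *\<^sub>R One \<bullet> i"
          proof -
            have "\<bar>x \<bullet> i\<bar> < real n" using Basis_le_norm[OF i, of x] that by linarith
            then show ?thesis using i by (auto simp: abs_less_iff)
          qed
        qed
        moreover have "\<forall>\<^sub>F n in sequentially. real n > norm x"
          using filterlim_real_sequentially unfolding filterlim_at_top_dense by blast
        ultimately have "\<forall>\<^sub>F n in sequentially. x \<in> ?B n"
          by (auto elim!: eventually_mono simp del: mem_box)
        then show "\<forall>\<^sub>F n in sequentially. indicator (?B n) x *\<^sub>R f x = f x"
          by eventually_elim (simp del: mem_box)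
      qed
    qed (use f in \<open>auto simp: indicator_def\<close>)
    then show ?thesis
      using box by (simp add: set_lebesgue_integral_def LIMSEQ_const_iff)
  qed
  have sig: "A \<in> sigma_sets UNIV (range (\<lambda>(a, b). box a b))"
    using A by (simp add: borel_eq_box)
  have st: "Int_stable (range (\<lambda>(a, b). box a b :: 'a set))"
    by (auto simp: Int_stable_def box_Int_box)
  have pw: "range (\<lambda>(a, b). box a b :: 'a set) \<subseteq> Pow UNIV" by simp
  from st pw sig show "(LINT x:A|lborel. f x) = 0"
  proof (induction rule: sigma_sets_induct_disjoint)
    case (basic A)
    then show ?case using box by auto
  next
    case empty
    then show ?case by (simp add: set_lebesgue_integral_def)
  next
    case (compl A)
    then have A: "A \<in> sets lborel" by (simp add: borel_eq_box)
    have "(LINT x:UNIV - A|lborel. f x) = (LINT x|lborel. f x - indicator A x *\<^sub>R f x)"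
      unfolding set_lebesgue_integral_def
      by (rule Bochner_Integration.integral_cong) (auto simp: indicator_def)
    also have "\<dots> = 0"
      using U compl f si[OF A] by (simp add: set_lebesgue_integral_def set_integrable_def)
    finally show ?case .
  next
    case (union A)
    then have A: "A i \<in> sets lborel" for i by (auto simp: borel_eq_box)
    have "(LINT x:(\<Union>i. A i)|lborel. f x) = (\<Sum>i. (LINT x:(A i)|lborel. f x))"
      by (rule lebesgue_integral_countable_add)
        (use A union(1) in \<open>auto simp: disjoint_family_on_def intro!: si\<close>)
    then show ?case using union by simp
  qed
qed

text \<open>Smooth box bumps approximate indicators of boxes whose closure lies in \<open>D\<close>;
  such boxes cover \<open>D\<close> countably. Within one of them \<open>h\<close> is exchanged for
  a Borel version, so that the criterion over \<open>lborel\<close> applies.\<close>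

lemma fundamental_lemma_calculus_variations:
  fixes h :: "'a::euclidean_space \<Rightarrow> real"
  assumes D: "open D" and h: "L2 (lebesgue_on D) h"
    and zero: "\<And>\<phi>. \<phi> \<in> test_functions D \<Longrightarrow> (\<integral>x. h x * \<phi> x \<partial>lebesgue_on D) = 0"
  shows "AE x in lebesgue_on D. h x = 0"
proof -
  let ?M = "lebesgue_on D"
  have Ds: "D \<inter> space lebesgue \<in> sets lebesgue" using D by simp
  have ib: "integrable ?M (\<lambda>x. indicator (box c d) x * h x)" if cd: "cbox c d \<subseteq> D" for c d
  proof -
    have "L2 ?M (indicator (box c d) :: 'a \<Rightarrow> real)"
    proof -
      have "L2 lborel (indicator (box c d) :: 'a \<Rightarrow> real)"
        using emeasure_lborel_box_finite[of c d]
        by (auto simp: L2_def power2_eq_square indicator_inter_arith[symmetric])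
      then show ?thesis
        using L2_lebesgue_on_support(1)[of "indicator (box c d) :: 'a \<Rightarrow> real" D] D cd box_subset_cbox[of c d]
        by (auto simp: indicator_def simp del: mem_box)
    qed
    from L2_mult_integrable[OF this h] show ?thesis .
  qed
  have zb: "(\<integral>x. indicator (box c d) x * h x \<partial>?M) = 0" if cd: "cbox c d \<subseteq> D" for c d
  proof -
    have "(\<lambda>n. \<integral>x. h x * box_bump c d n x \<partial>?M) \<longlonglongrightarrow> (\<integral>x. h x * indicator (box c d) x \<partial>?M)"
    proof (rule integral_dominated_convergence[where w = "\<lambda>x. \<bar>indicator (box c d) x * h x\<bar>"])
      show "(\<lambda>x. h x * indicator (box c d) x) \<in> borel_measurable ?M"
        using ib[OF cd] by (simp add: mult.commute)
      show "(\<lambda>x. h x * box_bump c d n x) \<in> borel_measurable ?M" for n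
        using L2_measurable[OF h] borel_measurable_lebesgue_on[OF test_function_borel(1)[OF box_bump_test_function[OF cd]]]
        by measurable
      show "integrable ?M (\<lambda>x. \<bar>indicator (box c d) x * h x\<bar>)"
        using ib[OF cd] by simp
      show "AE x in ?M. (\<lambda>n. h x * box_bump c d n x) \<longlonglongrightarrow> h x * indicator (box c d) x"
        by (intro AE_I2 tendsto_mult tendsto_const box_bump_tendsto)
      show "AE x in ?M. norm (h x * box_bump c d n x) \<le> \<bar>indicator (box c d) x * h x\<bar>" for n
        using box_bump_outside[of _ c d n] box_bump_bounds[of c d n]
        by (intro AE_I2) (auto simp: abs_mult indicator_def intro: mult_right_le_one_le)
    qed
    moreover have "(\<integral>x. h x * box_bump c d n x \<partial>?M) = 0" for n
      by (rule zero[OF box_bump_test_function[OF cd]])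
    ultimately show ?thesis by (simp add: LIMSEQ_const_iff mult.commute)
  qed
  have local: "AE x in lebesgue. x \<in> cbox a b \<longrightarrow> h x = 0" if ab: "cbox a b \<subseteq> D" for a b
  proof -
    define f where "f x = indicator (box a b) x * h x" for x
    have bD: "box a b \<subseteq> D" using ab box_subset_cbox[of a b] by blast
    have fD: "(\<lambda>x. indicator D x *\<^sub>R f x) = f"
      using bD by (intro ext) (auto simp: f_def simp del: mem_box split: split_indicator)
    have fi: "integrable lebesgue f"
      using ib[OF ab] integrable_restrict_space[OF Ds, of f] fD by (simp add: f_def[abs_def])
    then obtain f' where f': "f' \<in> borel_measurable lborel" "AE x in lborel. f x = f' x"
      using completion_ex_borel_measurable_real[of f lborel] by auto
    have ae: "AE x in lebesgue. f x = f' x" using f'(2) by (rule AE_completion)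
    have m': "f' \<in> borel_measurable lebesgue" using f'(1) by (rule measurable_completion)
    have f'i: "integrable lborel f'"
      using integrable_cong_AE[OF _ m' ae] fi integrable_completion[OF f'(1)] by simp
    have "AE x in lborel. f' x = 0"
    proof (rule AE_zero_if_box_integrals_zero[OF f'i])
      fix c d :: 'a
      \<comment> \<open>\<open>p\<close> and \<open>q\<close> are the corners of the intersection of
        the two boxes, which again has its closure inside \<open>D\<close>.\<close>
      define p where "p = (\<Sum>i\<in>Basis. max (c \<bullet> i) (a \<bullet> i) *\<^sub>R i)"
      define q where "q = (\<Sum>i\<in>Basis. min (d \<bullet> i) (b \<bullet> i) *\<^sub>R i)"
      have I: "box c d \<inter> box a b = box p q" "cbox p q \<subseteq> cbox a b"
        by (auto simp: p_def q_def box_Int_box mem_box)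
      have "(LINT x:box c d|lborel. f' x) = (\<integral>x. indicator (box c d) x *\<^sub>R f' x \<partial>lebesgue)"
        unfolding set_lebesgue_integral_def using f'(1) by (subst integral_completion) auto
      also have "\<dots> = (\<integral>x. indicator (box c d) x *\<^sub>R f x \<partial>lebesgue)"
      proof (rule integral_cong_AE)
        show "(\<lambda>x. indicator (box c d) x *\<^sub>R f' x) \<in> borel_measurable lebesgue"
          "(\<lambda>x. indicator (box c d) x *\<^sub>R f x) \<in> borel_measurable lebesgue"
          by (intro borel_measurable_scaleR borel_measurable_indicator m' borel_measurable_integrable[OF fi]; simp)+
        show "AE x in lebesgue. indicator (box c d) x *\<^sub>R f' x = indicator (box c d) x *\<^sub>R f x"
          using ae by eventually_elim simp
      qed
      also have "(\<lambda>x. indicator (box c d) x *\<^sub>R f x) = (\<lambda>x. indicator D x *\<^sub>R (indicator (box p q) x * h x))"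
        unfolding I(1)[symmetric] using bD by (intro ext) (auto simp: f_def simp del: mem_box split: split_indicator)
      also have "(\<integral>x. indicator D x *\<^sub>R (indicator (box p q) x * h x) \<partial>lebesgue) = 0"
        using zb[of p q] I(2) ab integral_restrict_space[OF Ds, of "\<lambda>x. indicator (box p q) x * h x"] by auto
      finally show "(LINT x:box c d|lborel. f' x) = 0" .
    qed
    then have "AE x in lebesgue. f' x = 0" by (rule AE_completion)
    \<comment> \<open>The cover below uses closed boxes, the argument above open ones; the faces are
      a null set.\<close>
    moreover have "AE x in lebesgue. x \<notin> cbox a b - box a b"
      using negligible_frontier_interval[of a b] by (intro AE_not_in) (simp add: negligible_iff_null_sets)
    ultimately show ?thesis
      using ae by eventually_elim (auto simp: f_def simp del: mem_box split: split_indicator_asm)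
  qed
  obtain \<D> where \<D>: "countable \<D>" "\<D> \<subseteq> Pow D" "\<And>X. X \<in> \<D> \<Longrightarrow> \<exists>a b. X = cbox a b" "\<Union>\<D> = D"
    using open_countable_Union_open_cbox[OF D] by metis
  have "AE x in lebesgue. \<forall>X\<in>\<D>. x \<in> X \<longrightarrow> h x = 0"
    unfolding AE_ball_countable[OF \<D>(1)]
  proof
    fix X assume X: "X \<in> \<D>"
    obtain a b where "X = cbox a b" using \<D>(3)[OF X] by blast
    with X \<D>(2) local[of a b] show "AE x in lebesgue. x \<in> X \<longrightarrow> h x = 0" by auto
  qed
  then have "AE x in lebesgue. x \<in> D \<longrightarrow> h x = 0"
    by eventually_elim (use \<D>(4) in auto)
  then show ?thesis using AE_restrict_space_iff[OF Ds] by simp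
qed

lemma weak_gradient_unique:
  assumes D: "open D" and g: "has_weak_gradient D u g" and g': "has_weak_gradient D u g'"
  shows "AE x in lebesgue_on D. g x = g' x"
proof -
  let ?M = "lebesgue_on D"
  have L: "L2 ?M g" "L2 ?M g'"
    using g g' by (auto simp: has_weak_gradient_def square_integrable_L2)
  have "AE x in ?M. (g x - g' x) \<bullet> b = 0" if b: "b \<in> Basis" for b
  proof (rule fundamental_lemma_calculus_variations[OF D])
    have d: "L2 ?M (\<lambda>x. g x - g' x)" by (rule L2_diff[OF L])
    show "L2 ?M (\<lambda>x. (g x - g' x) \<bullet> b)"
      unfolding L2_def
    proof
      show "(\<lambda>x. (g x - g' x) \<bullet> b) \<in> borel_measurable ?M"
        using L2_measurable[OF d] by measurable
      show "integrable ?M (\<lambda>x. (norm ((g x - g' x) \<bullet> b))\<^sup>2)"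
      proof (rule Bochner_Integration.integrable_bound[OF L2_square_integrable[OF d]])
        show "(\<lambda>x. (norm ((g x - g' x) \<bullet> b))\<^sup>2) \<in> borel_measurable ?M"
          using L2_measurable[OF d] by measurable
        show "AE x in ?M. norm ((norm ((g x - g' x) \<bullet> b))\<^sup>2) \<le> norm ((norm (g x - g' x))\<^sup>2)"
          using Basis_le_norm[OF b] by (auto intro!: power_mono simp: abs_le_square_iff[symmetric])
      qed
    qed
    fix \<phi> assume \<phi>: "\<phi> \<in> test_functions D"
    have Lb: "L2 ?M (\<lambda>x. \<phi> x *\<^sub>R b)"
      using test_function_lebesgue_on(1)[OF \<phi> D]
      by (simp add: L2_def power_mult_distrib b borel_measurable_scaleR)
    have i: "integrable ?M (\<lambda>x. (g x \<bullet> b) * \<phi> x)" "integrable ?M (\<lambda>x. (g' x \<bullet> b) * \<phi> x)"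
      using L2_inner_integrable[OF L(1) Lb] L2_inner_integrable[OF L(2) Lb] by (simp_all add: mult.commute)
    have "(\<integral>x. (g x \<bullet> b) * \<phi> x \<partial>?M) = (\<integral>x. (g' x \<bullet> b) * \<phi> x \<partial>?M)"
      using g g' \<phi> b by (auto simp: has_weak_gradient_def)
    then show "(\<integral>x. (g x - g' x) \<bullet> b * \<phi> x \<partial>?M) = 0"
      using i by (simp add: inner_diff_left left_diff_distrib)
  qed
  then have "AE x in ?M. \<forall>b\<in>Basis. (g x - g' x) \<bullet> b = 0"
    by (intro AE_finite_allI) auto
  then show ?thesis
    by eventually_elim (simp add: euclidean_eq_iff[of "g _"] inner_diff_left)
qed

text \<open>The gradient limit is kept explicit, so that \<open>weak_gradient\<close>, defined by choice, is only
  met through its almost everywhere uniqueness.\<close>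

definition H10_grad :: "'a::euclidean_space set \<Rightarrow> ('a \<Rightarrow> real) \<Rightarrow> ('a \<Rightarrow> 'a) \<Rightarrow> bool" where
  "H10_grad D u g \<longleftrightarrow> L2 (lebesgue_on D) u \<and> L2 (lebesgue_on D) g \<and>
     (\<exists>\<psi>. (\<forall>n::nat. \<psi> n \<in> test_functions D) \<and>
       (\<lambda>n. l2 (lebesgue_on D) (\<lambda>x. \<psi> n x - u x)) \<longlonglongrightarrow> 0 \<and>
       (\<lambda>n. l2 (lebesgue_on D) (\<lambda>x. gradient (\<psi> n) x - g x)) \<longlonglongrightarrow> 0)"

lemma H10_gradE:
  assumes "H10_grad D u g"
  obtains \<psi> where "L2 (lebesgue_on D) u" "L2 (lebesgue_on D) g" "\<And>n::nat. \<psi> n \<in> test_functions D"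
    "(\<lambda>n. l2 (lebesgue_on D) (\<lambda>x. \<psi> n x - u x)) \<longlonglongrightarrow> 0"
    "(\<lambda>n. l2 (lebesgue_on D) (\<lambda>x. gradient (\<psi> n) x - g x)) \<longlonglongrightarrow> 0"
  using assms unfolding H10_grad_def by blast

lemma H10_grad_test_function:
  assumes "\<phi> \<in> test_functions D" "open D"
  shows "H10_grad D \<phi> (gradient \<phi>)"
  unfolding H10_grad_def using assms test_function_lebesgue_on[OF assms]
  by (intro conjI exI[of _ "\<lambda>_. \<phi>"]) (auto simp: l2_def)

lemma H10_H10_grad:
  assumes D: "open D" and u: "u \<in> H10 D"
  shows "H10_grad D u (weak_gradient D u)"
proof -
  let ?M = "lebesgue_on D" and ?g = "weak_gradient D u"
  have w: "has_weak_gradient D u ?g"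
    using u unfolding weak_gradient_def H10_def H1_def by (metis (mono_tags, lifting) mem_Collect_eq someI_ex)
  then have L: "L2 ?M u" "L2 ?M ?g"
    by (auto simp: has_weak_gradient_def square_integrable_L2)
  obtain \<phi> where \<phi>: "\<And>n::nat. \<phi> n \<in> test_functions D" and
    lim: "(\<lambda>n. \<integral>x. (u x - \<phi> n x)\<^sup>2 + (norm (?g x - gradient (\<phi> n) x))\<^sup>2 \<partial>?M) \<longlonglongrightarrow> 0"
    using u unfolding H10_def by blast
  note \<phi>L = test_function_lebesgue_on[OF \<phi> D]
  have eq: "(\<integral>x. (u x - \<phi> n x)\<^sup>2 + (norm (?g x - gradient (\<phi> n) x))\<^sup>2 \<partial>?M)
     = (l2 ?M (\<lambda>x. \<phi> n x - u x))\<^sup>2 + (l2 ?M (\<lambda>x. gradient (\<phi> n) x - ?g x))\<^sup>2" for n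
  proof -
    have "integrable ?M (\<lambda>x. (u x - \<phi> n x)\<^sup>2)" "integrable ?M (\<lambda>x. (norm (?g x - gradient (\<phi> n) x))\<^sup>2)"
      using L2_square_integrable[OF L2_diff[OF L(1) \<phi>L(1)[of n]]]
        L2_square_integrable[OF L2_diff[OF L(2) \<phi>L(2)[of n]]] by simp_all
    then show ?thesis
      by (simp add: l2_square power2_commute[of "u _"] norm_minus_commute[of "?g _"])
  qed
  have lim0: "(\<lambda>n. sqrt (\<integral>x. (u x - \<phi> n x)\<^sup>2 + (norm (?g x - gradient (\<phi> n) x))\<^sup>2 \<partial>?M)) \<longlonglongrightarrow> 0"
    using tendsto_real_sqrt[OF lim] by simp
  have "(\<lambda>n. l2 ?M (\<lambda>x. \<phi> n x - u x)) \<longlonglongrightarrow> 0" "(\<lambda>n. l2 ?M (\<lambda>x. gradient (\<phi> n) x - ?g x)) \<longlonglongrightarrow> 0"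
    by (rule Lim_null_comparison[OF _ lim0], simp add: eq real_le_rsqrt)+
  then show ?thesis using L \<phi> unfolding H10_grad_def by blast
qed

text \<open>Converse of \<open>H10_H10_grad\<close>. A limit of test gradients is a weak gradient,
  hence agrees almost everywhere with the one picked by choice, and the same sequence then converges
  to that one.\<close>

lemma H10_grad_weak_gradient:
  assumes D: "open D" and u: "H10_grad D u g"
  shows "u \<in> H10 D" "AE x in lebesgue_on D. weak_gradient D u x = g x"
proof -
  let ?M = "lebesgue_on D"
  obtain \<psi> where \<psi>: "L2 ?M u" "L2 ?M g" "\<And>n::nat. \<psi> n \<in> test_functions D"
    "(\<lambda>n. l2 ?M (\<lambda>x. \<psi> n x - u x)) \<longlonglongrightarrow> 0" "(\<lambda>n. l2 ?M (\<lambda>x. gradient (\<psi> n) x - g x)) \<longlonglongrightarrow> 0"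
    using H10_gradE[OF u] by blast
  have w: "has_weak_gradient D u g"
    by (rule has_weak_gradient_limit[OF D \<psi>])
  then have w': "has_weak_gradient D u (weak_gradient D u)"
    unfolding weak_gradient_def by (rule someI[of "has_weak_gradient D u"])
  show ae: "AE x in ?M. weak_gradient D u x = g x"
    by (rule weak_gradient_unique[OF D w' w])
  note \<psi>L = test_function_lebesgue_on[OF \<psi>(3) D]
  have eq: "(\<integral>x. (u x - \<psi> n x)\<^sup>2 + (norm (weak_gradient D u x - gradient (\<psi> n) x))\<^sup>2 \<partial>?M)
     = (l2 ?M (\<lambda>x. \<psi> n x - u x))\<^sup>2 + (l2 ?M (\<lambda>x. gradient (\<psi> n) x - g x))\<^sup>2" for n
  proof -
    have "(\<integral>x. (u x - \<psi> n x)\<^sup>2 + (norm (weak_gradient D u x - gradient (\<psi> n) x))\<^sup>2 \<partial>?M)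
      = (\<integral>x. (u x - \<psi> n x)\<^sup>2 + (norm (g x - gradient (\<psi> n) x))\<^sup>2 \<partial>?M)"
      by (rule integral_cong_AE)
        (use ae w' \<psi>(1,2) \<psi>L(1,2)[of n] in \<open>auto simp: L2_def has_weak_gradient_def square_integrable_L2 elim!: eventually_mono\<close>)
    moreover have "integrable ?M (\<lambda>x. (u x - \<psi> n x)\<^sup>2)" "integrable ?M (\<lambda>x. (norm (g x - gradient (\<psi> n) x))\<^sup>2)"
      using L2_square_integrable[OF L2_diff[OF \<psi>(1) \<psi>L(1)[of n]]]
        L2_square_integrable[OF L2_diff[OF \<psi>(2) \<psi>L(2)[of n]]] by simp_all
    ultimately show ?thesis
      by (simp add: l2_square power2_commute[of "u _"] norm_minus_commute[of "g _"])
  qed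
  have "(\<lambda>n. \<integral>x. (u x - \<psi> n x)\<^sup>2 + (norm (weak_gradient D u x - gradient (\<psi> n) x))\<^sup>2 \<partial>?M) \<longlonglongrightarrow> 0\<^sup>2 + 0\<^sup>2"
    unfolding eq by (intro tendsto_intros \<psi>)
  then show "u \<in> H10 D"
    using w \<psi>(3) unfolding H10_def H1_def by auto
qed

lemma integral_weak_gradient_inner:
  assumes D: "open D" and u: "H10_grad D u g" and v: "H10_grad D v k"
  shows "(\<integral>x. weak_gradient D u x \<bullet> weak_gradient D v x \<partial>lebesgue_on D) = (\<integral>x. g x \<bullet> k x \<partial>lebesgue_on D)"
proof (rule integral_cong_AE)
  note w = H10_grad_weak_gradient[OF D u] H10_grad_weak_gradient[OF D v]
  have "L2 (lebesgue_on D) (weak_gradient D u)" "L2 (lebesgue_on D) (weak_gradient D v)"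
    using H10_H10_grad[OF D] w by (auto simp: H10_grad_def)
  then show "(\<lambda>x. weak_gradient D u x \<bullet> weak_gradient D v x) \<in> borel_measurable (lebesgue_on D)"
    by (auto dest!: L2_measurable)
  show "(\<lambda>x. g x \<bullet> k x) \<in> borel_measurable (lebesgue_on D)"
    using u v by (auto simp: H10_grad_def L2_def)
  show "AE x in lebesgue_on D. weak_gradient D u x \<bullet> weak_gradient D v x = g x \<bullet> k x"
    using w(2,4) by eventually_elim simp
qed

lemma H_form_eq:
  assumes D: "open D" and u: "H10_grad D u g"
  shows "H_form D \<mu> u = (l2 (lebesgue_on D) g)\<^sup>2 - \<mu> * (l2 (lebesgue_on D) u)\<^sup>2"
proof -
  let ?M = "lebesgue_on D"
  have i: "integrable ?M (\<lambda>x. (norm (weak_gradient D u x))\<^sup>2)" "integrable ?M (\<lambda>x. (u x)\<^sup>2)"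
    using H10_H10_grad[OF D H10_grad_weak_gradient(1)[OF D u]] by (auto simp: H10_grad_def L2_def)
  have "(\<integral>x. (norm (weak_gradient D u x))\<^sup>2 \<partial>?M) = (l2 ?M g)\<^sup>2"
    using integral_weak_gradient_inner[OF D u u] by (simp add: l2_square power2_norm_eq_inner)
  then show ?thesis
    using i by (simp add: H_form_def l2_square)
qed

text \<open>Density: an identity tested with smooth functions passes to all of the energy space,
  because both sides are continuous in the L2 norms.\<close>

lemma H10_grad_inner_limit:
  assumes "open D" "H10_grad D u g"
    and eq: "\<And>\<phi>. \<phi> \<in> test_functions D \<Longrightarrow>
      (\<integral>x. p x \<bullet> gradient \<phi> x \<partial>lebesgue_on D) = (\<integral>x. q x * \<phi> x \<partial>lebesgue_on D)"
    and p: "L2 (lebesgue_on D) p" and q: "L2 (lebesgue_on D) q"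
  shows "(\<integral>x. p x \<bullet> g x \<partial>lebesgue_on D) = (\<integral>x. q x * u x \<partial>lebesgue_on D)"
proof -
  let ?M = "lebesgue_on D"
  obtain \<psi> where \<psi>: "L2 ?M u" "L2 ?M g" "\<And>n::nat. \<psi> n \<in> test_functions D"
    "(\<lambda>n. l2 ?M (\<lambda>x. \<psi> n x - u x)) \<longlonglongrightarrow> 0" "(\<lambda>n. l2 ?M (\<lambda>x. gradient (\<psi> n) x - g x)) \<longlonglongrightarrow> 0"
    using H10_gradE[OF assms(2)] by blast
  note \<psi>L = test_function_lebesgue_on[OF \<psi>(3) assms(1)]
  have "(\<lambda>n. \<integral>x. p x \<bullet> gradient (\<psi> n) x \<partial>?M) \<longlonglongrightarrow> (\<integral>x. p x \<bullet> g x \<partial>?M)"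
    by (rule L2_inner_tendsto[OF p p _ \<psi>(2) \<psi>L(2) \<psi>(5)]) (simp add: l2_def)
  moreover have "(\<lambda>n. \<integral>x. q x * \<psi> n x \<partial>?M) \<longlonglongrightarrow> (\<integral>x. q x * u x \<partial>?M)"
    by (rule L2_inner_tendsto_real[OF q q _ \<psi>(1) \<psi>L(1) \<psi>(4)]) (simp add: l2_def)
  ultimately show ?thesis
    using eq[OF \<psi>(3)] LIMSEQ_unique by auto
qed

subsection \<open>Translations and the compact embedding into the square integrable functions\<close>

lemma l2_translation:
  assumes "f \<in> borel_measurable borel"
  shows "l2 lborel (\<lambda>x. f (x + c)) = l2 lborel f"
proof -
  have "(\<lambda>x. (norm (f x))\<^sup>2) \<in> borel_measurable borel" using assms by measurable
  from lborel_integral_translation[OF this, of c] show ?thesis by (simp add: l2_def)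
qed

lemma L2_translation:
  assumes f: "L2 lborel f"
  shows "L2 lborel (\<lambda>x. f (x + c))"
proof -
  have "integrable lborel (\<lambda>x. (norm (f x))\<^sup>2)" and m: "f \<in> borel_measurable borel" using f by (auto simp: L2_def)
  then have "integrable (distr lborel borel ((+) c)) (\<lambda>x. (norm (f x))\<^sup>2)"
    by (simp add: lborel_distr_plus)
  then have "integrable lborel (\<lambda>x. (norm (f (x + c)))\<^sup>2)"
    by (subst (asm) integrable_distr_eq) (use m in \<open>auto simp: add.commute\<close>)
  moreover have "(\<lambda>x. f (x + c)) \<in> borel_measurable lborel"
    using m by measurable
  ultimately show ?thesis by (simp add: L2_def)
qed

lemma has_real_derivative_along_line:
  assumes "f differentiable (at (x + t *\<^sub>R z))"
  shows "((\<lambda>t. f (x + t *\<^sub>R z)) has_real_derivative gradient f (x + t *\<^sub>R z) \<bullet> z) (at t)"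
proof -
  have 1: "((\<lambda>t. x + t *\<^sub>R z) has_derivative (\<lambda>h. h *\<^sub>R z)) (at t)"
    by (auto intro!: derivative_eq_intros)
  have "((\<lambda>t. f (x + t *\<^sub>R z)) has_derivative (\<lambda>h. gradient f (x + t *\<^sub>R z) \<bullet> (h *\<^sub>R z))) (at t)"
    using has_derivative_compose[OF 1 gradient_has_derivative[OF assms]] .
  then show ?thesis by (simp add: has_field_derivative_def mult.commute[of _ "_ \<bullet> _"])
qed

text \<open>The path from \<open>\<phi>\<close> to its translate has speed at most
  \<open>norm z\<close> times a translated gradient, whose norm does not change along the
  path.\<close>

lemma l2_translation_diff_le:
  assumes \<phi>: "\<phi> \<in> test_functions (D :: 'a::euclidean_space set)"
  shows "l2 lborel (\<lambda>x. \<phi> (x + z) - \<phi> x) \<le> norm z * l2 lborel (gradient \<phi>)"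
proof -
  obtain K where K: "compact K" "\<And>x. x \<notin> K \<Longrightarrow> \<phi> x = 0" "\<And>x. x \<notin> K \<Longrightarrow> gradient \<phi> x = 0"
    using test_functionsE[OF \<phi>] by metis
  note s = test_functions_smooth[OF \<phi>]
  note c = smooth_continuous_on[OF s, of UNIV] smooth_gradient_continuous[OF s, of UNIV]
  obtain R where R: "\<And>x. x \<in> K \<Longrightarrow> norm x \<le> R"
    using compact_imp_bounded[OF K(1)] bounded_iff by metis
  obtain B where B: "B > 0" "\<And>x. norm (gradient \<phi> x) \<le> B"
    using bounded_compact_support[OF c(2) K(1,3)] by metis
  \<comment> \<open>The parameter runs over an open interval around [0, 1] so that differentiation
    is also available at the end points; the factor 2 bounds it there.\<close>
  have out: "x + t *\<^sub>R z \<notin> K" if "-1 < t" "t < 2" "x \<notin> cball 0 (R + 2 * norm z)" for t x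
  proof
    assume "x + t *\<^sub>R z \<in> K"
    then have "norm (x + t *\<^sub>R z) \<le> R" by (rule R)
    moreover have "norm x \<le> norm (x + t *\<^sub>R z) + norm (t *\<^sub>R z)"
      using norm_triangle_ineq4[of "x + t *\<^sub>R z" "t *\<^sub>R z"] by simp
    moreover have "norm (t *\<^sub>R z) \<le> 2 * norm z"
      using that by (auto intro!: mult_right_mono)
    ultimately show False using that by simp
  qed
  have "l2 lborel (\<lambda>x. \<phi> (x + 1 *\<^sub>R z) - \<phi> (x + 0 *\<^sub>R z)) \<le> (1 - 0) * (norm z * l2 lborel (gradient \<phi>))"
  proof (rule l2_increment_le[where l = "-1" and u = 2 and \<Psi> = "\<lambda>t x. gradient \<phi> (x + t *\<^sub>R z) \<bullet> z"
        and K = "cball 0 (R + 2 * norm z)" and B = "B * norm z"])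
    show "((\<lambda>t. \<phi> (x + t *\<^sub>R z)) has_real_derivative gradient \<phi> (x + t *\<^sub>R z) \<bullet> z) (at t)" for t x
      by (rule has_real_derivative_along_line[OF smooth_differentiable[OF s]])
    show "continuous_on UNIV (\<lambda>x. \<phi> (x + t *\<^sub>R z))" for t
      by (intro continuous_on_compose2[OF c(1)] continuous_intros) auto
    show "continuous_on UNIV (\<lambda>x. gradient \<phi> (x + t *\<^sub>R z) \<bullet> z)" for t
      by (intro continuous_on_inner continuous_on_const continuous_on_compose2[OF c(2)] continuous_intros) auto
    show "\<bar>gradient \<phi> (x + t *\<^sub>R z) \<bullet> z\<bar> \<le> B * norm z" for t x
      by (rule order_trans[OF Cauchy_Schwarz_ineq2]) (simp add: B mult_right_mono)
    show "l2 lborel (\<lambda>x. gradient \<phi> (x + t *\<^sub>R z) \<bullet> z) \<le> norm z * l2 lborel (gradient \<phi>)" for t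
    proof -
      have g: "L2 lborel (\<lambda>x. gradient \<phi> (x + t *\<^sub>R z))"
        by (rule L2_translation[OF test_function_L2(2)[OF \<phi>]])
      have "l2 lborel (\<lambda>x. gradient \<phi> (x + t *\<^sub>R z) \<bullet> z) \<le> norm z * l2 lborel (\<lambda>x. gradient \<phi> (x + t *\<^sub>R z))"
      proof (rule L2_le(2)[OF g])
        show "(\<lambda>x. gradient \<phi> (x + t *\<^sub>R z) \<bullet> z) \<in> borel_measurable lborel"
          using L2_measurable[OF g] by measurable
        show "norm (gradient \<phi> (x + t *\<^sub>R z) \<bullet> z) \<le> norm z * norm (gradient \<phi> (x + t *\<^sub>R z))" for x
          using Cauchy_Schwarz_ineq2[of "gradient \<phi> (x + t *\<^sub>R z)" z] by (simp add: mult.commute)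
      qed simp
      then show ?thesis
        using l2_translation[OF test_function_borel(2)[OF \<phi>]] by simp
    qed
  qed (use out K in auto)
  then show ?thesis by simp
qed

text \<open>A translation by \<open>2 * R + 1\<close>, longer than the diameter of \<open>D\<close>,
  moves the support off itself. Then \<open>\<phi>\<close> is pointwise dominated by the difference
  with its translate.\<close>

lemma Poincare_inequality:
  assumes "\<phi> \<in> test_functions (D :: 'a::euclidean_space set)" and D: "\<And>x. x \<in> D \<Longrightarrow> norm x \<le> R" and R: "0 \<le> R"
  shows "l2 lborel \<phi> \<le> (2 * R + 1) * l2 lborel (gradient \<phi>)"
proof -
  obtain K where K: "K \<subseteq> D" "\<And>x. x \<notin> K \<Longrightarrow> \<phi> x = 0"
    using test_functionsE[OF assms(1)] by metis
  obtain b :: 'a where b: "b \<in> Basis" using nonempty_Basis by blast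
  define z where "z = (2 * R + 1) *\<^sub>R b"
  have z: "norm z = 2 * R + 1" using b R by (simp add: z_def)
  have L: "L2 lborel \<phi>" "L2 lborel (\<lambda>x. \<phi> (x + z))"
    using test_function_L2[OF assms(1)] L2_translation by blast+
  have 0: "\<phi> (x + z) = 0 \<or> \<phi> x = 0" for x
  proof (rule ccontr)
    assume "\<not> ?thesis"
    then have "x + z \<in> D" "x \<in> D" using K by blast+
    then have "norm (x + z) \<le> R" "norm x \<le> R" using D by blast+
    then have "norm z \<le> 2 * R" using norm_triangle_ineq4[of "x + z" x] by simp
    then show False using z by simp
  qed
  have "l2 lborel \<phi> \<le> 1 * l2 lborel (\<lambda>x. \<phi> (x + z) - \<phi> x)"
  proof (rule L2_le(2)[OF L2_diff[OF L(2,1)]])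
    show "\<phi> \<in> borel_measurable lborel" using L by (simp add: L2_def)
    show "norm (\<phi> x) \<le> 1 * norm (\<phi> (x + z) - \<phi> x)" for x using 0[of x] by auto
  qed simp
  also have "\<dots> \<le> (2 * R + 1) * l2 lborel (gradient \<phi>)"
    using l2_translation_diff_le[OF assms(1), of z] z by simp
  finally show ?thesis .
qed

section \<open>Averages over balls and Rellich compactness\<close>

definition ball_mean :: "real \<Rightarrow> ('a::euclidean_space \<Rightarrow> real) \<Rightarrow> 'a \<Rightarrow> real" where
  "ball_mean h f x = (\<integral>y. indicator (ball 0 h) y * f (x + y) \<partial>lborel) / measure lborel (ball (0::'a) h)"

lemma L2_indicator_ball: "L2 lborel (indicator (ball (0::'a::euclidean_space) h) :: 'a \<Rightarrow> real)"
  "l2 lborel (indicator (ball (0::'a) h) :: 'a \<Rightarrow> real) = sqrt (measure lborel (ball (0::'a) h))"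
  using emeasure_lborel_ball_finite[of "0::'a" h] borel_measurable_indicator[of "ball (0::'a) h" lborel]
  by (auto simp: L2_def l2_def power2_eq_square indicator_inter_arith[symmetric])

lemma measure_ball_pos: "h > 0 \<Longrightarrow> 0 < measure lborel (ball (x::'a::euclidean_space) h)"
  using content_ball_pos[of h x] by (simp add: measure_completion)

lemma abs_integral_ball_le:
  fixes f :: "'a::euclidean_space \<Rightarrow> real"
  assumes "L2 lborel f" "h > 0"
  shows "\<bar>(\<integral>y. indicator (ball 0 h) y * f y \<partial>lborel) / measure lborel (ball (0::'a) h)\<bar>
    \<le> l2 lborel f / sqrt (measure lborel (ball (0::'a) h))"
proof -
  let ?V = "measure lborel (ball (0::'a) h)"
  have V: "?V > 0" by (rule measure_ball_pos[OF assms(2)])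
  have "\<bar>\<integral>y. indicator (ball 0 h) y * f y \<partial>lborel\<bar> \<le> sqrt ?V * l2 lborel f"
    using L2_Cauchy_Schwarz_real[OF L2_indicator_ball(1) assms(1)] by (simp add: L2_indicator_ball(2))
  then have "\<bar>(\<integral>y. indicator (ball 0 h) y * f y \<partial>lborel) / ?V\<bar> \<le> sqrt ?V * l2 lborel f / ?V"
    using V by (simp add: divide_right_mono)
  also have "\<dots> = l2 lborel f / sqrt ?V"
    using V by (simp add: field_simps real_sqrt_mult_self)
  finally show ?thesis .
qed

text \<open>The sup bound and the Lipschitz constant involve only the two L2 norms and the radius,
  so averages of a bounded sequence are equicontinuous.\<close>

lemma ball_mean_diff_le:
  assumes \<phi>: "\<phi> \<in> test_functions (D :: 'a::euclidean_space set)" and h: "h > 0"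
  shows "\<bar>ball_mean h \<phi> x - ball_mean h \<phi> x'\<bar>
      \<le> norm (x - x') * l2 lborel (gradient \<phi>) / sqrt (measure lborel (ball (0::'a) h))" (is ?lip)
    and "\<bar>ball_mean h \<phi> x\<bar> \<le> l2 lborel \<phi> / sqrt (measure lborel (ball (0::'a) h))" (is ?bd)
proof -
  let ?V = "measure lborel (ball (0::'a) h)"
  have V: "?V > 0" by (rule measure_ball_pos[OF h])
  note L = test_function_L2(1)[OF \<phi>]
  have T: "L2 lborel (\<lambda>y. \<phi> (x + y))" for x
    using L2_translation[OF L, of x] by (simp add: add.commute)
  show ?bd
    using abs_integral_ball_le[OF T[of x] h] l2_translation[OF test_function_borel(1)[OF \<phi>], of x]
    by (simp add: ball_mean_def add.commute)
  have "ball_mean h \<phi> x - ball_mean h \<phi> x'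
      = (\<integral>y. indicator (ball 0 h) y * (\<phi> (x + y) - \<phi> (x' + y)) \<partial>lborel) / ?V"
    unfolding ball_mean_def diff_divide_distrib[symmetric]
    using L2_mult_integrable[OF L2_indicator_ball(1)[of h] T[of x]] L2_mult_integrable[OF L2_indicator_ball(1)[of h] T[of x']]
    by (simp add: right_diff_distrib)
  then have "\<bar>ball_mean h \<phi> x - ball_mean h \<phi> x'\<bar> \<le> l2 lborel (\<lambda>y. \<phi> (x + y) - \<phi> (x' + y)) / sqrt ?V"
    using abs_integral_ball_le[OF L2_diff[OF T[of x] T[of x']] h] by simp
  also have "l2 lborel (\<lambda>y. \<phi> (x + y) - \<phi> (x' + y)) = l2 lborel (\<lambda>w. \<phi> (w + (x - x')) - \<phi> w)"
  proof -
    have "(\<lambda>w. \<phi> (w + (x - x')) - \<phi> w) \<in> borel_measurable borel"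
      using test_function_borel(1)[OF \<phi>] by measurable
    from l2_translation[OF this, of x'] show ?thesis by (simp add: algebra_simps)
  qed
  also have "\<dots> / sqrt ?V \<le> norm (x - x') * l2 lborel (gradient \<phi>) / sqrt ?V"
    by (intro divide_right_mono l2_translation_diff_le[OF \<phi>]) simp
  finally show ?lip .
qed

text \<open>The average minus the value is a mean of translation differences over vectors shorter
  than \<open>h\<close>. Cauchy-Schwarz in the vector and exchanging the two integrals reduce it to
  \<open>l2_translation_diff_le\<close>.\<close>

lemma l2_ball_mean_diff_le:
  assumes \<phi>: "\<phi> \<in> test_functions (D :: 'a::euclidean_space set)" and h: "h > 0"
  shows "l2 lborel (\<lambda>x. ball_mean h \<phi> x - \<phi> x) \<le> h * l2 lborel (gradient \<phi>)"
proof -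
  let ?V = "measure lborel (ball (0::'a) h)"
  have V: "?V > 0" by (rule measure_ball_pos[OF h])
  have [measurable]: "\<phi> \<in> borel_measurable borel" by (rule test_function_borel(1)[OF \<phi>])
  note L = test_function_L2(1)[OF \<phi>]
  have T: "L2 lborel (\<lambda>y. \<phi> (x + y))" for x
    using L2_translation[OF L, of x] by (simp add: add.commute)
  define q where "q x y = indicator (ball 0 h) y * (\<phi> (x + y) - \<phi> x)\<^sup>2" for x y :: 'a
  have IB: "L2 lborel (\<lambda>y. indicator (ball (0::'a) h) y * c)" for c :: real
    using L2_cmult[OF L2_indicator_ball(1), of c h] by (simp add: mult.commute)
  have gL: "L2 lborel (\<lambda>y. indicator (ball 0 h) y * (\<phi> (x + y) - \<phi> x))" for x
  proof -
    have "L2 lborel (\<lambda>y. indicator (ball 0 h) y * \<phi> (x + y))"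
      by (rule L2_le(1)[OF T[of x], of _ 1]) (auto simp: indicator_def)
    from L2_diff[OF this IB[of "\<phi> x"]] show ?thesis by (simp add: right_diff_distrib)
  qed
  have qi: "integrable lborel (q x)" for x
  proof -
    have "(\<lambda>y. (norm (indicator (ball 0 h) y * (\<phi> (x + y) - \<phi> x)))\<^sup>2) = q x"
      by (auto simp: q_def indicator_def)
    then show ?thesis using L2_square_integrable[OF gL[of x]] by simp
  qed
  have pt: "ennreal ((ball_mean h \<phi> x - \<phi> x)\<^sup>2) \<le> (\<integral>\<^sup>+y. ennreal (q x y / ?V) \<partial>lborel)" for x
  proof -
    have l2g: "(l2 lborel (\<lambda>y. indicator (ball 0 h) y * (\<phi> (x + y) - \<phi> x)))\<^sup>2 = (\<integral>y. q x y \<partial>lborel)"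
      unfolding l2_square by (rule Bochner_Integration.integral_cong) (auto simp: q_def indicator_def)
    have "(\<integral>y. indicator (ball 0 h) y * (\<phi> (x + y) - \<phi> x) \<partial>lborel)
        = (\<integral>y. indicator (ball 0 h) y * \<phi> (x + y) \<partial>lborel) - (\<integral>y. indicator (ball (0::'a) h) y * \<phi> x \<partial>lborel)"
      using L2_mult_integrable[OF L2_indicator_ball(1)[of h] T[of x]] emeasure_lborel_ball_finite[of "0::'a" h]
      by (simp add: right_diff_distrib)
    also have "(\<integral>y. indicator (ball (0::'a) h) y * \<phi> x \<partial>lborel) = ?V * \<phi> x" by simp
    finally have "(ball_mean h \<phi> x - \<phi> x) = (\<integral>y. indicator (ball 0 h) y * (\<phi> (x + y) - \<phi> x) \<partial>lborel) / ?V"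
      using V by (simp add: ball_mean_def field_simps)
    \<comment> \<open>The indicator is doubled so that Cauchy-Schwarz leaves one copy with the
      difference and only differences over the ball are counted.\<close>
    also have "\<dots> = (\<integral>y. indicator (ball 0 h) y * (indicator (ball 0 h) y * (\<phi> (x + y) - \<phi> x)) \<partial>lborel) / ?V"
      by (intro arg_cong2[where f = "(/)"] Bochner_Integration.integral_cong) (auto simp: indicator_def)
    finally have "\<bar>ball_mean h \<phi> x - \<phi> x\<bar>
        \<le> l2 lborel (\<lambda>y. indicator (ball 0 h) y * (\<phi> (x + y) - \<phi> x)) / sqrt ?V"
      using abs_integral_ball_le[OF gL[of x] h] by simp
    then have "(ball_mean h \<phi> x - \<phi> x)\<^sup>2
        \<le> (l2 lborel (\<lambda>y. indicator (ball 0 h) y * (\<phi> (x + y) - \<phi> x)) / sqrt ?V)\<^sup>2"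
      using power_mono[OF _ abs_ge_zero, of "ball_mean h \<phi> x - \<phi> x" _ 2] by simp
    also have "\<dots> = (\<integral>y. q x y / ?V \<partial>lborel)"
      using V l2g by (simp add: power_divide)
    finally have "ennreal ((ball_mean h \<phi> x - \<phi> x)\<^sup>2) \<le> ennreal (\<integral>y. q x y / ?V \<partial>lborel)"
      by (rule ennreal_leI)
    also have "\<dots> = (\<integral>\<^sup>+y. ennreal (q x y / ?V) \<partial>lborel)"
      using integrable_divide[OF qi[of x], of ?V]
      by (intro nn_integral_eq_integral[symmetric]) (auto simp: q_def)
    finally show ?thesis .
  qed
  have "(\<integral>\<^sup>+x. ennreal ((ball_mean h \<phi> x - \<phi> x)\<^sup>2) \<partial>lborel)
      \<le> (\<integral>\<^sup>+x. (\<integral>\<^sup>+y. ennreal (q x y / ?V) \<partial>lborel) \<partial>lborel)"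
    by (intro nn_integral_mono pt)
  also have "\<dots> = (\<integral>\<^sup>+y. (\<integral>\<^sup>+x. ennreal (q x y / ?V) \<partial>lborel) \<partial>lborel)"
  proof (rule lborel_pair.Fubini'[symmetric])
    define i where "i y = (indicator (ball (0::'a) h) y :: real)" for y
    have [measurable]: "i \<in> borel_measurable borel"
      unfolding i_def[abs_def] by (rule borel_measurable_indicator) simp
    have "(\<lambda>(x, y). ennreal (q x y / ?V)) \<in> borel_measurable (borel \<Otimes>\<^sub>M borel)"
      unfolding q_def i_def[symmetric] by measurable
    then show "(\<lambda>(x, y). ennreal (q x y / ?V)) \<in> borel_measurable (lborel \<Otimes>\<^sub>M lborel)"
      using measurable_cong_sets[OF sets_pair_measure_cong[OF sets_lborel sets_lborel] refl] by blast
  qed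
  also have "\<dots> \<le> (\<integral>\<^sup>+y. ennreal ((h * l2 lborel (gradient \<phi>))\<^sup>2 / ?V) * indicator (ball (0::'a) h) y \<partial>lborel)"
  proof (intro nn_integral_mono)
    fix y :: 'a
    have d: "L2 lborel (\<lambda>x. \<phi> (x + y) - \<phi> x)" by (intro L2_diff L L2_translation)
    show "(\<integral>\<^sup>+x. ennreal (q x y / ?V) \<partial>lborel)
        \<le> ennreal ((h * l2 lborel (gradient \<phi>))\<^sup>2 / ?V) * indicator (ball 0 h) y"
    proof (cases "y \<in> ball 0 h")
      case True
      have "(\<integral>\<^sup>+x. ennreal (q x y / ?V) \<partial>lborel) = ennreal ((l2 lborel (\<lambda>x. \<phi> (x + y) - \<phi> x))\<^sup>2 / ?V)"
        using True L2_square_integrable[OF d]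
        by (simp add: q_def l2_square, subst nn_integral_eq_integral) auto
      also have "\<dots> \<le> ennreal ((h * l2 lborel (gradient \<phi>))\<^sup>2 / ?V)"
      proof (intro ennreal_leI divide_right_mono power_mono)
        have "norm y \<le> h" using True by simp
        then show "l2 lborel (\<lambda>x. \<phi> (x + y) - \<phi> x) \<le> h * l2 lborel (gradient \<phi>)"
          using l2_translation_diff_le[OF \<phi>, of y] mult_right_mono[of "norm y" h "l2 lborel (gradient \<phi>)"] by simp
      qed auto
      finally show ?thesis using True by simp
    qed (simp add: q_def)
  qed
  also have "\<dots> = ennreal ((h * l2 lborel (gradient \<phi>))\<^sup>2 / ?V) * emeasure lborel (ball (0::'a) h)"
    by (rule nn_integral_cmult_indicator) simp
  also have "emeasure lborel (ball (0::'a) h) = ennreal ?V"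
    using emeasure_lborel_ball_finite[of "0::'a" h] by (intro emeasure_eq_ennreal_measure) auto
  also have "ennreal ((h * l2 lborel (gradient \<phi>))\<^sup>2 / ?V) * ennreal ?V = ennreal ((h * l2 lborel (gradient \<phi>))\<^sup>2)"
    using V by (subst ennreal_mult[symmetric]) auto
  finally have le: "(\<integral>\<^sup>+x. ennreal ((ball_mean h \<phi> x - \<phi> x)\<^sup>2) \<partial>lborel) \<le> ennreal ((h * l2 lborel (gradient \<phi>))\<^sup>2)" .
  have "(\<integral>x. (ball_mean h \<phi> x - \<phi> x)\<^sup>2 \<partial>lborel) \<le> (h * l2 lborel (gradient \<phi>))\<^sup>2"
    by (rule integral_real_bounded[OF _ le]) simp
  then have "(l2 lborel (\<lambda>x. ball_mean h \<phi> x - \<phi> x))\<^sup>2 \<le> (h * l2 lborel (gradient \<phi>))\<^sup>2"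
    by (simp add: l2_square)
  then show ?thesis
    by (rule power2_le_imp_le) (use h in simp)
qed

lemma ball_mean_continuous:
  assumes \<phi>: "\<phi> \<in> test_functions (D :: 'a::euclidean_space set)" and h: "h > 0"
  shows "continuous_on UNIV (ball_mean h \<phi>)"
proof -
  let ?L = "l2 lborel (gradient \<phi>) / sqrt (measure lborel (ball (0::'a) h))"
  have "?L-lipschitz_on UNIV (ball_mean h \<phi>)"
    by (rule lipschitz_onI) (use ball_mean_diff_le(1)[OF \<phi> h] in \<open>auto simp: dist_norm mult.commute divide_nonneg_nonneg\<close>)
  then show ?thesis by (rule lipschitz_on_continuous_on)
qed

text \<open>Arzela-Ascoli applies to the averages at scale \<open>h\<close>. Replacing each function
  by its average costs \<open>h * A\<close>, and the averages differ by at most \<open>h\<close>,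
  which adds up to \<open>(2 * A + 1) * h\<close>.\<close>

lemma Rellich_step:
  fixes \<phi> :: "nat \<Rightarrow> 'a::euclidean_space \<Rightarrow> real"
  assumes D: "\<And>x. x \<in> D \<Longrightarrow> norm x \<le> R" and \<phi>: "\<And>n. \<phi> n \<in> test_functions D"
    and A: "\<And>n. l2 lborel (\<phi> n) \<le> A" "\<And>n. l2 lborel (gradient (\<phi> n)) \<le> A" and h: "0 < h" "h \<le> 1"
  shows "\<exists>r. strict_mono (r :: nat \<Rightarrow> nat) \<and>
    (\<exists>N. \<forall>m\<ge>N. \<forall>n\<ge>N. l2 lborel (\<lambda>x. \<phi> (r m) x - \<phi> (r n) x) \<le> (2 * A + 1) * h)"
proof -
  let ?V = "measure lborel (ball (0::'a) h)"
  define S where "S = cball (0::'a) (R + 1)"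
  define f where "f n = ball_mean h (\<phi> n)" for n
  have V: "?V > 0" by (rule measure_ball_pos[OF h(1)])
  have A0: "0 \<le> A" using A(1)[of 0] l2_nonneg order_trans by blast
  have cf: "continuous_on UNIV (f n)" for n
    unfolding f_def by (rule ball_mean_continuous[OF \<phi> h(1)])
  have f0: "f n x = 0" if "x \<notin> S" for n x
  proof -
    obtain K where K: "K \<subseteq> D" "\<And>x. x \<notin> K \<Longrightarrow> \<phi> n x = 0"
      using test_functionsE[OF \<phi>[of n]] by metis
    have "indicator (ball 0 h) y * \<phi> n (x + y) = 0" for y :: 'a
    proof (cases "y \<in> ball 0 h")
      case True
      have "norm x \<le> norm (x + y) + norm y" using norm_triangle_ineq4[of "x + y" y] by simp
      then have "norm (x + y) > R" using that True h by (simp add: S_def)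
      then have "x + y \<notin> K" using K(1) D by fastforce
      then show ?thesis using K(2) by simp
    qed simp
    then have "(\<lambda>y. indicator (ball 0 h) y * \<phi> n (x + y)) = (\<lambda>y. 0)" by blast
    then show ?thesis unfolding f_def ball_mean_def by simp
  qed
  have fL: "L2 lborel (f n)" for n
    by (rule L2_compact_support[where K = S, OF cf _ f0]) (auto simp: S_def)
  have bd: "norm (f n x) \<le> A / sqrt ?V" for n x
  proof -
    have "norm (f n x) \<le> l2 lborel (\<phi> n) / sqrt ?V"
      using ball_mean_diff_le(2)[OF \<phi> h(1)] by (simp add: f_def)
    also have "\<dots> \<le> A / sqrt ?V" by (intro divide_right_mono A) simp
    finally show ?thesis .
  qed
  have lip: "norm (f n x - f n y) \<le> norm (x - y) * (A / sqrt ?V)" for n x y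
  proof -
    have "norm (f n x - f n y) \<le> norm (x - y) * l2 lborel (gradient (\<phi> n)) / sqrt ?V"
      using ball_mean_diff_le(1)[OF \<phi> h(1)] by (simp add: f_def)
    also have "\<dots> \<le> norm (x - y) * A / sqrt ?V"
      by (intro divide_right_mono mult_left_mono A) auto
    finally show ?thesis by simp
  qed
  have "compact S" by (simp add: S_def)
  moreover have "\<exists>d. 0 < d \<and> (\<forall>n y. y \<in> S \<and> norm (x - y) < d \<longrightarrow> norm (f n x - f n y) < e)" if "0 < e" for x e
  proof (intro exI conjI allI impI)
    let ?c = "A / sqrt ?V + 1"
    have c: "?c > 0" using A0 V by (intro add_nonneg_pos) auto
    show "0 < e / ?c" using that c by simp
    fix n y assume y: "y \<in> S \<and> norm (x - y) < e / ?c"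
    have "norm (f n x - f n y) \<le> norm (x - y) * (A / sqrt ?V)" by (rule lip)
    also have "\<dots> \<le> norm (x - y) * ?c" by (intro mult_left_mono) auto
    also have "\<dots> < e" using y c by (simp add: field_simps)
    finally show "norm (f n x - f n y) < e" .
  qed
  ultimately obtain g r where r: "strict_mono (r :: nat \<Rightarrow> nat)"
    and lim: "\<And>e. 0 < e \<Longrightarrow> \<exists>N. \<forall>n x. n \<ge> N \<and> x \<in> S \<longrightarrow> norm (f (r n) x - g x) < e"
    using Arzela_Ascoli[of S f "A / sqrt ?V"] bd by metis
  \<comment> \<open>Adding 1 makes \<open>W\<close> positive and an upper bound for the square root
    of the measure of \<open>S\<close>.\<close>
  define W where "W = measure lborel S + 1"
  have W: "W > 0" by (simp add: W_def add_nonneg_pos)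
  obtain N where N: "\<And>n x. n \<ge> N \<Longrightarrow> x \<in> S \<Longrightarrow> norm (f (r n) x - g x) < h / (2 * W)"
    using lim[of "h / (2 * W)"] h W by auto
  have "l2 lborel (\<lambda>x. \<phi> (r m) x - \<phi> (r n) x) \<le> (2 * A + 1) * h" if mn: "m \<ge> N" "n \<ge> N" for m n
  proof -
    have IS: "L2 lborel (indicator S :: 'a \<Rightarrow> real)" "l2 lborel (indicator S :: 'a \<Rightarrow> real) = sqrt (measure lborel S)"
      using emeasure_lborel_cball_finite[of "0::'a" "R + 1"]
        borel_measurable_indicator[of "cball (0::'a) (R + 1)" lborel]
      by (auto simp: S_def L2_def l2_def power2_eq_square indicator_inter_arith[symmetric])
    have "l2 lborel (\<lambda>x. f (r m) x - f (r n) x) \<le> h / W * l2 lborel (indicator S :: 'a \<Rightarrow> real)"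
    proof (rule L2_le(2)[OF IS(1)])
      show "(\<lambda>x. f (r m) x - f (r n) x) \<in> borel_measurable lborel"
        using L2_measurable[OF L2_diff[OF fL fL]] .
      show "norm (f (r m) x - f (r n) x) \<le> h / W * norm (indicator S x :: real)" for x
      proof (cases "x \<in> S")
        case True
        have "norm (f (r m) x - f (r n) x) < h / (2 * W) + h / (2 * W)"
          using N[OF mn(1) True] N[OF mn(2) True] by (intro norm_diff_triangle_less[of _ "g x"]) (auto simp: norm_minus_commute)
        then show ?thesis using True by simp
      qed (simp add: f0)
    qed (use h W in auto)
    also have "\<dots> \<le> h / W * W"
    proof (intro mult_left_mono)
      show "l2 lborel (indicator S :: 'a \<Rightarrow> real) \<le> W"
        unfolding IS(2) W_def by (rule real_le_lsqrt) (auto simp: power2_sum add_nonneg_nonneg)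
    qed (use h W in auto)
    also have "\<dots> = h" using W by simp
    finally have mid: "l2 lborel (\<lambda>x. f (r m) x - f (r n) x) \<le> h" .
    have side: "l2 lborel (\<lambda>x. f k x - \<phi> k x) \<le> h * A" for k
      unfolding f_def
      by (rule order_trans[OF l2_ball_mean_diff_le[OF \<phi> h(1)] mult_left_mono[OF A(2)]])
        (use h in auto)
    note pL = test_function_L2(1)[OF \<phi>]
    have "l2 lborel (\<lambda>x. \<phi> (r m) x - \<phi> (r n) x)
      \<le> l2 lborel (\<lambda>x. \<phi> (r m) x - f (r m) x) + (l2 lborel (\<lambda>x. f (r m) x - f (r n) x) + l2 lborel (\<lambda>x. f (r n) x - \<phi> (r n) x))"
      by (rule order_trans[OF l2_triangle_diff[OF pL fL pL] add_left_mono[OF l2_triangle_diff[OF fL fL pL]]])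
    also have "\<dots> \<le> h * A + (h + h * A)"
      by (intro add_mono mid side) (use side[of "r m"] l2_minus_commute[of lborel "f (r m)" "\<phi> (r m)"] in simp)
    finally show ?thesis by (simp add: algebra_simps)
  qed
  with r show ?thesis by blast
qed

text \<open>Diagonal sequence over the scales \<open>1 / (k + 1)\<close>. Only the Cauchy property
  is extracted; the limit is taken later on \<open>lebesgue_on D\<close>.\<close>

lemma Rellich:
  fixes \<phi> :: "nat \<Rightarrow> 'a::euclidean_space \<Rightarrow> real"
  assumes D: "bounded D" and \<phi>: "\<And>n. \<phi> n \<in> test_functions D"
    and A: "\<And>n. l2 lborel (\<phi> n) \<le> A" "\<And>n. l2 lborel (gradient (\<phi> n)) \<le> A"
  obtains r where "strict_mono (r :: nat \<Rightarrow> nat)"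
    "\<And>e. e > 0 \<Longrightarrow> \<exists>N. \<forall>m\<ge>N. \<forall>n\<ge>N. l2 lborel (\<lambda>x. \<phi> (r m) x - \<phi> (r n) x) \<le> e"
proof -
  obtain R where R: "\<And>x. x \<in> D \<Longrightarrow> norm x \<le> R" using D bounded_iff by metis
  define P where "P k s \<longleftrightarrow> (\<exists>N. \<forall>m\<ge>N. \<forall>n\<ge>N. l2 lborel (\<lambda>x. \<phi> (s m) x - \<phi> (s n) x) \<le> (2 * A + 1) * (1 / real (Suc k)))"
    for k and s :: "nat \<Rightarrow> nat"
  interpret subseqs P
  proof
    fix k and s :: "nat \<Rightarrow> nat" assume "strict_mono s"
    show "\<exists>r'. strict_mono r' \<and> P k (s \<circ> r')"
      unfolding P_def comp_def by (rule Rellich_step[OF R]) (use \<phi> A in auto)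
  qed
  have st: "P k (s \<circ> r)" if "strict_mono r" "P k s" for r s k
    using that(2) seq_suble[OF that(1)] unfolding P_def comp_def by (meson order_trans)
  show thesis
  proof
    show "strict_mono diagseq" by (rule subseq_diagseq)
    fix e :: real assume e: "e > 0"
    obtain k where "(2 * A + 1) / e < real k" using reals_Archimedean2 by blast
    then have k: "(2 * A + 1) * (1 / real (Suc k)) \<le> e"
      using e by (simp add: field_simps)
    \<comment> \<open>Only from index \<open>Suc k\<close> on is the diagonal sequence controlled at
      scale k, hence the shift, undone at the end.\<close>
    have "P k (diagseq \<circ> ((+) (Suc k)))" by (rule diagseq_holds[OF st])
    then obtain N where N: "\<And>m n. m \<ge> N \<Longrightarrow> n \<ge> N \<Longrightarrow>
        l2 lborel (\<lambda>x. \<phi> (diagseq (Suc k + m)) x - \<phi> (diagseq (Suc k + n)) x) \<le> e"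
      using k unfolding P_def comp_def by (meson order_trans)
    show "\<exists>N. \<forall>m\<ge>N. \<forall>n\<ge>N. l2 lborel (\<lambda>x. \<phi> (diagseq m) x - \<phi> (diagseq n) x) \<le> e"
    proof (intro exI[of _ "N + Suc k"] allI impI)
      fix m n assume "N + Suc k \<le> m" "N + Suc k \<le> n"
      then show "l2 lborel (\<lambda>x. \<phi> (diagseq m) x - \<phi> (diagseq n) x) \<le> e"
        using N[of "m - Suc k" "n - Suc k"] by simp
    qed
  qed
qed

subsection \<open>The first Dirichlet eigenvalue as the minimum of the Rayleigh quotient\<close>

text \<open>Provides Cauchy-Schwarz for the Rayleigh form, which is nonnegative but may be
  degenerate.\<close>

lemma quadratic_nonneg_discriminant:
  fixes a b c :: real
  assumes "\<And>t. 0 \<le> a + 2 * t * b + t\<^sup>2 * c"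
  shows "b\<^sup>2 \<le> a * c"
proof (cases "c = 0")
  case True
  have "b = 0"
  proof (rule ccontr)
    assume "b \<noteq> 0"
    then show False using assms[of "- (a + 1) / (2 * b)"] True by (simp add: field_simps)
  qed
  then show ?thesis using True by simp
next
  case False
  have a: "0 \<le> a" using assms[of 0] by simp
  have "c > 0"
  proof (rule ccontr)
    assume "\<not> c > 0"
    then have c: "c < 0" using False by simp
    \<comment> \<open>Adding the values at t and -t removes b, and this t is large enough to make
      the remaining a + t^2 c negative.\<close>
    define t where "t = (\<bar>b\<bar> + a + 1) / (- c) + 1"
    have "0 \<le> a + 2 * t * b + t\<^sup>2 * c" "0 \<le> a + 2 * (- t) * b + (- t)\<^sup>2 * c" by (rule assms)+
    then have s: "0 \<le> a + t\<^sup>2 * c" by simp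
    have t: "t * (- c) = \<bar>b\<bar> + a + 1 - c" "t \<ge> 1"
      using c a by (auto simp: t_def field_simps)
    then have "t * (t * (- c)) \<ge> 1 * (\<bar>b\<bar> + a + 1 - c)"
      using a c by (intro mult_mono) auto
    then show False using s a c by (simp add: power2_eq_square algebra_simps)
  qed
  then have "0 \<le> c * (a + 2 * (- b / c) * b + (- b / c)\<^sup>2 * c)"
    by (intro mult_nonneg_nonneg assms) auto
  also have "\<dots> = a * c - b\<^sup>2"
    using False by (simp add: field_simps power2_eq_square)
  finally show ?thesis by simp
qed

lemma bump_l2_pos: "r > 0 \<Longrightarrow> l2 lborel (bump (x0::'a::euclidean_space) r) > 0"
proof (rule ccontr)
  assume r: "r > 0" and "\<not> l2 lborel (bump x0 r) > 0"
  then have "l2 lborel (bump x0 r) = 0" using l2_nonneg[of lborel "bump x0 r"] by linarith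
  then have "(\<integral>z. (norm (bump x0 r z))\<^sup>2 \<partial>lborel) = 0" by (metis l2_square zero_power2)
  moreover have "integrable lborel (\<lambda>z. (norm (bump x0 r z))\<^sup>2)"
    using test_function_L2(1)[OF bump_test_function[OF r, of x0 UNIV]] L2_square_integrable by blast
  ultimately have "AE z in lborel. (norm (bump x0 r z))\<^sup>2 = 0"
    by (subst (asm) integral_nonneg_eq_0_iff_AE) auto
  then have "AE z in lborel. z \<notin> ball x0 r"
    by eventually_elim (use bump_pos[OF r] in fastforce)
  then have "emeasure lborel (ball x0 r) = 0"
    by (subst (asm) AE_iff_measurable[of "ball x0 r"]) auto
  then show False
    using measure_ball_pos[OF r, of x0] by (simp add: measure_def)
qed

lemma test_function_normalized_exists:
  assumes "open D" "D \<noteq> {}"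
  obtains \<phi> where "\<phi> \<in> test_functions (D :: 'a::euclidean_space set)" "l2 lborel \<phi> = 1"
proof -
  obtain x r where r: "r > 0" "cball x r \<subseteq> D"
    using assms open_contains_cball by blast
  let ?c = "l2 lborel (bump x r)"
  have c: "?c > 0" by (rule bump_l2_pos[OF r(1)])
  have "(\<lambda>z. (1 / ?c) * bump x r z) \<in> test_functions D"
    by (intro test_functions_cmult bump_test_function r)
  moreover have "l2 lborel (\<lambda>z. (1 / ?c) * bump x r z) = 1"
    using l2_scaleR[of lborel "1 / ?c" "bump x r"] c by simp
  ultimately show thesis by (rule that)
qed

text \<open>The quadratic form \<open>H_form\<close> of a test function, with the classical gradient
  and over the whole space, where dilations act simply.\<close>

definition rayleigh_form :: "real \<Rightarrow> ('a::euclidean_space \<Rightarrow> real) \<Rightarrow> real" where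
  "rayleigh_form \<mu> \<phi> = (l2 lborel (gradient \<phi>))\<^sup>2 - \<mu> * (l2 lborel \<phi>)\<^sup>2"

lemma gradient_test_add:
  assumes "\<phi> \<in> test_functions D" "\<psi> \<in> test_functions D"
  shows "gradient (\<lambda>x. \<phi> x + t * \<psi> x) = (\<lambda>x. gradient \<phi> x + t *\<^sub>R gradient \<psi> x)"
  using assms[THEN test_functions_smooth, THEN smooth_differentiable]
  by (intro ext) (subst gradient_add, auto intro: differentiable_mult simp: gradient_cmult)

lemma l2_square_add:
  assumes "L2 M f" "L2 M g"
  shows "(l2 M (\<lambda>x. f x + t *\<^sub>R g x))\<^sup>2 = (l2 M f)\<^sup>2 + 2 * t * (\<integral>x. f x \<bullet> g x \<partial>M) + t\<^sup>2 * (l2 M g)\<^sup>2"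
proof -
  have "(l2 M (\<lambda>x. f x + t *\<^sub>R g x))\<^sup>2
      = (\<integral>x. (norm (f x))\<^sup>2 + (2 * t) * (f x \<bullet> g x) + t\<^sup>2 * (norm (g x))\<^sup>2 \<partial>M)"
    unfolding l2_square
  proof (rule Bochner_Integration.integral_cong[OF refl])
    fix x
    show "(norm (f x + t *\<^sub>R g x))\<^sup>2 = (norm (f x))\<^sup>2 + (2 * t) * (f x \<bullet> g x) + t\<^sup>2 * (norm (g x))\<^sup>2"
      by (simp only: power2_norm_eq_inner inner_add_left inner_add_right inner_scaleR_left inner_scaleR_right
          inner_commute[of "g x" "f x"]) (simp add: power2_eq_square algebra_simps)
  qed
  also have "\<dots> = (l2 M f)\<^sup>2 + 2 * t * (\<integral>x. f x \<bullet> g x \<partial>M) + t\<^sup>2 * (l2 M g)\<^sup>2"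
    using L2_square_integrable[OF assms(1)] L2_square_integrable[OF assms(2)] L2_inner_integrable[OF assms]
    by (simp add: l2_square)
  finally show ?thesis .
qed

lemma rayleigh_form_add:
  assumes \<phi>: "\<phi> \<in> test_functions D" and \<psi>: "\<psi> \<in> test_functions D"
  shows "rayleigh_form \<mu> (\<lambda>x. \<phi> x + t * \<psi> x) = rayleigh_form \<mu> \<phi>
    + 2 * t * ((\<integral>x. gradient \<phi> x \<bullet> gradient \<psi> x \<partial>lborel) - \<mu> * (\<integral>x. \<phi> x * \<psi> x \<partial>lborel)) + t\<^sup>2 * rayleigh_form \<mu> \<psi>"
  unfolding rayleigh_form_def gradient_test_add[OF \<phi> \<psi>]
    l2_square_add[OF test_function_L2(2)[OF \<phi>] test_function_L2(2)[OF \<psi>]]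
    l2_square_add[OF test_function_L2(1)[OF \<phi>] test_function_L2(1)[OF \<psi>], unfolded real_scaleR_def inner_real_def]
  by (simp add: algebra_simps)

lemma rayleigh_form_cmult:
  assumes "\<phi> \<in> test_functions D"
  shows "rayleigh_form \<mu> (\<lambda>x. c * \<phi> x) = c\<^sup>2 * rayleigh_form \<mu> \<phi>"
proof -
  have g: "gradient (\<lambda>x. c * \<phi> x) = (\<lambda>x. c *\<^sub>R gradient \<phi> x)"
    by (rule ext, rule gradient_cmult, rule smooth_differentiable[OF test_functions_smooth[OF assms]])
  have "l2 lborel (\<lambda>x. c * \<phi> x) = \<bar>c\<bar> * l2 lborel \<phi>"
    using l2_scaleR[of lborel c \<phi>] by simp
  then show ?thesis
    unfolding rayleigh_form_def g l2_scaleR by (simp add: power_mult_distrib algebra_simps)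
qed

lemma H10_grad_lower_bound:
  assumes D: "open D" and u: "H10_grad D u g"
    and le: "\<And>\<phi>. \<phi> \<in> test_functions D \<Longrightarrow> 0 \<le> rayleigh_form \<mu> \<phi>"
  shows "\<mu> * (l2 (lebesgue_on D) u)\<^sup>2 \<le> (l2 (lebesgue_on D) g)\<^sup>2"
proof -
  let ?M = "lebesgue_on D"
  obtain \<psi> where \<psi>: "L2 ?M u" "L2 ?M g" "\<And>n::nat. \<psi> n \<in> test_functions D"
    "(\<lambda>n. l2 ?M (\<lambda>x. \<psi> n x - u x)) \<longlonglongrightarrow> 0" "(\<lambda>n. l2 ?M (\<lambda>x. gradient (\<psi> n) x - g x)) \<longlonglongrightarrow> 0"
    using H10_gradE[OF u] by blast
  note \<psi>L = test_function_lebesgue_on[OF \<psi>(3) D]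
  have 1: "(\<lambda>n. \<mu> * (l2 ?M (\<psi> n))\<^sup>2) \<longlonglongrightarrow> \<mu> * (l2 ?M u)\<^sup>2"
    by (intro tendsto_intros l2_tendsto \<psi> \<psi>L)
  have 2: "(\<lambda>n. (l2 ?M (gradient (\<psi> n)))\<^sup>2) \<longlonglongrightarrow> (l2 ?M g)\<^sup>2"
    by (intro tendsto_intros l2_tendsto \<psi> \<psi>L)
  show ?thesis
    by (rule LIMSEQ_le[OF 1 2]) (use le[OF \<psi>(3)] \<psi>L(3,4) in \<open>auto simp: rayleigh_form_def\<close>)
qed

text \<open>The eigenvalue is defined by \<open>LEAST\<close> on the reals, which means something
  only if a least one exists. The infimum of the Rayleigh quotient is therefore shown to be attained
  by an eigenfunction, and to lie below every eigenvalue.\<close>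

lemma first_eigenvalue_rayleigh:
  fixes D :: "'a::euclidean_space set"
  assumes D: "open D" "bounded D" "D \<noteq> {}"
  shows "0 < first_eigenvalue D"
    and "\<And>\<phi>. \<phi> \<in> test_functions D \<Longrightarrow> 0 \<le> rayleigh_form (first_eigenvalue D) \<phi>"
    and "\<And>e. e > 0 \<Longrightarrow> \<exists>\<phi>\<in>test_functions D. l2 lborel \<phi> = 1 \<and> (l2 lborel (gradient \<phi>))\<^sup>2 < first_eigenvalue D + e"
proof -
  let ?M = "lebesgue_on D"
  define S where "S = {(l2 lborel (gradient \<phi>))\<^sup>2 | \<phi>. \<phi> \<in> test_functions D \<and> l2 lborel \<phi> = 1}"
  define \<mu> where "\<mu> = Inf S"
  obtain \<phi>0 where "\<phi>0 \<in> test_functions D" "l2 lborel \<phi>0 = 1"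
    using test_function_normalized_exists[OF D(1,3)] by blast
  then have ne: "S \<noteq> {}" by (auto simp: S_def)
  obtain R where R: "\<And>x. x \<in> D \<Longrightarrow> norm x \<le> R" "0 \<le> R"
    using D(2,3) bounded_iff norm_ge_zero by (metis bounded_pos less_imp_le)
  \<comment> \<open>The Poincare inequality bounds the quotients from below by a positive number, so
    the infimum exists and is positive.\<close>
  have lb: "(1 / (2 * R + 1))\<^sup>2 \<le> s" if s: "s \<in> S" for s
  proof -
    obtain \<phi> where \<phi>: "\<phi> \<in> test_functions D" "l2 lborel \<phi> = 1" "s = (l2 lborel (gradient \<phi>))\<^sup>2"
      using s by (auto simp: S_def)
    have "1 \<le> (2 * R + 1) * l2 lborel (gradient \<phi>)"
      using Poincare_inequality[OF \<phi>(1) R] \<phi>(2) by simp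
    then have "1 / (2 * R + 1) \<le> l2 lborel (gradient \<phi>)"
      using R(2) by (simp add: field_simps)
    then show ?thesis unfolding \<phi>(3) using R(2) by (intro power_mono) auto
  qed
  have bdd: "bdd_below S" using lb by (auto simp: bdd_below_def)
  have "(1 / (2 * R + 1))\<^sup>2 \<le> \<mu>"
    unfolding \<mu>_def by (rule cInf_greatest[OF ne lb])
  then have \<mu>pos: "\<mu> > 0" using R(2) by (smt (verit) zero_less_divide_1_iff zero_less_power)
  have nonneg: "0 \<le> rayleigh_form \<mu> \<phi>" if \<phi>: "\<phi> \<in> test_functions D" for \<phi>
  proof (cases "l2 lborel \<phi> = 0")
    case False
    define c where "c = l2 lborel \<phi>"
    have c: "c > 0" using False l2_nonneg[of lborel \<phi>] by (simp add: c_def less_le)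
    define \<psi> where "\<psi> x = (1 / c) * \<phi> x" for x
    have \<psi>: "\<psi> \<in> test_functions D" unfolding \<psi>_def[abs_def] by (rule test_functions_cmult[OF \<phi>])
    have l1: "l2 lborel \<psi> = 1"
      using l2_scaleR[of lborel "1 / c" \<phi>] c by (simp add: \<psi>_def[abs_def] c_def)
    have "\<mu> \<le> (l2 lborel (gradient \<psi>))\<^sup>2"
      unfolding \<mu>_def using \<psi> l1 by (intro cInf_lower[OF _ bdd]) (auto simp: S_def)
    then have "0 \<le> rayleigh_form \<mu> \<psi>" by (simp add: rayleigh_form_def l1)
    also have "\<dots> = (1 / c)\<^sup>2 * rayleigh_form \<mu> \<phi>"
      unfolding \<psi>_def by (rule rayleigh_form_cmult[OF \<phi>])
    finally show ?thesis using c by (simp add: zero_le_mult_iff zero_le_divide_iff)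
  qed (simp add: rayleigh_form_def)
  have approx: "\<exists>\<phi>\<in>test_functions D. l2 lborel \<phi> = 1 \<and> (l2 lborel (gradient \<phi>))\<^sup>2 < \<mu> + e" if "e > 0" for e
  proof -
    have "\<exists>s\<in>S. s < \<mu> + e"
      using cInf_less_iff[OF ne bdd, of "\<mu> + e"] that by (simp add: \<mu>_def)
    then show ?thesis by (auto simp: S_def)
  qed
  have "\<exists>\<phi>. \<forall>n. \<phi> n \<in> test_functions D \<and> l2 lborel (\<phi> n) = 1 \<and> (l2 lborel (gradient (\<phi> n)))\<^sup>2 < \<mu> + 1 / real (Suc n)"
  proof (intro choice allI)
    fix n :: nat
    have "1 / real (Suc n) > 0" by simp
    from approx[OF this] show "\<exists>\<phi>. \<phi> \<in> test_functions D \<and> l2 lborel \<phi> = 1 \<and> (l2 lborel (gradient \<phi>))\<^sup>2 < \<mu> + 1 / real (Suc n)"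
      by blast
  qed
  then obtain \<phi> where \<phi>: "\<And>n. \<phi> n \<in> test_functions D" "\<And>n. l2 lborel (\<phi> n) = 1"
    "\<And>n. (l2 lborel (gradient (\<phi> n)))\<^sup>2 < \<mu> + 1 / real (Suc n)" by blast
  have gb: "l2 lborel (gradient (\<phi> n)) \<le> \<mu> + 1" for n
  proof (rule power2_le_imp_le)
    have "1 / real (Suc n) \<le> 1" by simp
    moreover have "\<mu> + 1 \<le> (\<mu> + 1)\<^sup>2" using \<mu>pos by (intro self_le_power) auto
    ultimately show "(l2 lborel (gradient (\<phi> n)))\<^sup>2 \<le> (\<mu> + 1)\<^sup>2" using \<phi>(3)[of n] by linarith
  qed (use \<mu>pos in simp)
  have lb1: "l2 lborel (\<phi> n) \<le> \<mu> + 1" for n using \<phi>(2) \<mu>pos by simp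
  obtain r where r: "strict_mono (r :: nat \<Rightarrow> nat)"
    "\<And>e. e > 0 \<Longrightarrow> \<exists>N. \<forall>m\<ge>N. \<forall>n\<ge>N. l2 lborel (\<lambda>x. \<phi> (r m) x - \<phi> (r n) x) \<le> e"
    using Rellich[of D \<phi> "\<mu> + 1", OF D(2) \<phi>(1) lb1 gb] by blast
  define \<psi> where "\<psi> n = \<phi> (r n)" for n
  have \<psi>: "\<psi> n \<in> test_functions D" "l2 lborel (\<psi> n) = 1" for n
    using \<phi> by (auto simp: \<psi>_def)
  have q: "rayleigh_form \<mu> (\<psi> n) \<le> 1 / real (Suc n)" for n
  proof -
    have "rayleigh_form \<mu> (\<psi> n) \<le> 1 / real (Suc (r n))"
      using \<phi>(3)[of "r n"] \<psi>(2)[of n] by (simp add: rayleigh_form_def \<psi>_def)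
    also have "\<dots> \<le> 1 / real (Suc n)"
      using seq_suble[OF r(1), of n] by (intro divide_left_mono) auto
    finally show ?thesis .
  qed
  have qlim: "(\<lambda>n. rayleigh_form \<mu> (\<psi> n)) \<longlonglongrightarrow> 0"
    by (rule tendsto_sandwich[OF _ _ tendsto_const LIMSEQ_Suc[OF lim_1_over_n]])
      (use nonneg[OF \<psi>(1)] q in auto)
  note \<psi>L = test_function_lebesgue_on[OF \<psi>(1) D(1)]
  have diffT: "(\<lambda>x. \<psi> m x - \<psi> n x) \<in> test_functions D" for m n by (intro test_functions_diff \<psi>)
  have gdiff: "gradient (\<lambda>x. \<psi> m x - \<psi> n x) = (\<lambda>x. gradient (\<psi> m) x - gradient (\<psi> n) x)" for m n
    by (rule ext, rule gradient_diff; rule smooth_differentiable[OF test_functions_smooth[OF \<psi>(1)]])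
  \<comment> \<open>Parallelogram law for the nonnegative Rayleigh form: the form of a difference is
    at most twice the sum of the forms. Hence Cauchy in L2 becomes Cauchy for the gradients.\<close>
  have gle: "(l2 ?M (\<lambda>x. gradient (\<psi> m) x - gradient (\<psi> n) x))\<^sup>2
      \<le> \<mu> * (l2 ?M (\<lambda>x. \<psi> m x - \<psi> n x))\<^sup>2 + 2 / real (Suc m) + 2 / real (Suc n)" for m n
  proof -
    have "rayleigh_form \<mu> (\<lambda>x. \<psi> m x + (-1) * \<psi> n x) + rayleigh_form \<mu> (\<lambda>x. \<psi> m x + 1 * \<psi> n x)
        = 2 * rayleigh_form \<mu> (\<psi> m) + 2 * rayleigh_form \<mu> (\<psi> n)"
      unfolding rayleigh_form_add[OF \<psi>(1) \<psi>(1)] by simp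
    moreover have "0 \<le> rayleigh_form \<mu> (\<lambda>x. \<psi> m x + 1 * \<psi> n x)"
      using test_functions_add[OF \<psi>(1)[of m] \<psi>(1)[of n]] by (intro nonneg) simp
    ultimately have "rayleigh_form \<mu> (\<lambda>x. \<psi> m x - \<psi> n x) \<le> 2 * rayleigh_form \<mu> (\<psi> m) + 2 * rayleigh_form \<mu> (\<psi> n)"
      by simp
    also have "\<dots> \<le> 2 / real (Suc m) + 2 / real (Suc n)"
      using q[of m] q[of n] by simp
    finally show ?thesis
      using test_function_lebesgue_on(3,4)[OF diffT D(1), of m n]
      by (simp add: rayleigh_form_def gdiff del: of_nat_Suc)
  qed
  have C1: "\<exists>N. \<forall>m\<ge>N. \<forall>n\<ge>N. l2 ?M (\<lambda>x. \<psi> m x - \<psi> n x) \<le> e" if "e > 0" for e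
    using r(2)[OF that] test_function_lebesgue_on(3)[OF diffT D(1)] by (simp add: \<psi>_def)
  have C2: "\<exists>N. \<forall>m\<ge>N. \<forall>n\<ge>N. l2 ?M (\<lambda>x. gradient (\<psi> m) x - gradient (\<psi> n) x) \<le> e" if e: "e > 0" for e
  proof -
    \<comment> \<open>Chosen to spend half of \<open>e^2\<close> on the L2 term and leave a quarter
      for each of the two remainders.\<close>
    define d where "d = e / sqrt (2 * \<mu>)"
    have d: "d > 0" "\<mu> * d\<^sup>2 = e\<^sup>2 / 2" using e \<mu>pos by (auto simp: d_def power_divide)
    obtain N1 where N1: "\<And>m n. m \<ge> N1 \<Longrightarrow> n \<ge> N1 \<Longrightarrow> l2 ?M (\<lambda>x. \<psi> m x - \<psi> n x) \<le> d"
      using C1[OF d(1)] by blast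
    obtain N2 where N2: "8 / e\<^sup>2 < real N2" using reals_Archimedean2 by blast
    have small: "2 / real (Suc m) \<le> e\<^sup>2 / 4" if "m \<ge> N2" for m
    proof -
      have "8 / e\<^sup>2 \<le> real (Suc m)" using N2 that by simp
      then show ?thesis using e by (simp add: field_simps)
    qed
    show ?thesis
    proof (intro exI[of _ "max N1 N2"] allI impI)
      fix m n assume mn: "max N1 N2 \<le> m" "max N1 N2 \<le> n"
      have "\<mu> * (l2 ?M (\<lambda>x. \<psi> m x - \<psi> n x))\<^sup>2 \<le> \<mu> * d\<^sup>2"
        using mn \<mu>pos by (intro mult_left_mono power_mono N1) auto
      then have "(l2 ?M (\<lambda>x. gradient (\<psi> m) x - gradient (\<psi> n) x))\<^sup>2 \<le> e\<^sup>2"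
        using gle[of m n] d(2) small[of m] small[of n] mn by linarith
      then show "l2 ?M (\<lambda>x. gradient (\<psi> m) x - gradient (\<psi> n) x) \<le> e"
        by (rule power2_le_imp_le) (use e in simp)
    qed
  qed
  obtain u where u: "L2 ?M u" "(\<lambda>n. l2 ?M (\<lambda>x. \<psi> n x - u x)) \<longlonglongrightarrow> 0"
    using L2_complete[OF \<psi>L(1) C1] by blast
  obtain g where g: "L2 ?M g" "(\<lambda>n. l2 ?M (\<lambda>x. gradient (\<psi> n) x - g x)) \<longlonglongrightarrow> 0"
    using L2_complete[OF \<psi>L(2) C2] by blast
  have ug: "H10_grad D u g"
    unfolding H10_grad_def using u g \<psi>(1) by blast
  have "(\<lambda>n. l2 ?M (\<psi> n)) \<longlonglongrightarrow> l2 ?M u" by (rule l2_tendsto[OF u(1) \<psi>L(1) u(2)])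
  then have u1: "l2 ?M u = 1" using \<psi>L(3) \<psi>(2) by (simp add: LIMSEQ_const_iff)
  have test_eq: "(\<integral>x. g x \<bullet> gradient \<eta> x \<partial>?M) = (\<integral>x. (\<mu> * u x) * \<eta> x \<partial>?M)" if \<eta>: "\<eta> \<in> test_functions D" for \<eta>
  proof -
    note \<eta>L = test_function_lebesgue_on[OF \<eta> D(1)]
    define B where "B n = (\<integral>x. gradient (\<psi> n) x \<bullet> gradient \<eta> x \<partial>lborel) - \<mu> * (\<integral>x. \<psi> n x * \<eta> x \<partial>lborel)" for n
    \<comment> \<open>The Euler equation comes from Cauchy-Schwarz for the form: its value at the
      minimising sequence tends to 0, so its pairing with any fixed test function does too.\<close>
    have Ble: "(B n)\<^sup>2 \<le> rayleigh_form \<mu> (\<psi> n) * rayleigh_form \<mu> \<eta>" for n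
    proof (rule quadratic_nonneg_discriminant)
      fix t
      have "0 \<le> rayleigh_form \<mu> (\<lambda>x. \<psi> n x + t * \<eta> x)"
        by (intro nonneg test_functions_add test_functions_cmult \<psi> \<eta>)
      then show "0 \<le> rayleigh_form \<mu> (\<psi> n) + 2 * t * B n + t\<^sup>2 * rayleigh_form \<mu> \<eta>"
        unfolding rayleigh_form_add[OF \<psi>(1) \<eta>] B_def .
    qed
    have q0: "(\<lambda>n. rayleigh_form \<mu> (\<psi> n) * rayleigh_form \<mu> \<eta>) \<longlonglongrightarrow> 0"
      using tendsto_mult[OF qlim tendsto_const[of "rayleigh_form \<mu> \<eta>"]] by simp
    have "(\<lambda>n. (B n)\<^sup>2) \<longlonglongrightarrow> 0"
      by (rule tendsto_sandwich[OF _ _ tendsto_const q0]) (use Ble in auto)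
    then have B0: "B \<longlonglongrightarrow> 0"
      using tendsto_real_sqrt[of "\<lambda>n. (B n)\<^sup>2" 0 sequentially] by (simp add: tendsto_rabs_zero_iff)
    have Bn: "B n = (\<integral>x. gradient (\<psi> n) x \<bullet> gradient \<eta> x \<partial>?M) - \<mu> * (\<integral>x. \<psi> n x * \<eta> x \<partial>?M)" for n
    proof -
      have m: "(\<lambda>x. gradient (\<psi> n) x \<bullet> gradient \<eta> x) \<in> borel_measurable borel" "(\<lambda>x. \<psi> n x * \<eta> x) \<in> borel_measurable borel"
        using test_function_borel[OF \<psi>(1)] test_function_borel[OF \<eta>] by measurable
      obtain K where "K \<subseteq> D" "\<And>x. x \<notin> K \<Longrightarrow> \<eta> x = 0" "\<And>x. x \<notin> K \<Longrightarrow> gradient \<eta> x = 0"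
        using test_functionsE[OF \<eta>] by metis
      then have "\<And>x. x \<notin> D \<Longrightarrow> \<eta> x = 0" "\<And>x. x \<notin> D \<Longrightarrow> gradient \<eta> x = 0" by auto
      then show ?thesis
        using lebesgue_on_integral_support(1)[OF m(1) D(1)] lebesgue_on_integral_support(1)[OF m(2) D(1)]
        by (simp add: B_def)
    qed
    have "B \<longlonglongrightarrow> (\<integral>x. g x \<bullet> gradient \<eta> x \<partial>?M) - \<mu> * (\<integral>x. u x * \<eta> x \<partial>?M)"
      unfolding Bn[abs_def]
      by (intro tendsto_intros L2_inner_tendsto[OF g(1) \<psi>L(2) g(2) \<eta>L(2) \<eta>L(2)]
          L2_inner_tendsto_real[OF u(1) \<psi>L(1) u(2) \<eta>L(1) \<eta>L(1)]) (simp_all add: l2_def)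
    from LIMSEQ_unique[OF B0 this] show ?thesis by (simp add: mult.assoc)
  qed
  have eig: "dirichlet_eigenvalue D \<mu>"
    unfolding dirichlet_eigenvalue_def
  proof (intro bexI[of _ u] conjI ballI)
    show "\<not> zero_on D u"
    proof
      assume "zero_on D u"
      then have "(\<integral>x. (norm (u x))\<^sup>2 \<partial>?M) = 0"
        by (intro integral_eq_zero_AE) (auto elim!: eventually_mono)
      then show False using u1 by (simp add: l2_def)
    qed
    show "u \<in> H10 D" by (rule H10_grad_weak_gradient(1)[OF D(1) ug])
    fix v assume v: "v \<in> H10 D"
    note vg = H10_H10_grad[OF D(1) v]
    have "(\<integral>x. weak_gradient D u x \<bullet> weak_gradient D v x \<partial>?M) = (\<integral>x. g x \<bullet> weak_gradient D v x \<partial>?M)"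
      by (rule integral_weak_gradient_inner[OF D(1) ug vg])
    also have "\<dots> = (\<integral>x. (\<mu> * u x) * v x \<partial>?M)"
      by (rule H10_grad_inner_limit[OF D(1) vg test_eq g(1) L2_cmult[OF u(1)]])
    finally show "(\<integral>x. weak_gradient D u x \<bullet> weak_gradient D v x \<partial>?M) = \<mu> * (\<integral>x. u x * v x \<partial>?M)"
      by (simp add: mult.assoc)
  qed
  \<comment> \<open>An eigenfunction tested with itself has its eigenvalue as Rayleigh quotient, and
    the lower bound extends to it by density.\<close>
  have least: "\<mu> \<le> \<nu>" if "dirichlet_eigenvalue D \<nu>" for \<nu>
  proof -
    obtain w where w: "w \<in> H10 D" "\<not> zero_on D w"
      "(\<integral>x. weak_gradient D w x \<bullet> weak_gradient D w x \<partial>?M) = \<nu> * (\<integral>x. w x * w x \<partial>?M)"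
      using \<open>dirichlet_eigenvalue D \<nu>\<close> unfolding dirichlet_eigenvalue_def by blast
    note wg = H10_H10_grad[OF D(1) w(1)]
    then have wL: "L2 ?M w" by (simp add: H10_grad_def)
    have "\<mu> * (l2 ?M w)\<^sup>2 \<le> (l2 ?M (weak_gradient D w))\<^sup>2"
      by (rule H10_grad_lower_bound[OF D(1) wg nonneg])
    also have "\<dots> = \<nu> * (l2 ?M w)\<^sup>2"
      using w(3) unfolding l2_square_real by (simp add: l2_square power2_norm_eq_inner)
    finally have le: "\<mu> * (l2 ?M w)\<^sup>2 \<le> \<nu> * (l2 ?M w)\<^sup>2" .
    have "(l2 ?M w)\<^sup>2 \<noteq> 0"
    proof
      assume "(l2 ?M w)\<^sup>2 = 0"
      then have "(\<integral>x. (norm (w x))\<^sup>2 \<partial>?M) = 0" by (simp add: l2_square)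
      then have "AE x in ?M. (norm (w x))\<^sup>2 = 0"
        using L2_square_integrable[OF wL] by (subst (asm) integral_nonneg_eq_0_iff_AE) auto
      then show False using w(2) by simp
    qed
    then have "(l2 ?M w)\<^sup>2 > 0" by simp
    then show ?thesis using le by simp
  qed
  have "first_eigenvalue D = \<mu>"
    unfolding first_eigenvalue_def by (rule Least_equality[where P = "dirichlet_eigenvalue D", OF eig least])
  then show "0 < first_eigenvalue D"
    "\<And>\<phi>. \<phi> \<in> test_functions D \<Longrightarrow> 0 \<le> rayleigh_form (first_eigenvalue D) \<phi>"
    "\<And>e. e > 0 \<Longrightarrow> \<exists>\<phi>\<in>test_functions D. l2 lborel \<phi> = 1 \<and> (l2 lborel (gradient \<phi>))\<^sup>2 < first_eigenvalue D + e"
    using \<mu>pos nonneg approx by auto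
qed

subsection \<open>Dilations\<close>

lemma l2_dilation:
  fixes f :: "'a::euclidean_space \<Rightarrow> 'b::euclidean_space"
  assumes f: "f \<in> borel_measurable borel" and c: "c > 0"
  shows "(l2 lborel f)\<^sup>2 = c ^ DIM('a) * (l2 lborel (\<lambda>x. f (c *\<^sub>R x)))\<^sup>2"
proof -
  have "(\<lambda>x. (norm (f x))\<^sup>2) \<in> borel_measurable borel" using f by measurable
  from lborel_integral_affine[OF this c, of 0] show ?thesis by (simp add: l2_square)
qed

lemma L2_dilation:
  assumes \<phi>: "continuous_on UNIV \<phi>" "compact K" "\<And>x. x \<notin> K \<Longrightarrow> \<phi> x = 0" and c: "c > 0"
  shows "L2 lborel (\<lambda>x::'a::euclidean_space. \<phi> (c *\<^sub>R x) :: 'b::euclidean_space)"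
proof (rule L2_compact_support)
  show "continuous_on UNIV (\<lambda>x. \<phi> (c *\<^sub>R x))"
    by (intro continuous_on_compose2[OF \<phi>(1)] continuous_intros) auto
  show "compact ((\<lambda>x. (1 / c) *\<^sub>R x) ` K)" using \<phi>(2) by (rule compact_scaling)
  show "\<phi> (c *\<^sub>R x) = 0" if "x \<notin> (\<lambda>x. (1 / c) *\<^sub>R x) ` K" for x
    using that c image_eqI[of x "\<lambda>x. (1 / c) *\<^sub>R x" "c *\<^sub>R x" K] \<phi>(3)[of "c *\<^sub>R x"] by auto
qed

lemma gradient_dilation:
  assumes "\<phi> \<in> test_functions D"
  shows "gradient (\<lambda>x. \<phi> (c *\<^sub>R x)) = (\<lambda>x. c *\<^sub>R gradient \<phi> (c *\<^sub>R x))"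
  by (rule ext, rule gradient_scale, rule smooth_differentiable[OF test_functions_smooth[OF assms]])

lemma rayleigh_form_dilation:
  assumes \<phi>: "\<phi> \<in> test_functions (D :: 'a::euclidean_space set)" and c: "c > 0"
  shows "c ^ DIM('a) * rayleigh_form \<mu> (\<lambda>x. \<phi> (c *\<^sub>R x))
    = c\<^sup>2 * (l2 lborel (gradient \<phi>))\<^sup>2 - \<mu> * (l2 lborel \<phi>)\<^sup>2"
proof -
  have "(l2 lborel (gradient (\<lambda>x. \<phi> (c *\<^sub>R x))))\<^sup>2 = c\<^sup>2 * (l2 lborel (\<lambda>x. gradient \<phi> (c *\<^sub>R x)))\<^sup>2"
    unfolding gradient_dilation[OF \<phi>] l2_scaleR by (simp add: power_mult_distrib)
  then show ?thesis
    unfolding rayleigh_form_def l2_dilation[OF test_function_borel(1)[OF \<phi>] c] l2_dilation[OF test_function_borel(2)[OF \<phi>] c]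
    by (simp add: algebra_simps)
qed

text \<open>The path of dilates has velocity \<open>gradient \<phi> (t x) \<bullet> x\<close>, and
  on the support the norm of x is at most \<open>R / t\<close>. Keeping t above 1/2 bounds both this
  factor and the Jacobian.\<close>

lemma l2_dilation_diff_le:
  assumes \<phi>: "\<phi> \<in> test_functions (D :: 'a::euclidean_space set)" and D: "\<And>x. x \<in> D \<Longrightarrow> norm x \<le> R" and R: "0 \<le> R"
    and c: "1 / 2 \<le> c" "c < 1"
  shows "l2 lborel (\<lambda>x. \<phi> (c *\<^sub>R x) - \<phi> x) \<le> (1 - c) * (2 * R * 2 ^ DIM('a) * l2 lborel (gradient \<phi>))"
proof -
  obtain K where K: "compact K" "K \<subseteq> D" "\<And>x. x \<notin> K \<Longrightarrow> \<phi> x = 0" "\<And>x. x \<notin> K \<Longrightarrow> gradient \<phi> x = 0"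
    using test_functionsE[OF \<phi>] by metis
  note s = test_functions_smooth[OF \<phi>]
  note cont = smooth_continuous_on[OF s, of UNIV] smooth_gradient_continuous[OF s, of UNIV]
  obtain B where B: "B > 0" "\<And>x. norm (gradient \<phi> x) \<le> B"
    using bounded_compact_support[OF cont(2) K(1,4)] by metis
  have nx: "norm x \<le> R / t" if "t > 0" "t *\<^sub>R x \<in> K" for t x
    using D[of "t *\<^sub>R x"] K(2) that by (auto simp: field_simps)
  \<comment> \<open>The parameter interval extends down to 1/4, where the dilated support still fits
    into the ball of radius \<open>4 * R\<close>.\<close>
  have out: "t *\<^sub>R x \<notin> K" if "1 / 4 < t" "x \<notin> cball 0 (4 * R)" for t x
  proof
    assume "t *\<^sub>R x \<in> K"
    then have "norm x \<le> R / t" using that(1) by (intro nx) auto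
    also have "\<dots> \<le> R / (1 / 4)" using that(1) R by (intro divide_left_mono) auto
    finally show False using that by simp
  qed
  have bd: "\<bar>gradient \<phi> (t *\<^sub>R x) \<bullet> x\<bar> \<le> (R / t) * norm (gradient \<phi> (t *\<^sub>R x))" if "t > 0" for t x
  proof (cases "t *\<^sub>R x \<in> K")
    case True
    have "\<bar>gradient \<phi> (t *\<^sub>R x) \<bullet> x\<bar> \<le> norm (gradient \<phi> (t *\<^sub>R x)) * norm x" by (rule Cauchy_Schwarz_ineq2)
    also have "\<dots> \<le> norm (gradient \<phi> (t *\<^sub>R x)) * (R / t)" by (intro mult_left_mono nx that True) simp
    finally show ?thesis by (simp add: mult.commute)
  qed (simp add: K(4))
  have "l2 lborel (\<lambda>x. \<phi> (1 *\<^sub>R x) - \<phi> (c *\<^sub>R x)) \<le> (1 - c) * (2 * R * 2 ^ DIM('a) * l2 lborel (gradient \<phi>))"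
  proof (rule l2_increment_le[where l = "1 / 4" and u = 2 and \<Psi> = "\<lambda>t x. gradient \<phi> (t *\<^sub>R x) \<bullet> x"
        and K = "cball 0 (4 * R)" and B = "4 * R * B"])
    show "((\<lambda>t. \<phi> (t *\<^sub>R x)) has_real_derivative gradient \<phi> (t *\<^sub>R x) \<bullet> x) (at t)" for t x
      using has_real_derivative_along_line[of \<phi> 0 t x] smooth_differentiable[OF s] by simp
    show "continuous_on UNIV (\<lambda>x. \<phi> (t *\<^sub>R x))" for t
      by (intro continuous_on_compose2[OF cont(1)] continuous_intros) auto
    show "continuous_on UNIV (\<lambda>x. gradient \<phi> (t *\<^sub>R x) \<bullet> x)" for t
      by (intro continuous_on_inner continuous_on_id continuous_on_compose2[OF cont(2)] continuous_intros) auto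
    show "\<bar>gradient \<phi> (t *\<^sub>R x) \<bullet> x\<bar> \<le> 4 * R * B" if t: "1 / 4 < t" "t < 2" for t x
    proof -
      have "\<bar>gradient \<phi> (t *\<^sub>R x) \<bullet> x\<bar> \<le> (R / t) * norm (gradient \<phi> (t *\<^sub>R x))" using t by (intro bd) auto
      also have "\<dots> \<le> (R / (1 / 4)) * B"
        using t R B by (intro mult_mono divide_left_mono) auto
      finally show ?thesis by simp
    qed
    show "l2 lborel (\<lambda>x. gradient \<phi> (t *\<^sub>R x) \<bullet> x) \<le> 2 * R * 2 ^ DIM('a) * l2 lborel (gradient \<phi>)" if t: "c < t" "t < 1" for t
    proof -
      have t0: "t > 1 / 2" using t c by simp
      have gL: "L2 lborel (\<lambda>x. gradient \<phi> (t *\<^sub>R x))"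
        by (rule L2_dilation[OF cont(2) K(1,4)]) (use t0 in auto)
      have "l2 lborel (\<lambda>x. gradient \<phi> (t *\<^sub>R x) \<bullet> x) \<le> 2 * R * l2 lborel (\<lambda>x. gradient \<phi> (t *\<^sub>R x))"
      proof (rule L2_le(2)[OF gL])
        show "(\<lambda>x. gradient \<phi> (t *\<^sub>R x) \<bullet> x) \<in> borel_measurable lborel"
          using L2_measurable[OF gL] by measurable
        show "norm (gradient \<phi> (t *\<^sub>R x) \<bullet> x) \<le> 2 * R * norm (gradient \<phi> (t *\<^sub>R x))" for x
        proof -
          have "norm (gradient \<phi> (t *\<^sub>R x) \<bullet> x) \<le> (R / t) * norm (gradient \<phi> (t *\<^sub>R x))"
            using bd[of t x] t0 by simp
          also have "\<dots> \<le> (R / (1 / 2)) * norm (gradient \<phi> (t *\<^sub>R x))"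
            using t0 R by (intro mult_right_mono divide_left_mono) auto
          finally show ?thesis by simp
        qed
      qed (use R in simp)
      also have "l2 lborel (\<lambda>x. gradient \<phi> (t *\<^sub>R x)) \<le> 2 ^ DIM('a) * l2 lborel (gradient \<phi>)"
      proof (rule power2_le_imp_le)
        have "1 * (l2 lborel (\<lambda>x. gradient \<phi> (t *\<^sub>R x)))\<^sup>2
            \<le> (2 * t) ^ DIM('a) * (l2 lborel (\<lambda>x. gradient \<phi> (t *\<^sub>R x)))\<^sup>2"
          using t0 by (intro mult_right_mono one_le_power) auto
        also have "\<dots> = 2 ^ DIM('a) * (l2 lborel (gradient \<phi>))\<^sup>2"
          using t0 by (subst l2_dilation[OF test_function_borel(2)[OF \<phi>], of t]) (auto simp: power_mult_distrib)
        also have "\<dots> \<le> (2 ^ DIM('a))\<^sup>2 * (l2 lborel (gradient \<phi>))\<^sup>2"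
          by (intro mult_right_mono self_le_power) auto
        finally show "(l2 lborel (\<lambda>x. gradient \<phi> (t *\<^sub>R x)))\<^sup>2 \<le> (2 ^ DIM('a) * l2 lborel (gradient \<phi>))\<^sup>2"
          by (simp add: power_mult_distrib)
      qed simp
      finally show ?thesis using R by (simp add: mult.assoc mult_left_mono)
    qed
  qed (use c out K in auto)
  then show ?thesis by (simp add: l2_minus_commute)
qed

text \<open>The compact closure keeps a positive distance \<open>d\<close> from the complement, and
  dilation moves a point by at most \<open>s * R\<close>. No star-shapedness is involved.\<close>

lemma dilation_test_function:
  assumes "compactly_contained D' D" "open D"
  obtains s0 where "s0 > 0" "\<And>s K. 0 \<le> s \<Longrightarrow> s < s0 \<Longrightarrow> K \<subseteq> D' \<Longrightarrow> (\<lambda>x. (1 + s) *\<^sub>R x) ` K \<subseteq> D"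
proof -
  have c: "compact (closure D')" "closure D' \<subseteq> D"
    using assms(1) by (auto simp: compactly_contained_def)
  obtain d where d: "d > 0" "(\<Union>x\<in>closure D'. ball x d) \<subseteq> D"
    using compact_subset_open_imp_ball_epsilon_subset[OF c(1) assms(2) c(2)] by blast
  obtain R where R: "R > 0" "\<And>x. x \<in> closure D' \<Longrightarrow> norm x \<le> R"
    using compact_imp_bounded[OF c(1)] bounded_pos by metis
  show thesis
  proof
    show "d / R > 0" using d R by simp
    fix s and K :: "'a set" assume s: "0 \<le> s" "s < d / R" and K: "K \<subseteq> D'"
    show "(\<lambda>x. (1 + s) *\<^sub>R x) ` K \<subseteq> D"
    proof
      fix y assume "y \<in> (\<lambda>x. (1 + s) *\<^sub>R x) ` K"
      then obtain x where x: "x \<in> K" "y = (1 + s) *\<^sub>R x" by blast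
      have xc: "x \<in> closure D'" using x K closure_subset by blast
      have "dist x y = s * norm x" using s x by (simp add: dist_norm algebra_simps)
      also have "\<dots> \<le> s * R" using s R(2)[OF xc] by (simp add: mult_left_mono)
      also have "\<dots> < d" using s R by (simp add: field_simps)
      finally have "y \<in> ball x d" by simp
      then show "y \<in> D" using d(2) xc by blast
    qed
  qed
qed

lemma test_functions_dilation:
  assumes \<phi>: "\<phi> \<in> test_functions D'" and s: "0 \<le> s"
    and sub: "\<And>K. K \<subseteq> D' \<Longrightarrow> (\<lambda>x. (1 + s) *\<^sub>R x) ` K \<subseteq> D"
  shows "(\<lambda>x. \<phi> ((1 / (1 + s)) *\<^sub>R x)) \<in> test_functions D"
proof -
  obtain K where K: "compact K" "K \<subseteq> D'" "\<And>x. x \<notin> K \<Longrightarrow> \<phi> x = 0"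
    using test_functionsE[OF \<phi>] by metis
  show ?thesis
    unfolding test_functions_iff
  proof (intro conjI exI[of _ "(\<lambda>x. (1 + s) *\<^sub>R x) ` K"] allI impI)
    show "smooth (\<lambda>x. \<phi> ((1 / (1 + s)) *\<^sub>R x))" by (rule smooth_scale[OF test_functions_smooth[OF \<phi>]])
    show "compact ((\<lambda>x. (1 + s) *\<^sub>R x) ` K)" using K(1) by (rule compact_scaling)
    show "(\<lambda>x. (1 + s) *\<^sub>R x) ` K \<subseteq> D" by (rule sub[OF K(2)])
    fix x assume "x \<notin> (\<lambda>x. (1 + s) *\<^sub>R x) ` K"
    then show "\<phi> ((1 / (1 + s)) *\<^sub>R x) = 0"
      using s image_eqI[of x "\<lambda>x. (1 + s) *\<^sub>R x" "(1 / (1 + s)) *\<^sub>R x" K] K(3)[of "(1 / (1 + s)) *\<^sub>R x"] by auto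
  qed
qed

text \<open>A fixed dilation carries near-optimal functions of the inner domain into the outer one
  and multiplies their quotient by a factor below 1. Strictness thus comes from scaling and not from
  unique continuation.\<close>

lemma first_eigenvalue_strict_mono:
  fixes D D' :: "'a::euclidean_space set"
  assumes D: "open D" "bounded D" and D': "open D'" "D' \<noteq> {}" and sub: "compactly_contained D' D"
  shows "first_eigenvalue D < first_eigenvalue D'"
proof -
  have D'D: "D' \<subseteq> D" using sub closure_subset by (auto simp: compactly_contained_def)
  then have ne: "D \<noteq> {}" "bounded D'" using D'(2) D(2) bounded_subset by auto
  note ev = first_eigenvalue_rayleigh[OF D ne(1)]
  note ev' = first_eigenvalue_rayleigh[OF D'(1) ne(2) D'(2)]
  obtain s0 where s0: "s0 > 0" "\<And>s K. 0 \<le> s \<Longrightarrow> s < s0 \<Longrightarrow> K \<subseteq> D' \<Longrightarrow> (\<lambda>x. (1 + s) *\<^sub>R x) ` K \<subseteq> D"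
    using dilation_test_function[OF sub D(1)] by metis
  define s where "s = s0 / 2"
  have s: "0 < s" "s < s0" using s0(1) by (auto simp: s_def)
  define c where "c = 1 / (1 + s)"
  have c: "0 < c" "c < 1" using s by (auto simp: c_def)
  have "first_eigenvalue D \<le> c\<^sup>2 * first_eigenvalue D'"
  proof (rule field_le_epsilon)
    fix e :: real assume e: "e > 0"
    obtain \<phi> where \<phi>: "\<phi> \<in> test_functions D'" "l2 lborel \<phi> = 1" "(l2 lborel (gradient \<phi>))\<^sup>2 < first_eigenvalue D' + e"
      using ev'(3)[OF e] by blast
    have v: "(\<lambda>x. \<phi> (c *\<^sub>R x)) \<in> test_functions D"
      unfolding c_def by (rule test_functions_dilation[OF \<phi>(1)]) (use s s0(2)[of s] in auto)
    have "0 \<le> c ^ DIM('a) * rayleigh_form (first_eigenvalue D) (\<lambda>x. \<phi> (c *\<^sub>R x))"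
      using ev(2)[OF v] c by simp
    also have "\<dots> = c\<^sup>2 * (l2 lborel (gradient \<phi>))\<^sup>2 - first_eigenvalue D"
      using rayleigh_form_dilation[OF \<phi>(1) c(1)] \<phi>(2) by simp
    finally have "first_eigenvalue D \<le> c\<^sup>2 * (l2 lborel (gradient \<phi>))\<^sup>2" by simp
    also have "\<dots> \<le> c\<^sup>2 * (first_eigenvalue D' + e)"
      using \<phi>(3) by (intro mult_left_mono) auto
    also have "\<dots> \<le> c\<^sup>2 * first_eigenvalue D' + e"
      using c e power_le_one[of c 2] mult_right_mono[of "c\<^sup>2" 1 e] by (simp add: algebra_simps)
    finally show "first_eigenvalue D \<le> c\<^sup>2 * first_eigenvalue D' + e" .
  qed
  also have "\<dots> < 1 * first_eigenvalue D'"
    using ev'(1) c power_Suc_less_one[of c 1] by (intro mult_strict_right_mono) (auto simp: power2_eq_square)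
  finally show ?thesis by simp
qed

subsection \<open>The Nehari set\<close>

lemma integrable_lebesgue_on_bounded:
  fixes f :: "'a::euclidean_space \<Rightarrow> real"
  assumes "open D" "bounded D" "f \<in> borel_measurable (lebesgue_on D)" "AE x in lebesgue_on D. \<bar>f x\<bar> \<le> C"
  shows "integrable (lebesgue_on D) f"
proof -
  have "finite_measure (lebesgue_on D)"
    using assms(1,2) by (intro finite_measure_lebesgue_on lmeasurable_open)
  then show ?thesis
    by (rule finite_measure.integrable_const_bound[of _ f C]) (use assms(3,4) in auto)
qed

lemma M_integrable:
  fixes w :: "'a::euclidean_space \<Rightarrow> real"
  assumes D: "open D" "bounded D" and m: "essentially_bounded D m" and p: "0 \<le> p"
    and w: "w \<in> borel_measurable (lebesgue_on D)" "\<And>x. x \<in> D \<Longrightarrow> \<bar>w x\<bar> \<le> B"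
  shows "integrable (lebesgue_on D) (\<lambda>x. m x * \<bar>w x\<bar> powr p)"
proof -
  obtain C where C: "AE x in lebesgue_on D. \<bar>m x\<bar> \<le> C" and mm: "m \<in> borel_measurable (lebesgue_on D)"
    using m by (auto simp: essentially_bounded_def)
  show ?thesis
  proof (rule integrable_lebesgue_on_bounded[OF D])
    show "(\<lambda>x. m x * \<bar>w x\<bar> powr p) \<in> borel_measurable (lebesgue_on D)"
      using mm w(1) by measurable
    have "AE x in lebesgue_on D. x \<in> D" by (rule AE_I2) (simp add: space_restrict_space)
    then show "AE x in lebesgue_on D. \<bar>m x * \<bar>w x\<bar> powr p\<bar> \<le> C * B powr p"
      using C
    proof eventually_elim
      case (elim x)
      have "\<bar>w x\<bar> powr p \<le> B powr p" using w(2)[OF elim(1)] p by (intro powr_mono2) auto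
      then show ?case using elim(2) by (auto simp: abs_mult intro!: mult_mono)
    qed
  qed
qed

text \<open>Both forms are negative and scale with the powers 2 and \<open>\<alpha> + 1\<close> of
  t, so exactly this t balances them. On the balanced ray the second condition reads
  \<open>(1 - \<alpha>) * M < 0\<close>.\<close>

lemma nehari_projection:
  assumes D: "open D" "bounded D" and m: "essentially_bounded D m" and \<alpha>: "0 < \<alpha>" "\<alpha> < 1"
    and w: "w \<in> test_functions D" and H: "rayleigh_form \<mu> w < 0" and M: "M_form D m \<alpha> w < 0"
    and t: "t = (M_form D m \<alpha> w / rayleigh_form \<mu> w) powr (1 / (1 - \<alpha>))"
  shows "(\<lambda>x. t * w x) \<in> nehari_minus D m \<alpha> \<mu>" "M_form D m \<alpha> (\<lambda>x. t * w x) = t powr (\<alpha> + 1) * M_form D m \<alpha> w"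
proof -
  have t0: "t > 0" using H M by (simp add: t)
  show Mt: "M_form D m \<alpha> (\<lambda>x. t * w x) = t powr (\<alpha> + 1) * M_form D m \<alpha> w"
    unfolding M_form_def using t0
    by (subst Bochner_Integration.integral_mult_right_zero[symmetric], intro Bochner_Integration.integral_cong)
      (auto simp: abs_mult powr_mult mult.left_commute)
  note tw = test_functions_cmult[OF w, of t]
  have Hf: "H_form D \<mu> (\<lambda>x. t * w x) = t\<^sup>2 * rayleigh_form \<mu> w"
    using H_form_eq[OF D(1) H10_grad_test_function[OF tw D(1)], of \<mu>] test_function_lebesgue_on(3,4)[OF tw D(1)]
      rayleigh_form_cmult[OF w, of \<mu> t] by (simp add: rayleigh_form_def)
  have "t powr (1 - \<alpha>) = M_form D m \<alpha> w / rayleigh_form \<mu> w"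
    using \<alpha> H M by (simp add: t powr_powr)
  then have "t powr (\<alpha> + 1) * (t powr (1 - \<alpha>) * rayleigh_form \<mu> w) = t powr (\<alpha> + 1) * M_form D m \<alpha> w"
    using H by simp
  moreover have "t powr (\<alpha> + 1) * t powr (1 - \<alpha>) = t\<^sup>2"
    using t0 by (simp add: powr_add[symmetric])
  ultimately have HM: "H_form D \<mu> (\<lambda>x. t * w x) = M_form D m \<alpha> (\<lambda>x. t * w x)"
    by (simp add: Hf Mt mult.assoc[symmetric])
  have Mneg: "M_form D m \<alpha> (\<lambda>x. t * w x) < 0" using M t0 by (simp add: Mt mult_pos_neg)
  have "\<not> zero_on D (\<lambda>x. t * w x)"
  proof
    assume "zero_on D (\<lambda>x. t * w x)"
    then have "M_form D m \<alpha> (\<lambda>x. t * w x) = 0"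
      unfolding M_form_def by (intro integral_eq_zero_AE) (auto elim!: eventually_mono)
    then show False using Mneg by simp
  qed
  moreover have "(1 - \<alpha>) * M_form D m \<alpha> (\<lambda>x. t * w x) < 0" using \<alpha> Mneg by (simp add: mult_pos_neg)
  moreover have "(\<lambda>x. t * w x) \<in> H10 D"
    by (rule H10_grad_weak_gradient(1)[OF D(1) H10_grad_test_function[OF tw D(1)]])
  ultimately show "(\<lambda>x. t * w x) \<in> nehari_minus D m \<alpha> \<mu>"
    using HM by (simp add: nehari_minus_def algebra_simps)
qed

lemma M_form_nonpos:
  assumes "AE x in lebesgue_on D. m x \<le> 0"
  shows "M_form D m \<alpha> w \<le> 0"
proof -
  have "0 \<le> (\<integral>x. - (m x * \<bar>w x\<bar> powr (\<alpha> + 1)) \<partial>lebesgue_on D)"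
    using assms by (intro integral_nonneg_AE) (auto elim!: eventually_mono simp: mult_nonpos_nonneg)
  then show ?thesis by (simp add: M_form_def)
qed

lemma nehari_energy:
  assumes "w \<in> nehari_minus D m \<alpha> \<mu>" "0 < \<alpha>"
  shows "energy D m \<alpha> \<mu> w = (1 - \<alpha>) / (2 * (\<alpha> + 1)) * (- M_form D m \<alpha> w)"
  using assms by (simp add: nehari_minus_def energy_def field_simps)

text \<open>On the Nehari set the energy is a fixed positive multiple of -M and so bounded below by
  0; minimality of the energy is therefore minimality of -M.\<close>

lemma nehari_minimizer_M_le:
  assumes u: "nehari_minus_solution D m \<alpha> \<mu> u" and w: "w \<in> nehari_minus D m \<alpha> \<mu>"
    and m: "AE x in lebesgue_on D. m x \<le> 0" and \<alpha>: "0 < \<alpha>" "\<alpha> < 1"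
  shows "- M_form D m \<alpha> u \<le> - M_form D m \<alpha> w"
proof -
  let ?c = "(1 - \<alpha>) / (2 * (\<alpha> + 1))"
  have c: "?c > 0" using \<alpha> by simp
  have "bdd_below (energy D m \<alpha> \<mu> ` nehari_minus D m \<alpha> \<mu>)"
  proof (rule bdd_belowI2[of _ 0])
    fix v assume v: "v \<in> nehari_minus D m \<alpha> \<mu>"
    show "0 \<le> energy D m \<alpha> \<mu> v"
      unfolding nehari_energy[OF v \<alpha>(1)] using c M_form_nonpos[OF m, of \<alpha> v] by (intro mult_nonneg_nonneg) auto
  qed
  then have "energy D m \<alpha> \<mu> u \<le> energy D m \<alpha> \<mu> w"
    using u w by (auto simp: nehari_minus_solution_def intro: cINF_lower)
  moreover have "u \<in> nehari_minus D m \<alpha> \<mu>" using u by (simp add: nehari_minus_solution_def)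
  ultimately have "?c * (- M_form D m \<alpha> u) \<le> ?c * (- M_form D m \<alpha> w)"
    using nehari_energy[OF _ \<alpha>(1)] w by metis
  then show ?thesis unfolding mult_le_cancel_left_pos[OF c] .
qed

text \<open>Split at the level s: below it the power is at most
  \<open>s powr (\<alpha> + 1)\<close>, above it the negative exponent \<open>\<alpha> - 1\<close>
  favours s. A squared L2 norm of order \<open>s^2\<close> thereby yields order
  \<open>s powr (\<alpha> + 1)\<close>.\<close>

lemma powr_le_square_plus:
  fixes s y \<alpha> :: real
  assumes "s > 0" "0 < \<alpha>" "\<alpha> < 1"
  shows "\<bar>y\<bar> powr (\<alpha> + 1) \<le> s powr (\<alpha> - 1) * y\<^sup>2 + s powr (\<alpha> + 1)"
proof (cases "\<bar>y\<bar> \<le> s")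
  case True
  then have "\<bar>y\<bar> powr (\<alpha> + 1) \<le> s powr (\<alpha> + 1)" using assms by (intro powr_mono2) auto
  then show ?thesis by (simp add: add_increasing)
next
  case False
  then have y: "\<bar>y\<bar> > 0" "s \<le> \<bar>y\<bar>" using assms(1) by auto
  have "\<bar>y\<bar> powr (\<alpha> + 1) = \<bar>y\<bar> powr ((\<alpha> - 1) + 2)" by (simp add: algebra_simps)
  also have "\<dots> = \<bar>y\<bar> powr (\<alpha> - 1) * y\<^sup>2"
    using y(1) by (subst powr_add) (simp add: powr_numeral)
  also have "\<dots> \<le> s powr (\<alpha> - 1) * y\<^sup>2"
    using y assms by (intro mult_right_mono powr_mono2') auto
  finally show ?thesis by (simp add: add_increasing2)
qed

text \<open>The competitor is a dilate of a nearly optimal function of the inner domain plus a small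
  multiple of a fixed function \<open>\<psi>\<close> supported where \<open>m < 0\<close>. Dilation by \<open>1 + s\<close> lowers the
  quadratic form by an amount of order \<open>s\<close>, while its mass outside the inner domain is only of
  order \<open>s\<close> in the \<open>L\<^sup>2\<close> norm; \<open>\<psi>\<close> keeps \<open>M\<close> from vanishing.\<close>

lemma nehari_small_M:
  fixes D D' :: "'a::euclidean_space set"
  assumes D: "open D" "bounded D" and D': "open D'" "D' \<noteq> {}" and sub: "compactly_contained D' D"
    and m: "essentially_bounded D m" "AE x in lebesgue_on D. m x \<le> 0" "\<And>x. x \<in> D' \<Longrightarrow> m x = 0"
    and \<alpha>: "0 < \<alpha>" "\<alpha> < 1"
    and \<psi>: "\<psi> \<in> test_functions D" "M_form D m \<alpha> \<psi> < 0"
    and K: "compact K" "\<And>x. x \<notin> K \<Longrightarrow> \<psi> x = 0" "\<And>x. x \<notin> K \<Longrightarrow> gradient \<psi> x = 0" "K \<inter> closure D' = {}"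
  obtains C s1 where "C > 0" "s1 > 0"
    "\<And>s \<mu>. 0 < s \<Longrightarrow> s < s1 \<Longrightarrow> first_eigenvalue D' - s * first_eigenvalue D' / 2 < \<mu> \<Longrightarrow> \<mu> < first_eigenvalue D'
      \<Longrightarrow> \<exists>w\<in>nehari_minus D m \<alpha> \<mu>. - M_form D m \<alpha> w \<le> C * s powr (\<alpha> + 1)"
proof -
  let ?M = "lebesgue_on D" and ?p = "\<alpha> + 1"
  define l where "l = first_eigenvalue D'"
  have D'D: "D' \<subseteq> D" using sub closure_subset by (auto simp: compactly_contained_def)
  have bD': "bounded D'" using D'D D(2) bounded_subset by blast
  note ev' = first_eigenvalue_rayleigh[OF D'(1) bD' D'(2), folded l_def]
  have l: "l > 0" by (rule ev'(1))
  \<comment> \<open>Dilating inside the complement of \<open>K\<close> keeps the dilate and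
    \<open>\<psi>\<close> apart, so that both forms split into sums without cross terms.\<close>
  have opK: "open (D - K)" using D(1) K(1) by (simp add: open_Diff compact_imp_closed)
  have subK: "compactly_contained D' (D - K)" using sub K(4) by (auto simp: compactly_contained_def)
  obtain s0 where s0: "s0 > 0" "\<And>s L. 0 \<le> s \<Longrightarrow> s < s0 \<Longrightarrow> L \<subseteq> D' \<Longrightarrow> (\<lambda>x. (1 + s) *\<^sub>R x) ` L \<subseteq> D - K"
    using dilation_test_function[OF subK opK] by metis
  obtain R where R: "R > 0" "\<And>x. x \<in> D' \<Longrightarrow> norm x \<le> R" using bD' bounded_pos by metis
  obtain Cm0 where Cm0: "AE x in ?M. \<bar>m x\<bar> \<le> Cm0" using m(1) by (auto simp: essentially_bounded_def)
  define Cm where "Cm = max Cm0 0"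
  have Cm: "0 \<le> Cm" "AE x in ?M. \<bar>m x\<bar> \<le> Cm" using Cm0 by (auto simp: Cm_def elim!: eventually_mono)
  define L where "L = 2 * R * 2 ^ DIM('a)"
  define V :: real where "V = (\<integral>x. 1 \<partial>?M)"
  define C\<psi> where "C\<psi> = (l2 lborel (gradient \<psi>))\<^sup>2"
  \<comment> \<open>Coefficient of \<open>s powr (\<alpha> + 1)\<close> in the bound for -M of the
    unscaled competitor: the dilate contributes the first summand, \<open>\<psi>\<close> the
    second.\<close>
  define C1 where "C1 = Cm * (L\<^sup>2 * (2 * l) + V) + (- M_form D m \<alpha> \<psi>)"
  \<comment> \<open>Bound for the projection factor: the quotient of the two forms is at most
    \<open>C1 * s powr (\<alpha> + 1)\<close> over \<open>s * l / 4\<close>.\<close>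
  define T where "T = (4 * C1 / l) powr (1 / (1 - \<alpha>))"
  \<comment> \<open>The three caps keep the dilate inside \<open>D - K\<close>, validate a numerical
    estimate, and let the quadratic term of \<open>\<psi>\<close> consume at most half of the
    gain.\<close>
  define s1 where "s1 = min s0 (min (1 / 4) (l / (4 * (C\<psi> + 1))))"
  have V0: "0 \<le> V" unfolding V_def by (rule Bochner_Integration.integral_nonneg) simp
  have C\<psi>0: "0 \<le> C\<psi>" by (simp add: C\<psi>_def)
  have "0 \<le> Cm * (L\<^sup>2 * (2 * l) + V)" using Cm(1) V0 l by (intro mult_nonneg_nonneg add_nonneg_nonneg) auto
  then have C1: "C1 > 0" using \<psi>(2) by (simp add: C1_def)
  show thesis
  proof
    show "T powr ?p * C1 > 0" using C1 l \<alpha> by (simp add: T_def)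
    show "s1 > 0" using s0(1) l C\<psi>0 by (simp add: s1_def)
    fix s \<mu> assume s: "0 < s" "s < s1" and \<mu>: "first_eigenvalue D' - s * first_eigenvalue D' / 2 < \<mu>" "\<mu> < first_eigenvalue D'"
    note \<mu> = \<mu>[folded l_def]
    have s': "s < s0" "s < 1 / 4" "s * (C\<psi> + 1) < l / 4"
      using s C\<psi>0 by (auto simp: s1_def field_simps)
    have "s * l / 2 < l" using s'(2) l by simp
    then have \<mu>0: "\<mu> > 0" using \<mu>(1) by linarith
    define c where "c = 1 / (1 + s)"
    have c: "1 / 2 \<le> c" "c < 1" "0 < c" "1 - c \<le> s" using s s' by (auto simp: c_def field_simps)
    have "s * l / 2 > 0" using s l by simp
    from ev'(3)[OF this] obtain \<phi> where \<phi>: "\<phi> \<in> test_functions D'" "l2 lborel \<phi> = 1"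
      "(l2 lborel (gradient \<phi>))\<^sup>2 < l + s * l / 2" by blast
    define v where "v x = \<phi> (c *\<^sub>R x)" for x
    have vK: "v \<in> test_functions (D - K)"
      unfolding v_def[abs_def] c_def by (rule test_functions_dilation[OF \<phi>(1)]) (use s s0(2)[of s] s' in auto)
    have vD: "v \<in> test_functions D" by (rule test_functions_mono[OF vK]) blast
    have \<phi>D: "\<phi> \<in> test_functions D" by (rule test_functions_mono[OF \<phi>(1) D'D])
    obtain Kv where Kv: "Kv \<subseteq> D - K" "\<And>x. x \<notin> Kv \<Longrightarrow> v x = 0" "\<And>x. x \<notin> Kv \<Longrightarrow> gradient v x = 0"
      using test_functionsE[OF vK] by metis
    have disj: "v x = 0 \<and> gradient v x = 0 \<or> \<psi> x = 0 \<and> gradient \<psi> x = 0" for x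
      using Kv K(2,3) by blast
    \<comment> \<open>The dilation gains about 2 s to first order, near-optimality costs s / 2, and
      the difference is at least s. The gap between \<open>\<mu>\<close> and \<open>l\<close> costs
      another s / 2, which leaves the form below -s l / 2.\<close>
    have "c\<^sup>2 * (1 + s / 2) \<le> 1 - s"
    proof -
      have "1 + s / 2 \<le> (1 - s) * (1 + s)\<^sup>2"
      proof -
        have "(1 - s) * (1 + s)\<^sup>2 = 1 + s - s * s - s * s * s" by (simp add: power2_eq_square algebra_simps)
        moreover have "s * s \<le> s / 4" using s s' by (simp add: mult_left_mono)
        moreover have "s * s * s \<le> s / 4 * 1" using s s' \<open>s * s \<le> s / 4\<close> by (intro mult_mono) auto
        ultimately show ?thesis by simp
      qed
      then show ?thesis using s by (simp add: c_def power_divide divide_simps)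
    qed
    then have "c\<^sup>2 * (l + s * l / 2) \<le> (1 - s) * l"
      using mult_right_mono[of "c\<^sup>2 * (1 + s / 2)" "1 - s" l] l by (simp add: algebra_simps)
    moreover have "c\<^sup>2 * (l2 lborel (gradient \<phi>))\<^sup>2 \<le> c\<^sup>2 * (l + s * l / 2)"
      using \<phi>(3) by (intro mult_left_mono) auto
    ultimately have "c ^ DIM('a) * rayleigh_form \<mu> v \<le> - (s * l / 2)"
      using rayleigh_form_dilation[OF \<phi>(1) c(3), of \<mu>] \<phi>(2) \<mu>(1) by (simp add: v_def[abs_def] algebra_simps)
    moreover have cN: "0 < c ^ DIM('a)" "c ^ DIM('a) \<le> 1" using c by (auto intro: power_le_one)
    \<comment> \<open>The bound is negative and the power of c is at most 1, so multiplying the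
      bound by it only raises it; the common factor then cancels.\<close>
    moreover have "c ^ DIM('a) * (- (s * l / 2)) \<ge> 1 * (- (s * l / 2))"
      using cN s l by (intro mult_right_mono_neg) auto
    ultimately have "c ^ DIM('a) * rayleigh_form \<mu> v \<le> c ^ DIM('a) * (- (s * l / 2))" by linarith
    then have rv: "rayleigh_form \<mu> v \<le> - (s * l / 2)"
      unfolding mult_le_cancel_left_pos[OF cN(1)] .
    define w0 where "w0 x = v x + s * \<psi> x" for x
    have w0: "w0 \<in> test_functions D"
      unfolding w0_def[abs_def] by (intro test_functions_add test_functions_cmult vD \<psi>)
    have "(\<lambda>x. gradient v x \<bullet> gradient \<psi> x) = (\<lambda>x. 0)" "(\<lambda>x. v x * \<psi> x) = (\<lambda>x. 0)"
      using disj by (metis inner_zero_left inner_zero_right, metis mult_zero_left mult_zero_right)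
    then have "rayleigh_form \<mu> w0 = rayleigh_form \<mu> v + s\<^sup>2 * rayleigh_form \<mu> \<psi>"
      using rayleigh_form_add[OF vD \<psi>(1), of \<mu> s] by (simp add: w0_def[abs_def])
    also have "\<dots> \<le> - (s * l / 2) + s\<^sup>2 * C\<psi>"
      using \<mu>0 by (intro add_mono rv mult_left_mono) (auto simp: rayleigh_form_def C\<psi>_def)
    also have "\<dots> \<le> - (s * l / 4)"
    proof -
      have "s * (s * (C\<psi> + 1)) \<le> s * (l / 4)" using s s' by (intro mult_left_mono) auto
      moreover have "s * (s * C\<psi>) \<le> s * (s * (C\<psi> + 1))" using s by (intro mult_left_mono) auto
      ultimately have "s * (s * C\<psi>) \<le> s * (l / 4)" by (rule order_trans[rotated])
      then show ?thesis by (simp add: power2_eq_square algebra_simps)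
    qed
    finally have H: "rayleigh_form \<mu> w0 \<le> - (s * l / 4)" .
    then have Hneg: "rayleigh_form \<mu> w0 < 0" using s l by (smt (verit) mult_pos_pos divide_pos_pos)
    have bw: "\<exists>B. \<forall>x. \<bar>f x\<bar> \<le> B" if "f \<in> test_functions D" for f
    proof -
      obtain K where "compact K" "\<And>x. x \<notin> K \<Longrightarrow> f x = 0" using test_functionsE[OF \<open>f \<in> test_functions D\<close>] by metis
      from bounded_compact_support[OF smooth_continuous_on[OF test_functions_smooth[OF \<open>f \<in> test_functions D\<close>]] this]
      show ?thesis by (metis real_norm_def)
    qed
    have Mi: "integrable ?M (\<lambda>x. m x * \<bar>f x\<bar> powr ?p)" if f: "f \<in> test_functions D" for f
    proof -
      obtain B where "\<And>x. \<bar>f x\<bar> \<le> B" using bw[OF f] by blast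
      then show ?thesis
        using \<alpha> by (intro M_integrable[OF D m(1), where B = B] borel_measurable_lebesgue_on test_function_borel(1)[OF f]) auto
    qed
    have Mw0: "M_form D m \<alpha> w0 = M_form D m \<alpha> v + s powr ?p * M_form D m \<alpha> \<psi>"
    proof -
      have "m x * \<bar>w0 x\<bar> powr ?p = m x * \<bar>v x\<bar> powr ?p + s powr ?p * (m x * \<bar>\<psi> x\<bar> powr ?p)" for x
        using disj[of x] s \<alpha> by (auto simp: w0_def abs_mult powr_mult)
      then show ?thesis
        unfolding M_form_def using Mi[OF vD] Mi[OF \<psi>(1)] by simp
    qed
    have i1: "integrable ?M (\<lambda>x. 1 :: real)"
      by (rule integrable_lebesgue_on_bounded[OF D, of _ 1]) auto
    have dL: "L2 ?M (\<lambda>x. v x - \<phi> x)"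
      by (intro L2_diff test_function_lebesgue_on D vD \<phi>D)
    have dl2: "(l2 ?M (\<lambda>x. v x - \<phi> x))\<^sup>2 \<le> s\<^sup>2 * (L\<^sup>2 * (2 * l))"
    proof -
      have "l2 ?M (\<lambda>x. v x - \<phi> x) = l2 lborel (\<lambda>x. v x - \<phi> x)"
        by (rule test_function_lebesgue_on(3)[OF test_functions_diff[OF vD \<phi>D] D(1)])
      also have "\<dots> \<le> (1 - c) * (L * l2 lborel (gradient \<phi>))"
        unfolding v_def L_def using l2_dilation_diff_le[OF \<phi>(1) R(2) _ c(1,2)] R(1) by (simp add: mult.assoc)
      also have "\<dots> \<le> s * (L * l2 lborel (gradient \<phi>))"
        using c R(1) by (intro mult_right_mono) (auto simp: L_def)
      finally have "(l2 ?M (\<lambda>x. v x - \<phi> x))\<^sup>2 \<le> (s * (L * l2 lborel (gradient \<phi>)))\<^sup>2"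
        by (intro power_mono) auto
      also have "\<dots> = s\<^sup>2 * (L\<^sup>2 * (l2 lborel (gradient \<phi>))\<^sup>2)" by (simp add: power_mult_distrib)
      also have "\<dots> \<le> s\<^sup>2 * (L\<^sup>2 * (2 * l))"
      proof (intro mult_left_mono)
        have "s * l / 2 \<le> l" using s' l by simp
        then show "(l2 lborel (gradient \<phi>))\<^sup>2 \<le> 2 * l" using \<phi>(3) by linarith
      qed auto
      finally show ?thesis .
    qed
    have Mv: "- M_form D m \<alpha> v \<le> Cm * (L\<^sup>2 * (2 * l) + V) * s powr ?p"
    proof -
      let ?h = "\<lambda>x. Cm * (s powr (\<alpha> - 1) * (v x - \<phi> x)\<^sup>2 + s powr ?p * 1)"
      have ih: "integrable ?M (\<lambda>x. (v x - \<phi> x)\<^sup>2)" using L2_square_integrable[OF dL] by simp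
      have ih': "integrable ?M (\<lambda>x. s powr (\<alpha> - 1) * (v x - \<phi> x)\<^sup>2)" "integrable ?M (\<lambda>x. s powr ?p * 1)"
        by (intro integrable_mult_right ih i1)+
      have "- M_form D m \<alpha> v = (\<integral>x. - (m x * \<bar>v x\<bar> powr ?p) \<partial>?M)" by (simp add: M_form_def)
      also have "\<dots> \<le> (\<integral>x. ?h x \<partial>?M)"
      proof (rule integral_mono_AE)
        show "AE x in ?M. - (m x * \<bar>v x\<bar> powr ?p) \<le> ?h x"
          using Cm(2)
        proof eventually_elim
          case (elim x)
          show ?case
          proof (cases "x \<in> D'")
            case True
            then show ?thesis using m(3) Cm(1) by (simp add: mult_nonneg_nonneg)
          next
            case False
            \<comment> \<open>Outside the inner domain \<open>v\<close> equals its difference from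
              \<open>\<phi>\<close>, and inside it \<open>m\<close> vanishes, so -M sees only the
              small displaced part.\<close>
            then have "\<phi> x = 0" using test_functionsE[OF \<phi>(1)] by (metis subsetD)
            then have "\<bar>v x\<bar> powr ?p \<le> s powr (\<alpha> - 1) * (v x - \<phi> x)\<^sup>2 + s powr ?p * 1"
              using powr_le_square_plus[OF s(1) \<alpha>, of "v x"] by simp
            then have "(- m x) * \<bar>v x\<bar> powr ?p \<le> ?h x"
              using elim Cm(1) by (intro mult_mono) auto
            then show ?thesis by simp
          qed
        qed
        show "integrable ?M ?h" by (intro integrable_mult_right Bochner_Integration.integrable_add ih')
        show "integrable ?M (\<lambda>x. - (m x * \<bar>v x\<bar> powr ?p))" using Mi[OF vD] by simp
      qed
      also have "\<dots> = Cm * (s powr (\<alpha> - 1) * (l2 ?M (\<lambda>x. v x - \<phi> x))\<^sup>2 + s powr ?p * V)"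
      proof -
        have "(\<integral>x. ?h x \<partial>?M) = Cm * (s powr (\<alpha> - 1) * (\<integral>x. (v x - \<phi> x)\<^sup>2 \<partial>?M) + s powr ?p * V)"
          unfolding V_def Bochner_Integration.integral_mult_right_zero
          unfolding Bochner_Integration.integral_add[OF ih'] Bochner_Integration.integral_mult_right_zero ..
        then show ?thesis by (simp add: l2_square)
      qed
      also have "\<dots> \<le> Cm * (s powr (\<alpha> - 1) * (s\<^sup>2 * (L\<^sup>2 * (2 * l))) + s powr ?p * V)"
        using Cm(1) dl2 by (intro mult_left_mono add_right_mono) auto
      also have "s powr (\<alpha> - 1) * (s\<^sup>2 * (L\<^sup>2 * (2 * l))) = s powr ?p * (L\<^sup>2 * (2 * l))"
      proof -
        have "s powr (\<alpha> - 1) * s\<^sup>2 = s powr ((\<alpha> - 1) + 2)"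
          using s(1) by (subst powr_add) (simp add: powr_numeral)
        then show ?thesis by (simp add: mult.assoc[symmetric] add.commute)
      qed
      finally show ?thesis by (simp add: algebra_simps)
    qed
    have Mw0_le: "- M_form D m \<alpha> w0 \<le> C1 * s powr ?p"
      using Mv unfolding Mw0 C1_def by (simp add: algebra_simps)
    have "s powr ?p * M_form D m \<alpha> \<psi> < 0" using \<psi>(2) s by (simp add: mult_pos_neg)
    then have Mneg: "M_form D m \<alpha> w0 < 0" using Mw0 M_form_nonpos[OF m(2), of \<alpha> v] by linarith
    define t where "t = (M_form D m \<alpha> w0 / rayleigh_form \<mu> w0) powr (1 / (1 - \<alpha>))"
    note np = nehari_projection[OF D m(1) \<alpha> w0 Hneg Mneg t_def]
    have "M_form D m \<alpha> w0 / rayleigh_form \<mu> w0 = (- M_form D m \<alpha> w0) / (- rayleigh_form \<mu> w0)" by simp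
    also have "\<dots> \<le> (C1 * s powr ?p) / (s * l / 4)"
      using Mw0_le H Mneg s l by (intro frac_le) auto
    also have "\<dots> = (4 * C1 / l) * s powr \<alpha>"
      using s l by (simp add: powr_add field_simps)
    also have "\<dots> \<le> (4 * C1 / l) * 1"
      using C1 l s s' \<alpha> by (intro mult_left_mono powr_le1) auto
    finally have "M_form D m \<alpha> w0 / rayleigh_form \<mu> w0 \<le> 4 * C1 / l" by simp
    then have tT: "t \<le> T"
      unfolding t_def T_def using \<alpha> Hneg Mneg by (intro powr_mono2) (auto simp: divide_nonpos_neg)
    have t0: "0 \<le> t" by (simp add: t_def)
    have "- M_form D m \<alpha> (\<lambda>x. t * w0 x) = t powr ?p * (- M_form D m \<alpha> w0)" by (simp add: np(2))
    also have "\<dots> \<le> T powr ?p * (C1 * s powr ?p)"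
      using tT t0 \<alpha> Mw0_le Mneg by (intro mult_mono powr_mono2) auto
    finally show "\<exists>w\<in>nehari_minus D m \<alpha> \<mu>. - M_form D m \<alpha> w \<le> T powr ?p * C1 * s powr ?p"
      using np(1) by (auto simp: mult.assoc)
  qed
qed

subsection \<open>The square of a solution as a subsolution on the whole space\<close>

text \<open>The approximating functions supply the compact support in \<open>D\<close>; of
  \<open>\<phi>\<close> only bounds for the value and the gradient enter. This makes
  \<open>\<phi> * u\<close> an admissible test function even if \<open>\<phi>\<close> does not
  vanish on the frontier.\<close>

lemma H10_grad_mult_smooth:
  assumes D: "open D" and u: "H10_grad D u g" and \<phi>: "\<phi> \<in> test_functions UNIV"
  shows "H10_grad D (\<lambda>x. \<phi> x * u x) (\<lambda>x. \<phi> x *\<^sub>R g x + u x *\<^sub>R gradient \<phi> x)"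
proof -
  let ?M = "lebesgue_on D"
  obtain \<psi> where \<psi>: "L2 ?M u" "L2 ?M g" "\<And>n::nat. \<psi> n \<in> test_functions D"
    "(\<lambda>n. l2 ?M (\<lambda>x. \<psi> n x - u x)) \<longlonglongrightarrow> 0" "(\<lambda>n. l2 ?M (\<lambda>x. gradient (\<psi> n) x - g x)) \<longlonglongrightarrow> 0"
    using H10_gradE[OF u] by blast
  note \<psi>L = test_function_lebesgue_on[OF \<psi>(3) D]
  note s\<phi> = test_functions_smooth[OF \<phi>]
  obtain K where K: "compact K" "\<And>x. x \<notin> K \<Longrightarrow> \<phi> x = 0" "\<And>x. x \<notin> K \<Longrightarrow> gradient \<phi> x = 0"
    using test_functionsE[OF \<phi>] by metis
  obtain A where A: "A > 0" "\<And>x. norm (\<phi> x) \<le> A"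
    using bounded_compact_support[OF smooth_continuous_on[OF s\<phi>] K(1,2)] by metis
  obtain B where B: "B > 0" "\<And>x. norm (gradient \<phi> x) \<le> B"
    using bounded_compact_support[OF smooth_gradient_continuous[OF s\<phi>] K(1,3)] by metis
  have m: "\<phi> \<in> borel_measurable ?M" "gradient \<phi> \<in> borel_measurable ?M"
    by (intro borel_measurable_lebesgue_on test_function_borel[OF \<phi>])+
  have sc: "L2 ?M (\<lambda>x. \<phi> x *\<^sub>R f x)" "l2 ?M (\<lambda>x. \<phi> x *\<^sub>R f x) \<le> A * l2 ?M f" if "L2 ?M f" for f :: "'a \<Rightarrow> 'b::euclidean_space"
    using L2_bounded_scaleR[OF that m(1)] A(2) by auto
  have gr: "L2 ?M (\<lambda>x. f x *\<^sub>R gradient \<phi> x)" "l2 ?M (\<lambda>x. f x *\<^sub>R gradient \<phi> x) \<le> B * l2 ?M f" if f: "L2 ?M f" for f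
  proof -
    have mf: "(\<lambda>x. f x *\<^sub>R gradient \<phi> x) \<in> borel_measurable ?M"
      using L2_measurable[OF f] m(2) by measurable
    have "norm (f x *\<^sub>R gradient \<phi> x) \<le> B * norm (f x)" for x
      using mult_right_mono[OF B(2)[of x], of "\<bar>f x\<bar>"] by (simp add: mult.commute)
    from L2_le[OF f mf this] B(1)
    show "L2 ?M (\<lambda>x. f x *\<^sub>R gradient \<phi> x)" "l2 ?M (\<lambda>x. f x *\<^sub>R gradient \<phi> x) \<le> B * l2 ?M f" by auto
  qed
  have u\<phi>: "L2 ?M (\<lambda>x. \<phi> x * u x)" using sc(1)[OF \<psi>(1)] by simp
  have 1: "(\<lambda>n. l2 ?M (\<lambda>x. \<psi> n x * \<phi> x - \<phi> x * u x)) \<longlonglongrightarrow> 0"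
  proof (rule Lim_null_comparison)
    show "(\<lambda>n. A * l2 ?M (\<lambda>x. \<psi> n x - u x)) \<longlonglongrightarrow> 0"
      using tendsto_mult_right_zero[OF \<psi>(4), of A] by (simp add: mult.commute)
    show "\<forall>\<^sub>F n in sequentially. norm (l2 ?M (\<lambda>x. \<psi> n x * \<phi> x - \<phi> x * u x)) \<le> A * l2 ?M (\<lambda>x. \<psi> n x - u x)"
      using sc(2)[OF L2_diff[OF \<psi>L(1) \<psi>(1)]] by (intro always_eventually) (auto simp: algebra_simps)
  qed
  have 2: "(\<lambda>n. l2 ?M (\<lambda>x. gradient (\<lambda>x. \<psi> n x * \<phi> x) x - (\<phi> x *\<^sub>R g x + u x *\<^sub>R gradient \<phi> x))) \<longlonglongrightarrow> 0"
  proof (rule Lim_null_comparison)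
    show "(\<lambda>n. A * l2 ?M (\<lambda>x. gradient (\<psi> n) x - g x) + B * l2 ?M (\<lambda>x. \<psi> n x - u x)) \<longlonglongrightarrow> 0"
      using tendsto_add[OF tendsto_mult_right_zero[OF \<psi>(5), of A] tendsto_mult_right_zero[OF \<psi>(4), of B]]
      by (simp add: mult.commute)
    show "\<forall>\<^sub>F n in sequentially. norm (l2 ?M (\<lambda>x. gradient (\<lambda>x. \<psi> n x * \<phi> x) x - (\<phi> x *\<^sub>R g x + u x *\<^sub>R gradient \<phi> x)))
        \<le> A * l2 ?M (\<lambda>x. gradient (\<psi> n) x - g x) + B * l2 ?M (\<lambda>x. \<psi> n x - u x)"
    proof (rule always_eventually, rule allI)
      fix n
      have "gradient (\<lambda>x. \<psi> n x * \<phi> x) x - (\<phi> x *\<^sub>R g x + u x *\<^sub>R gradient \<phi> x)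
          = \<phi> x *\<^sub>R (gradient (\<psi> n) x - g x) + (\<psi> n x - u x) *\<^sub>R gradient \<phi> x" for x
        using gradient_mult[of "\<psi> n" x \<phi>] smooth_differentiable[OF test_functions_smooth[OF \<psi>(3)]]
          smooth_differentiable[OF s\<phi>] by (simp add: algebra_simps)
      then have "l2 ?M (\<lambda>x. gradient (\<lambda>x. \<psi> n x * \<phi> x) x - (\<phi> x *\<^sub>R g x + u x *\<^sub>R gradient \<phi> x))
          \<le> l2 ?M (\<lambda>x. \<phi> x *\<^sub>R (gradient (\<psi> n) x - g x)) + l2 ?M (\<lambda>x. (\<psi> n x - u x) *\<^sub>R gradient \<phi> x)"
        using l2_triangle[OF sc(1)[OF L2_diff[OF \<psi>L(2) \<psi>(2)]] gr(1)[OF L2_diff[OF \<psi>L(1) \<psi>(1)]]] by simp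
      also have "\<dots> \<le> A * l2 ?M (\<lambda>x. gradient (\<psi> n) x - g x) + B * l2 ?M (\<lambda>x. \<psi> n x - u x)"
        by (intro add_mono sc gr L2_diff \<psi> \<psi>L)
      finally show "norm (l2 ?M (\<lambda>x. gradient (\<lambda>x. \<psi> n x * \<phi> x) x - (\<phi> x *\<^sub>R g x + u x *\<^sub>R gradient \<phi> x)))
        \<le> A * l2 ?M (\<lambda>x. gradient (\<psi> n) x - g x) + B * l2 ?M (\<lambda>x. \<psi> n x - u x)" by simp
    qed
  qed
  show ?thesis
    unfolding H10_grad_def
    by (intro conjI u\<phi> L2_add sc gr \<psi> exI[of _ "\<lambda>n x. \<psi> n x * \<phi> x"] allI 1 2 test_functions_mult s\<phi>)
qed

text \<open>Exact for the approximating test functions, whose compact support in \<open>D\<close>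
  leaves no boundary term. Each side pairs two L2-convergent sequences, so it passes to the limit,
  one coordinate at a time.\<close>

lemma H10_grad_square_laplacian:
  assumes D: "open D" and u: "H10_grad D u g" and \<phi>: "\<phi> \<in> test_functions UNIV"
  shows "integrable (lebesgue_on D) (\<lambda>x. (u x)\<^sup>2 * laplacian \<phi> x)"
    and "(\<integral>x. (u x)\<^sup>2 * laplacian \<phi> x \<partial>lebesgue_on D) = - 2 * (\<integral>x. g x \<bullet> (u x *\<^sub>R gradient \<phi> x) \<partial>lebesgue_on D)"
proof -
  let ?M = "lebesgue_on D"
  obtain \<psi> where \<psi>: "L2 ?M u" "L2 ?M g" "\<And>n::nat. \<psi> n \<in> test_functions D"
    "(\<lambda>n. l2 ?M (\<lambda>x. \<psi> n x - u x)) \<longlonglongrightarrow> 0" "(\<lambda>n. l2 ?M (\<lambda>x. gradient (\<psi> n) x - g x)) \<longlonglongrightarrow> 0"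
    using H10_gradE[OF u] by blast
  note \<psi>L = test_function_lebesgue_on[OF \<psi>(3) D]
  note s\<phi> = test_functions_smooth[OF \<phi>]
  obtain K where K: "compact K" "\<And>x. x \<notin> K \<Longrightarrow> \<phi> x = 0" "\<And>x. x \<notin> K \<Longrightarrow> gradient \<phi> x = 0"
    using test_functionsE[OF \<phi>] by metis
  have eq: "integrable ?M (\<lambda>x. u x * (pd b (pd b \<phi>) x * u x)) \<and> integrable ?M (\<lambda>x. g x \<bullet> (pd b \<phi> x *\<^sub>R (u x *\<^sub>R b))) \<and>
      (\<integral>x. u x * (pd b (pd b \<phi>) x * u x) \<partial>?M) = - 2 * (\<integral>x. g x \<bullet> (pd b \<phi> x *\<^sub>R (u x *\<^sub>R b)) \<partial>?M)"
    if b: "b \<in> Basis" for b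
  proof -
    have sb: "smooth (pd b \<phi>)" "smooth (pd b (pd b \<phi>))" using s\<phi> b smooth_pd by blast+
    have z1: "pd b \<phi> x = 0" if "x \<notin> K" for x
      using K(3)[OF that] gradient_inner[OF b, of \<phi> x] by simp
    have z2: "pd b (pd b \<phi>) x = 0" if "x \<notin> K" for x
      using gradient_zero_outside[OF compact_imp_closed[OF K(1)] z1 that] gradient_inner[OF b, of "pd b \<phi>" x] by simp
    obtain A where A: "\<And>x. norm (pd b \<phi> x) \<le> A"
      using bounded_compact_support[OF smooth_continuous_on[OF sb(1)] K(1) z1] by metis
    obtain B where B: "\<And>x. norm (pd b (pd b \<phi>) x) \<le> B"
      using bounded_compact_support[OF smooth_continuous_on[OF sb(2)] K(1) z2] by metis
    have m: "pd b \<phi> \<in> borel_measurable ?M" "pd b (pd b \<phi>) \<in> borel_measurable ?M"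
      by (intro borel_measurable_lebesgue_on borel_measurable_continuous_onI smooth_continuous_on sb)+
    have fb: "L2 ?M (\<lambda>x. f x *\<^sub>R b) \<and> l2 ?M (\<lambda>x. f x *\<^sub>R b) = l2 ?M f" if "L2 ?M f" for f :: "'a \<Rightarrow> real"
      using that by (auto simp: L2_def l2_def b intro: borel_measurable_scaleR)
    have S1: "L2 ?M (\<lambda>x. pd b \<phi> x *\<^sub>R (f x *\<^sub>R b))" "l2 ?M (\<lambda>x. pd b \<phi> x *\<^sub>R (f x *\<^sub>R b)) \<le> A * l2 ?M f"
      if "L2 ?M f" for f :: "'a \<Rightarrow> real"
      using L2_bounded_scaleR[OF fb[OF that, THEN conjunct1] m(1)] A fb[OF that] by auto
    have S2: "L2 ?M (\<lambda>x. pd b (pd b \<phi>) x * f x)" "l2 ?M (\<lambda>x. pd b (pd b \<phi>) x * f x) \<le> B * l2 ?M f"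
      if "L2 ?M f" for f :: "'a \<Rightarrow> real"
      using L2_bounded_scaleR[OF that m(2)] B by auto
    have c1: "(\<lambda>n. l2 ?M (\<lambda>x. pd b \<phi> x *\<^sub>R (\<psi> n x *\<^sub>R b) - pd b \<phi> x *\<^sub>R (u x *\<^sub>R b))) \<longlonglongrightarrow> 0"
    proof (rule Lim_null_comparison)
      show "(\<lambda>n. A * l2 ?M (\<lambda>x. \<psi> n x - u x)) \<longlonglongrightarrow> 0"
        using tendsto_mult_right_zero[OF \<psi>(4), of A] by (simp add: mult.commute)
      show "\<forall>\<^sub>F n in sequentially. norm (l2 ?M (\<lambda>x. pd b \<phi> x *\<^sub>R (\<psi> n x *\<^sub>R b) - pd b \<phi> x *\<^sub>R (u x *\<^sub>R b))) \<le> A * l2 ?M (\<lambda>x. \<psi> n x - u x)"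
        using S1(2)[OF L2_diff[OF \<psi>L(1) \<psi>(1)]] by (intro always_eventually) (auto simp: algebra_simps)
    qed
    have c2: "(\<lambda>n. l2 ?M (\<lambda>x. pd b (pd b \<phi>) x * \<psi> n x - pd b (pd b \<phi>) x * u x)) \<longlonglongrightarrow> 0"
    proof (rule Lim_null_comparison)
      show "(\<lambda>n. B * l2 ?M (\<lambda>x. \<psi> n x - u x)) \<longlonglongrightarrow> 0"
        using tendsto_mult_right_zero[OF \<psi>(4), of B] by (simp add: mult.commute)
      show "\<forall>\<^sub>F n in sequentially. norm (l2 ?M (\<lambda>x. pd b (pd b \<phi>) x * \<psi> n x - pd b (pd b \<phi>) x * u x)) \<le> B * l2 ?M (\<lambda>x. \<psi> n x - u x)"
        using S2(2)[OF L2_diff[OF \<psi>L(1) \<psi>(1)]] by (intro always_eventually) (auto simp: algebra_simps)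
    qed
    have "(\<integral>x. \<psi> n x * (pd b (pd b \<phi>) x * \<psi> n x) \<partial>?M) = - 2 * (\<integral>x. gradient (\<psi> n) x \<bullet> (pd b \<phi> x *\<^sub>R (\<psi> n x *\<^sub>R b)) \<partial>?M)" for n
    proof -
      note sn = test_functions_smooth[OF \<psi>(3)[of n]]
      have "(\<integral>x. (\<psi> n x * \<psi> n x) * (gradient (pd b \<phi>) x \<bullet> b) \<partial>?M) = - (\<integral>x. (gradient (\<lambda>x. \<psi> n x * \<psi> n x) x \<bullet> b) * pd b \<phi> x \<partial>?M)"
        by (rule test_functions_parts[OF test_functions_mult[OF \<psi>(3) sn] sb(1) b D])
      moreover have "gradient (\<lambda>x. \<psi> n x * \<psi> n x) x = \<psi> n x *\<^sub>R gradient (\<psi> n) x + \<psi> n x *\<^sub>R gradient (\<psi> n) x" for x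
        by (intro gradient_mult smooth_differentiable sn)
      moreover have "(\<integral>x. ((\<psi> n x *\<^sub>R gradient (\<psi> n) x + \<psi> n x *\<^sub>R gradient (\<psi> n) x) \<bullet> b) * pd b \<phi> x \<partial>?M)
          = 2 * (\<integral>x. gradient (\<psi> n) x \<bullet> (pd b \<phi> x *\<^sub>R (\<psi> n x *\<^sub>R b)) \<partial>?M)"
        by (subst Bochner_Integration.integral_mult_right_zero[symmetric], rule Bochner_Integration.integral_cong)
          (auto simp: inner_add_left algebra_simps)
      ultimately show ?thesis by (simp add: gradient_inner[OF b] mult_ac)
    qed
    then have "(\<lambda>n. \<integral>x. \<psi> n x * (pd b (pd b \<phi>) x * \<psi> n x) \<partial>?M) \<longlonglongrightarrow> - 2 * (\<integral>x. g x \<bullet> (pd b \<phi> x *\<^sub>R (u x *\<^sub>R b)) \<partial>?M)"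
      using tendsto_mult[OF tendsto_const L2_inner_tendsto[OF \<psi>(2) \<psi>L(2) \<psi>(5) S1(1)[OF \<psi>(1)] S1(1)[OF \<psi>L(1)] c1], of "-2"]
      by simp
    moreover have "(\<lambda>n. \<integral>x. \<psi> n x * (pd b (pd b \<phi>) x * \<psi> n x) \<partial>?M) \<longlonglongrightarrow> (\<integral>x. u x * (pd b (pd b \<phi>) x * u x) \<partial>?M)"
      by (rule L2_inner_tendsto_real[OF \<psi>(1) \<psi>L(1) \<psi>(4) S2(1)[OF \<psi>(1)] S2(1)[OF \<psi>L(1)] c2])
    ultimately have "(\<integral>x. u x * (pd b (pd b \<phi>) x * u x) \<partial>?M) = - 2 * (\<integral>x. g x \<bullet> (pd b \<phi> x *\<^sub>R (u x *\<^sub>R b)) \<partial>?M)"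
      using LIMSEQ_unique by blast
    then show ?thesis
      using L2_mult_integrable[OF \<psi>(1) S2(1)[OF \<psi>(1)]] L2_inner_integrable[OF \<psi>(2) S1(1)[OF \<psi>(1)]] by blast
  qed
  have e1: "(\<lambda>x. (u x)\<^sup>2 * laplacian \<phi> x) = (\<lambda>x. \<Sum>b\<in>Basis. u x * (pd b (pd b \<phi>) x * u x))"
    by (rule ext) (simp add: laplacian_def sum_distrib_left power2_eq_square mult_ac)
  have e2: "g x \<bullet> (u x *\<^sub>R gradient \<phi> x) = (\<Sum>b\<in>Basis. g x \<bullet> (pd b \<phi> x *\<^sub>R (u x *\<^sub>R b)))" for x
    by (simp add: gradient_def pd_def inner_sum_right sum_distrib_left scaleR_sum_right mult_ac)
  show "integrable ?M (\<lambda>x. (u x)\<^sup>2 * laplacian \<phi> x)"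
    unfolding e1 using eq by (intro Bochner_Integration.integrable_sum) blast
  have "(\<integral>x. (u x)\<^sup>2 * laplacian \<phi> x \<partial>?M) = (\<Sum>b\<in>Basis. \<integral>x. u x * (pd b (pd b \<phi>) x * u x) \<partial>?M)"
    unfolding e1 using eq by (intro Bochner_Integration.integral_sum) blast
  also have "\<dots> = - 2 * (\<Sum>b\<in>Basis. \<integral>x. g x \<bullet> (pd b \<phi> x *\<^sub>R (u x *\<^sub>R b)) \<partial>?M)"
    unfolding sum_distrib_left using eq by (intro sum.cong) auto
  also have "(\<Sum>b\<in>Basis. \<integral>x. g x \<bullet> (pd b \<phi> x *\<^sub>R (u x *\<^sub>R b)) \<partial>?M) = (\<integral>x. g x \<bullet> (u x *\<^sub>R gradient \<phi> x) \<partial>?M)"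
    unfolding e2 using eq by (intro Bochner_Integration.integral_sum[symmetric]) blast
  finally show "(\<integral>x. (u x)\<^sup>2 * laplacian \<phi> x \<partial>?M) = - 2 * (\<integral>x. g x \<bullet> (u x *\<^sub>R gradient \<phi> x) \<partial>?M)" .
qed

text \<open>Testing the equation with \<open>\<phi> * u\<close> produces the integral of
  \<open>\<phi>\<close> times the squared gradient; dropping this nonnegative term gives the
  inequality.\<close>

lemma weak_solution_square_subsolution:
  assumes D: "open D" "bounded D" and m: "essentially_bounded D m" and \<alpha>: "0 < \<alpha>" "\<alpha> < 1"
    and u: "weak_solution D m \<alpha> \<mu> u" and nonneg: "\<And>x. x \<in> D \<Longrightarrow> 0 \<le> u x" and bd: "\<And>x. x \<in> D \<Longrightarrow> \<bar>u x\<bar> \<le> B"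
    and \<phi>: "\<phi> \<in> test_functions UNIV" "\<And>x. 0 \<le> \<phi> x"
  shows "(\<integral>x. (u x)\<^sup>2 * laplacian \<phi> x \<partial>lebesgue_on D)
    \<ge> (\<integral>x. (- 2 * \<mu> * (u x)\<^sup>2 - 2 * (m x * \<bar>u x\<bar> powr (\<alpha> + 1))) * \<phi> x \<partial>lebesgue_on D)"
proof -
  let ?M = "lebesgue_on D"
  define g where "g = weak_gradient D u"
  have uH: "u \<in> H10 D" using u by (simp add: weak_solution_def)
  have ug: "H10_grad D u g" unfolding g_def by (rule H10_H10_grad[OF D(1) uH])
  then have L: "L2 ?M u" "L2 ?M g" by (auto simp: H10_grad_def)
  note vg = H10_grad_mult_smooth[OF D(1) ug \<phi>(1)]
  have vH: "(\<lambda>x. \<phi> x * u x) \<in> H10 D" by (rule H10_grad_weak_gradient(1)[OF D(1) vg])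
  have Lv: "L2 ?M (\<lambda>x. \<phi> x *\<^sub>R g x + u x *\<^sub>R gradient \<phi> x)" using vg by (simp add: H10_grad_def)
  obtain K where K: "compact K" "\<And>x. x \<notin> K \<Longrightarrow> \<phi> x = 0" using test_functionsE[OF \<phi>(1)] by metis
  obtain A where A: "\<And>x. norm (\<phi> x) \<le> A"
    using bounded_compact_support[OF smooth_continuous_on[OF test_functions_smooth[OF \<phi>(1)]] K] by metis
  have m\<phi>: "\<phi> \<in> borel_measurable ?M" by (intro borel_measurable_lebesgue_on test_function_borel[OF \<phi>(1)])
  have L\<phi>g: "L2 ?M (\<lambda>x. \<phi> x *\<^sub>R g x)" using L2_bounded_scaleR(1)[OF L(2) m\<phi>] A by auto
  have Lu\<phi>: "L2 ?M (\<lambda>x. u x *\<^sub>R gradient \<phi> x)" using L2_diff[OF Lv L\<phi>g] by simp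
  have "(\<integral>x. (\<mu> * u x + m x * \<bar>u x\<bar> powr (\<alpha> - 1) * u x) * (\<phi> x * u x) \<partial>?M)
      = (\<integral>x. weak_gradient D u x \<bullet> weak_gradient D (\<lambda>x. \<phi> x * u x) x \<partial>?M)"
    using u vH by (simp add: weak_solution_def)
  also have "\<dots> = (\<integral>x. g x \<bullet> (\<phi> x *\<^sub>R g x + u x *\<^sub>R gradient \<phi> x) \<partial>?M)"
    by (rule integral_weak_gradient_inner[OF D(1) ug vg])
  also have "\<dots> = (\<integral>x. g x \<bullet> (\<phi> x *\<^sub>R g x) \<partial>?M) + (\<integral>x. g x \<bullet> (u x *\<^sub>R gradient \<phi> x) \<partial>?M)"
    using L2_inner_integrable[OF L(2) L\<phi>g] L2_inner_integrable[OF L(2) Lu\<phi>] by (simp add: inner_add_right)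
  finally have *: "(\<integral>x. g x \<bullet> (u x *\<^sub>R gradient \<phi> x) \<partial>?M)
      = (\<integral>x. (\<mu> * u x + m x * \<bar>u x\<bar> powr (\<alpha> - 1) * u x) * (\<phi> x * u x) \<partial>?M) - (\<integral>x. g x \<bullet> (\<phi> x *\<^sub>R g x) \<partial>?M)"
    by simp
  have "0 \<le> (\<integral>x. g x \<bullet> (\<phi> x *\<^sub>R g x) \<partial>?M)"
    using \<phi>(2) by (intro Bochner_Integration.integral_nonneg) simp
  then have "- 2 * (\<integral>x. (\<mu> * u x + m x * \<bar>u x\<bar> powr (\<alpha> - 1) * u x) * (\<phi> x * u x) \<partial>?M)
      \<le> - 2 * (\<integral>x. g x \<bullet> (u x *\<^sub>R gradient \<phi> x) \<partial>?M)" unfolding * by simp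
  also have "\<dots> = (\<integral>x. (u x)\<^sup>2 * laplacian \<phi> x \<partial>?M)"
    by (rule H10_grad_square_laplacian(2)[OF D(1) ug \<phi>(1), symmetric])
  also have "- 2 * (\<integral>x. (\<mu> * u x + m x * \<bar>u x\<bar> powr (\<alpha> - 1) * u x) * (\<phi> x * u x) \<partial>?M)
      = (\<integral>x. (- 2 * \<mu> * (u x)\<^sup>2 - 2 * (m x * \<bar>u x\<bar> powr (\<alpha> + 1))) * \<phi> x \<partial>?M)"
  proof -
    have "- 2 * ((\<mu> * u x + m x * \<bar>u x\<bar> powr (\<alpha> - 1) * u x) * (\<phi> x * u x))
        = (- 2 * \<mu> * (u x)\<^sup>2 - 2 * (m x * \<bar>u x\<bar> powr (\<alpha> + 1))) * \<phi> x" for x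
    proof (cases "u x = 0")
      case False
      have "\<bar>u x\<bar> powr (\<alpha> + 1) = \<bar>u x\<bar> powr ((\<alpha> - 1) + 2)" by (simp add: algebra_simps)
      also have "\<dots> = \<bar>u x\<bar> powr (\<alpha> - 1) * (u x)\<^sup>2"
        using False by (subst powr_add) (simp add: powr_numeral)
      finally show ?thesis by (simp add: power2_eq_square algebra_simps)
    qed (use \<alpha> in simp)
    then show ?thesis
      by (subst Bochner_Integration.integral_mult_right_zero[symmetric]) simp
  qed
  finally show ?thesis .
qed

subsection \<open>A mean value inequality\<close>

lemma abs_laplacian_bump_le:
  obtains C where "C > 0" "\<And>(x0::'a::euclidean_space) r z. r > 0 \<Longrightarrow>
    \<bar>laplacian (bump x0 r) z\<bar> \<le> C / r\<^sup>2 * indicator (ball x0 r) z"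
proof -
  obtain F1 where F1: "F1 > 0" "\<And>s. s \<le> 1 \<Longrightarrow> \<bar>flat (Suc 0) s\<bar> \<le> F1" using flat_bounded by blast
  obtain F2 where F2: "F2 > 0" "\<And>s. s \<le> 1 \<Longrightarrow> \<bar>flat (Suc (Suc 0)) s\<bar> \<le> F2" using flat_bounded by blast
  let ?C = "2 * (real DIM('a) * F1 + 2 * F2)"
  show thesis
  proof
    show "?C > 0" using F1 F2 by (simp add: add_nonneg_pos)
    fix x0 z :: 'a and r :: real assume r: "r > 0"
    show "\<bar>laplacian (bump x0 r) z\<bar> \<le> ?C / r\<^sup>2 * indicator (ball x0 r) z"
    proof (cases "z \<in> ball x0 r")
      case True
      have q: "(norm (z - x0))\<^sup>2 / r\<^sup>2 \<le> 1"
        using True r by (simp add: dist_norm norm_minus_commute power_mono)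
      have "\<bar>real DIM('a) * flat (Suc 0) (bump_arg x0 r z) - 2 * ((norm (z - x0))\<^sup>2 / r\<^sup>2) * flat (Suc (Suc 0)) (bump_arg x0 r z)\<bar>
          \<le> \<bar>real DIM('a) * flat (Suc 0) (bump_arg x0 r z)\<bar> + \<bar>2 * ((norm (z - x0))\<^sup>2 / r\<^sup>2) * flat (Suc (Suc 0)) (bump_arg x0 r z)\<bar>"
        by (rule abs_triangle_ineq4)
      also have "\<dots> \<le> real DIM('a) * F1 + 2 * F2"
      proof (rule add_mono)
        show "\<bar>real DIM('a) * flat (Suc 0) (bump_arg x0 r z)\<bar> \<le> real DIM('a) * F1"
          unfolding abs_mult using F1(2)[OF bump_arg_le_1] by (simp add: mult_left_mono)
        have "\<bar>2 * ((norm (z - x0))\<^sup>2 / r\<^sup>2)\<bar> * \<bar>flat (Suc (Suc 0)) (bump_arg x0 r z)\<bar> \<le> 2 * F2"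
          using q F2(2)[OF bump_arg_le_1] by (intro mult_mono) auto
        then show "\<bar>2 * ((norm (z - x0))\<^sup>2 / r\<^sup>2) * flat (Suc (Suc 0)) (bump_arg x0 r z)\<bar> \<le> 2 * F2"
          unfolding abs_mult .
      qed
      finally have "2 / r\<^sup>2 * \<bar>real DIM('a) * flat (Suc 0) (bump_arg x0 r z) - 2 * ((norm (z - x0))\<^sup>2 / r\<^sup>2) * flat (Suc (Suc 0)) (bump_arg x0 r z)\<bar>
          \<le> 2 / r\<^sup>2 * (real DIM('a) * F1 + 2 * F2)"
        by (intro mult_left_mono) auto
      then show ?thesis
        using True unfolding laplacian_bump abs_mult by simp
    next
      case False
      then show ?thesis
        unfolding laplacian_bump using flat_bump_outside[OF r False] by simp
    qed
  qed
qed

text \<open>Scaling the radius of the kernel \<open>flat 1\<close> amounts to adding a Laplacian of the bump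
  \<open>flat 0\<close>, since the gradient of the latter is radial with profile \<open>flat 1\<close>.\<close>

lemma kernel_radius_derivative:
  fixes x0 z :: "'a::euclidean_space"
  assumes t: "t > 0"
  shows "((\<lambda>t. 1 / t ^ DIM('a) * flat (Suc 0) (bump_arg x0 t z)) has_real_derivative
    t / (2 * t ^ DIM('a)) * laplacian (bump x0 t) z) (at t)"
proof -
  \<comment> \<open>A successor form of the dimension lets the power rule be applied without a
    subtraction in the exponent.\<close>
  obtain k where k: "DIM('a) = Suc k" using DIM_positive[where 'a='a] gr0_implies_Suc by blast
  let ?q = "(norm (z - x0))\<^sup>2"
  have b: "((\<lambda>t. bump_arg x0 t z) has_real_derivative 2 * ?q / t ^ 3) (at t)"
    unfolding bump_arg_def using t
    by (auto intro!: derivative_eq_intros simp: power2_eq_square power3_eq_cube field_simps)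
  have "((\<lambda>t. flat (Suc 0) (bump_arg x0 t z)) has_real_derivative
      flat (Suc (Suc 0)) (bump_arg x0 t z) * (2 * ?q / t ^ 3)) (at t)"
    by (rule DERIV_chain2[OF flat_deriv b])
  moreover have "((\<lambda>t. 1 / t ^ DIM('a)) has_real_derivative - real DIM('a) / (t * t ^ DIM('a))) (at t)"
  proof -
    have "((\<lambda>t. t ^ Suc k) has_real_derivative real (Suc k) * t ^ k) (at t)"
      using DERIV_pow[of "Suc k" t] by simp
    from DERIV_inverse'[OF this] show ?thesis
      using t unfolding k by (simp add: field_simps del: of_nat_Suc)
  qed
  ultimately have "((\<lambda>t. 1 / t ^ DIM('a) * flat (Suc 0) (bump_arg x0 t z)) has_real_derivative
     - real DIM('a) / (t * t ^ DIM('a)) * flat (Suc 0) (bump_arg x0 t z)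
      + flat (Suc (Suc 0)) (bump_arg x0 t z) * (2 * ?q / t ^ 3) * (1 / t ^ DIM('a))) (at t)"
    by (rule DERIV_mult[rotated])
  moreover have "- real DIM('a) / (t * t ^ DIM('a)) * flat (Suc 0) (bump_arg x0 t z)
      + flat (Suc (Suc 0)) (bump_arg x0 t z) * (2 * ?q / t ^ 3) * (1 / t ^ DIM('a))
      = t / (2 * t ^ DIM('a)) * laplacian (bump x0 t) z"
    unfolding laplacian_bump using t by (simp add: field_simps power2_eq_square power3_eq_cube)
  ultimately show ?thesis by simp
qed

lemma integrable_mult_bounded:
  fixes w h :: "'a \<Rightarrow> real"
  assumes w: "integrable M w" and h: "h \<in> borel_measurable M" "\<And>z. \<bar>h z\<bar> \<le> B"
  shows "integrable M (\<lambda>z. w z * h z)"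
proof (rule Bochner_Integration.integrable_bound)
  show "integrable M (\<lambda>z. B * \<bar>w z\<bar>)" using w by simp
  show "(\<lambda>z. w z * h z) \<in> borel_measurable M"
    using borel_measurable_integrable[OF w] h(1) by measurable
  show "AE z in M. norm (w z * h z) \<le> norm (B * \<bar>w z\<bar>)"
  proof (rule AE_I2)
    fix z
    have "\<bar>w z\<bar> * \<bar>h z\<bar> \<le> \<bar>w z\<bar> * \<bar>B\<bar>" using h(2)[of z] by (intro mult_left_mono) auto
    then show "norm (w z * h z) \<le> norm (B * \<bar>w z\<bar>)" by (simp add: abs_mult mult.commute)
  qed
qed

lemma integrable_times_indicator:
  fixes w :: "'a::euclidean_space \<Rightarrow> real"
  assumes "integrable lebesgue w" "A \<in> sets lebesgue"
  shows "integrable lebesgue (\<lambda>z. w z * indicator A z)"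
  using integrable_mult_indicator[OF assms(2,1)] by (simp add: mult.commute)

lemma borel_measurable_lebesgue_continuous:
  "continuous_on UNIV (f :: 'a::euclidean_space \<Rightarrow> real) \<Longrightarrow> f \<in> borel_measurable lebesgue"
  by (intro measurable_completion) (simp add: borel_measurable_continuous_onI)

lemma smooth_laplacian: "smooth \<phi> \<Longrightarrow> smooth (laplacian \<phi>)"
  unfolding laplacian_def[abs_def] by (intro smooth_sum smooth_pd)

lemma bump_lebesgue_measurable:
  "(\<lambda>z. flat n (bump_arg x0 r z)) \<in> borel_measurable lebesgue" "laplacian (bump x0 r) \<in> borel_measurable lebesgue"
  "bump x0 r \<in> borel_measurable lebesgue"
  by (intro borel_measurable_lebesgue_continuous smooth_continuous_on smooth_flat_comp smooth_bump_arg
      smooth_laplacian smooth_bump)+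

lemma integral_flat_kernel:
  fixes x0 :: "'a::euclidean_space"
  assumes t: "t > 0"
  shows "(\<integral>z. 1 / t ^ DIM('a) * flat (Suc 0) (bump_arg x0 t z) \<partial>lebesgue)
    = (\<integral>y. flat (Suc 0) (bump_arg (0::'a) 1 y) \<partial>lborel)"
proof -
  have c: "continuous_on UNIV (\<lambda>z. flat (Suc 0) (bump_arg x0 t z))"
    by (intro smooth_continuous_on smooth_flat_comp smooth_bump_arg)
  then have m: "(\<lambda>z. flat (Suc 0) (bump_arg x0 t z)) \<in> borel_measurable borel"
    by (rule borel_measurable_continuous_onI)
  have "(\<integral>z. 1 / t ^ DIM('a) * flat (Suc 0) (bump_arg x0 t z) \<partial>lebesgue)
      = 1 / t ^ DIM('a) * (\<integral>z. flat (Suc 0) (bump_arg x0 t z) \<partial>lborel)"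
    using m by (simp add: integral_completion)
  also have "(\<integral>z. flat (Suc 0) (bump_arg x0 t z) \<partial>lborel)
      = t ^ DIM('a) * (\<integral>y. flat (Suc 0) (bump_arg x0 t (x0 + t *\<^sub>R y)) \<partial>lborel)"
    by (rule lborel_integral_affine[OF m t])
  also have "(\<lambda>y. bump_arg x0 t (x0 + t *\<^sub>R y)) = bump_arg 0 1"
    using t by (auto simp: bump_arg_def power_mult_distrib)
  then have "(\<lambda>y. flat (Suc 0) (bump_arg x0 t (x0 + t *\<^sub>R y))) = (\<lambda>y. flat (Suc 0) (bump_arg 0 1 y))"
    by metis
  finally show ?thesis using t by simp
qed

lemma integral_flat_kernel_pos: "(\<integral>y. flat (Suc 0) (bump_arg (0::'a::euclidean_space) 1 y) \<partial>lborel) > 0"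
proof -
  have 1: "integrable lborel (\<lambda>y. flat n (bump_arg (0::'a) 1 y))" for n
    by (rule integrable_compact_support[of _ "cball 0 1"])
      (auto intro!: smooth_continuous_on smooth_flat_comp smooth_bump_arg flat_bump_outside)
  have t: "bump (0::'a) 1 \<in> test_functions UNIV" by (rule bump_test_function) auto
  have "0 < (l2 lborel (bump (0::'a) 1))\<^sup>2" using bump_l2_pos[of 1 "0::'a"] by simp
  also have "\<dots> = (\<integral>y. (norm (bump (0::'a) 1 y))\<^sup>2 \<partial>lborel)" by (rule l2_square)
  also have "\<dots> \<le> (\<integral>y. flat (Suc 0) (bump_arg (0::'a) 1 y) \<partial>lborel)"
  proof (rule integral_mono[OF L2_square_integrable[OF test_function_L2(1)[OF t]] 1])
    fix y :: 'a
    have "(norm (bump 0 1 y))\<^sup>2 = bump 0 1 y * bump 0 1 y" by (simp add: power2_eq_square)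
    also have "\<dots> \<le> bump 0 1 y" using bump_nonneg[of 0 1 y] bump_le_1[of 0 1 y] by (simp add: mult_left_le)
    also have "\<dots> \<le> flat (Suc 0) (bump_arg 0 1 y)"
      unfolding bump_def by (rule flat_0_le_flat_1[OF bump_arg_le_1])
    finally show "(norm (bump 0 1 y))\<^sup>2 \<le> flat (Suc 0) (bump_arg 0 1 y)" .
  qed
  finally show ?thesis .
qed

text \<open>The kernel average over radius t has logarithmic derivative at least
  \<open>- \<Lambda>\<close>, so multiplied by exp (\<open>\<Lambda>\<close> t) it is nondecreasing.
  As t tends to 0, continuity at the centre recovers \<open>\<kappa> * w x0\<close>.\<close>

lemma mean_value_inequality:
  obtains C where "C > 0" "\<And>(w::'a::euclidean_space \<Rightarrow> real) x0 R \<Lambda>. integrable lebesgue w \<Longrightarrow> (\<And>z. 0 \<le> w z)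
    \<Longrightarrow> isCont w x0 \<Longrightarrow> 0 < R \<Longrightarrow> R \<le> 1 \<Longrightarrow> 0 \<le> \<Lambda>
    \<Longrightarrow> (\<And>t. 0 < t \<Longrightarrow> t \<le> R \<Longrightarrow> (\<integral>z. w z * laplacian (bump x0 t) z \<partial>lebesgue) \<ge> - \<Lambda> * (\<integral>z. w z * bump x0 t z \<partial>lebesgue))
    \<Longrightarrow> w x0 \<le> C * exp \<Lambda> / R ^ DIM('a) * (\<integral>z. w z * indicator (ball x0 R) z \<partial>lebesgue)"
proof -
  obtain F1 where F1: "F1 > 0" "\<And>s. s \<le> 1 \<Longrightarrow> \<bar>flat (Suc 0) s\<bar> \<le> F1" using flat_bounded by blast
  obtain CL where CL: "CL > 0" "\<And>(x0::'a) r z. r > 0 \<Longrightarrow> \<bar>laplacian (bump x0 r) z\<bar> \<le> CL / r\<^sup>2 * indicator (ball x0 r) z"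
    using abs_laplacian_bump_le by metis
  define \<kappa> where "\<kappa> = (\<integral>y. flat (Suc 0) (bump_arg (0::'a) 1 y) \<partial>lborel)"
  have \<kappa>: "\<kappa> > 0" unfolding \<kappa>_def by (rule integral_flat_kernel_pos)
  let ?N = "DIM('a)"
  show thesis
  proof
    show "F1 / \<kappa> > 0" using F1 \<kappa> by simp
    fix w :: "'a \<Rightarrow> real" and x0 R \<Lambda>
    assume w: "integrable lebesgue w" "\<And>z. 0 \<le> w z" and cont: "isCont w x0" and R: "0 < R" "R \<le> 1" and \<Lambda>: "0 \<le> \<Lambda>"
      and sub: "\<And>t. 0 < t \<Longrightarrow> t \<le> R \<Longrightarrow> (\<integral>z. w z * laplacian (bump x0 t) z \<partial>lebesgue) \<ge> - \<Lambda> * (\<integral>z. w z * bump x0 t z \<partial>lebesgue)"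
    define k where "k t z = 1 / t ^ ?N * flat (Suc 0) (bump_arg x0 t z)" for t z
    define k' where "k' t z = t / (2 * t ^ ?N) * laplacian (bump x0 t) z" for t z
    define A where "A t = (\<integral>z. w z * k t z \<partial>lebesgue)" for t
    have km: "k t \<in> borel_measurable lebesgue" for t
      unfolding k_def[abs_def] by (intro borel_measurable_times borel_measurable_const bump_lebesgue_measurable)
    have kb: "\<bar>k t z\<bar> \<le> F1 / t ^ ?N" if "t > 0" for t z
    proof -
      have "\<bar>k t z\<bar> = \<bar>flat (Suc 0) (bump_arg x0 t z)\<bar> / t ^ ?N" using that by (simp add: k_def abs_mult)
      also have "\<dots> \<le> F1 / t ^ ?N" using that by (intro divide_right_mono F1 bump_arg_le_1) auto
      finally show ?thesis .
    qed
    have k0: "0 \<le> k t z" if "t > 0" for t z using that by (simp add: k_def flat_1_nonneg)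
    have wk: "integrable lebesgue (\<lambda>z. w z * k t z)" if "t > 0" for t
      by (rule integrable_mult_bounded[OF w(1) km kb[OF that]])
    have A0: "0 \<le> A t" if "t > 0" for t
      unfolding A_def using w(2) k0[OF that] by (intro Bochner_Integration.integral_nonneg) simp
    have dA: "(A has_real_derivative (\<integral>z. w z * k' t z \<partial>lebesgue)) (at t)" if t: "t > 0" for t
      unfolding A_def[abs_def]
    \<comment> \<open>Staying within t / 2 of t keeps the radii away from 0, which bounds the
      derivative of the kernel by a constant.\<close>
    proof (rule integral_has_real_derivative(2)[where \<delta> = "t / 2" and G = "\<lambda>z. \<bar>w z\<bar> * (CL / (2 * ((t / 2) ^ ?N * (t / 2))))"])
      show "integrable lebesgue (\<lambda>z. \<bar>w z\<bar> * (CL / (2 * ((t / 2) ^ ?N * (t / 2)))))" using w(1) by simp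
      fix s assume "\<bar>s - t\<bar> < t / 2"
      then have s: "s > t / 2" "s > 0" using t by (auto simp: abs_if split: if_splits)
      show "integrable lebesgue (\<lambda>z. w z * k s z)" by (rule wk[OF s(2)])
      show "((\<lambda>t. w z * k t z) has_real_derivative w z * k' s z) (at s)" for z
        unfolding k_def k'_def by (intro DERIV_cmult kernel_radius_derivative s)
      show "\<bar>w z * k' s z\<bar> \<le> \<bar>w z\<bar> * (CL / (2 * ((t / 2) ^ ?N * (t / 2))))" for z
      proof -
        have "\<bar>k' s z\<bar> = s / (2 * s ^ ?N) * \<bar>laplacian (bump x0 s) z\<bar>" using s by (simp add: k'_def abs_mult)
        also have "\<dots> \<le> s / (2 * s ^ ?N) * (CL / s\<^sup>2)"
        proof (intro mult_left_mono)
          have "CL / s\<^sup>2 * indicator (ball x0 s) z \<le> CL / s\<^sup>2 * 1"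
            using CL(1) by (intro mult_left_mono) (auto simp: indicator_def)
          then show "\<bar>laplacian (bump x0 s) z\<bar> \<le> CL / s\<^sup>2" using CL(2)[OF s(2), of x0 z] by simp
        qed (use s in simp)
        also have "\<dots> = CL / (2 * (s ^ ?N * s))" using s by (simp add: power2_eq_square field_simps)
        also have "\<dots> \<le> CL / (2 * ((t / 2) ^ ?N * (t / 2)))"
          using s t CL(1) by (intro divide_left_mono mult_left_mono mult_mono power_mono mult_pos_pos) auto
        finally show ?thesis unfolding abs_mult by (intro mult_left_mono) auto
      qed
    qed (use t in simp)
    have dA_ge: "(\<integral>z. w z * k' t z \<partial>lebesgue) \<ge> - \<Lambda> * A t" if t: "0 < t" "t \<le> R" for t
    proof -
      have "(\<integral>z. w z * k' t z \<partial>lebesgue) = t / (2 * t ^ ?N) * (\<integral>z. w z * laplacian (bump x0 t) z \<partial>lebesgue)"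
        unfolding k'_def by (subst Bochner_Integration.integral_mult_right_zero[symmetric]) (simp add: mult_ac)
      \<comment> \<open>The bump is dominated by the kernel, so the term of order zero is a multiple
        of the very average being differentiated.\<close>
      moreover have "(\<integral>z. w z * bump x0 t z \<partial>lebesgue) \<le> t ^ ?N * A t"
      proof -
        have wb: "integrable lebesgue (\<lambda>z. w z * bump x0 t z)"
          by (rule integrable_mult_bounded[OF w(1) bump_lebesgue_measurable(3), of _ _ 1])
            (auto simp: abs_of_nonneg bump_nonneg bump_le_1)
        have "(\<integral>z. w z * bump x0 t z \<partial>lebesgue) \<le> (\<integral>z. t ^ ?N * (w z * k t z) \<partial>lebesgue)"
        proof (rule integral_mono[OF wb])
          show "integrable lebesgue (\<lambda>z. t ^ ?N * (w z * k t z))" using wk[OF t(1)] by simp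
          fix z
          have "w z * bump x0 t z \<le> w z * flat (Suc 0) (bump_arg x0 t z)"
            unfolding bump_def by (intro mult_left_mono flat_0_le_flat_1 bump_arg_le_1 w)
          then show "w z * bump x0 t z \<le> t ^ ?N * (w z * k t z)" using t by (simp add: k_def)
        qed
        then show ?thesis by (simp add: A_def)
      qed
      then have "t / (2 * t ^ ?N) * (- \<Lambda> * (t ^ ?N * A t)) \<le> t / (2 * t ^ ?N) * (\<integral>z. w z * laplacian (bump x0 t) z \<partial>lebesgue)"
        using sub[OF t] \<Lambda> t
        by (intro mult_left_mono) (auto intro: order_trans[rotated] simp: mult_left_mono)
      moreover have "t / (2 * t ^ ?N) * (- \<Lambda> * (t ^ ?N * A t)) = - ((t / 2) * (\<Lambda> * A t))" using t by simp
      moreover have "(t / 2) * (\<Lambda> * A t) \<le> 1 * (\<Lambda> * A t)"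
        using t R \<Lambda> A0[OF t(1)] by (intro mult_right_mono) auto
      ultimately show ?thesis by simp
    qed
    have mono: "A e \<le> exp \<Lambda> * A R" if e: "0 < e" "e \<le> R" for e
    proof -
      have "A e * exp (\<Lambda> * e) \<le> A R * exp (\<Lambda> * R)"
      proof (rule DERIV_nonneg_imp_nondecreasing[OF e(2)])
        fix t assume t: "e \<le> t" "t \<le> R"
        then have t0: "t > 0" using e by simp
        have "((\<lambda>t. A t * exp (\<Lambda> * t)) has_real_derivative
            (\<integral>z. w z * k' t z \<partial>lebesgue) * exp (\<Lambda> * t) + (exp (\<Lambda> * t) * \<Lambda>) * A t) (at t)"
          by (rule DERIV_mult[OF dA[OF t0]]) (auto intro!: derivative_eq_intros)
        moreover have "0 \<le> ((\<integral>z. w z * k' t z \<partial>lebesgue) + \<Lambda> * A t) * exp (\<Lambda> * t)"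
          using dA_ge[OF t0 t(2)] by (intro mult_nonneg_nonneg) auto
        ultimately show "\<exists>y. ((\<lambda>t. A t * exp (\<Lambda> * t)) has_real_derivative y) (at t) \<and> 0 \<le> y"
          by (intro exI conjI) (auto simp: algebra_simps)
      qed
      moreover have "A e * 1 \<le> A e * exp (\<Lambda> * e)" using A0[OF e(1)] \<Lambda> e by (intro mult_left_mono) auto
      moreover have "A R * exp (\<Lambda> * R) \<le> A R * exp \<Lambda>"
        using A0[OF R(1)] \<Lambda> R by (intro mult_left_mono) (auto simp: mult_left_le)
      ultimately show ?thesis by (simp add: mult.commute)
    qed
    have "w x0 * \<kappa> \<le> exp \<Lambda> * A R"
    proof (rule field_le_epsilon)
      fix e' :: real assume e': "e' > 0"
      define e where "e = e' / \<kappa>"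
      have e: "e > 0" using e' \<kappa> by (simp add: e_def)
      obtain d where d: "d > 0" "\<And>z. dist z x0 < d \<Longrightarrow> dist (w z) (w x0) < e"
        using cont e unfolding continuous_at_eps_delta by metis
      define r where "r = min d R"
      have r: "0 < r" "r \<le> R" "r \<le> d" using d R by (auto simp: r_def)
      have "(\<integral>z. (w x0 - e) * k r z \<partial>lebesgue) \<le> A r"
        unfolding A_def
      proof (rule integral_mono[OF _ wk[OF r(1)]])
        have kc: "integrable lborel (k r)"
          unfolding k_def[abs_def]
          by (intro integrable_mult_right integrable_compact_support[of _ "cball x0 r"])
            (use r in \<open>auto intro!: smooth_continuous_on smooth_flat_comp smooth_bump_arg flat_bump_outside\<close>)
        then have "integrable lebesgue (k r)" using integrable_completion[of "k r" lborel] by simp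
        then show "integrable lebesgue (\<lambda>z. (w x0 - e) * k r z)" by simp
        fix z
        show "(w x0 - e) * k r z \<le> w z * k r z"
        proof (cases "z \<in> ball x0 r")
          case True
          then have "dist (w z) (w x0) < e" using r by (intro d) (simp add: dist_commute)
          then show ?thesis using k0[OF r(1)] by (intro mult_right_mono) (auto simp: dist_real_def)
        qed (simp add: k_def flat_bump_outside[OF r(1)])
      qed
      also have "(\<integral>z. (w x0 - e) * k r z \<partial>lebesgue) = (w x0 - e) * \<kappa>"
        unfolding k_def \<kappa>_def integral_flat_kernel[OF r(1), of x0, symmetric]
        by (rule Bochner_Integration.integral_mult_right_zero)
      finally have "(w x0 - e) * \<kappa> \<le> exp \<Lambda> * A R" using mono[OF r(1,2)] by linarith
      then show "w x0 * \<kappa> \<le> exp \<Lambda> * A R + e'" using \<kappa> by (simp add: e_def algebra_simps)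
    qed
    also have "A R \<le> F1 / R ^ ?N * (\<integral>z. w z * indicator (ball x0 R) z \<partial>lebesgue)"
    proof -
      have wi: "integrable lebesgue (\<lambda>z. w z * indicator (ball x0 R) z)"
        by (rule integrable_times_indicator[OF w(1)]) simp
      have "A R \<le> (\<integral>z. F1 / R ^ ?N * (w z * indicator (ball x0 R) z) \<partial>lebesgue)"
        unfolding A_def
      proof (rule integral_mono[OF wk[OF R(1)]])
        show "integrable lebesgue (\<lambda>z. F1 / R ^ ?N * (w z * indicator (ball x0 R) z))" using wi by simp
        fix z
        show "w z * k R z \<le> F1 / R ^ ?N * (w z * indicator (ball x0 R) z)"
        proof (cases "z \<in> ball x0 R")
          case True
          have "w z * k R z \<le> w z * (F1 / R ^ ?N)"
            using kb[OF R(1), of z] by (intro mult_left_mono w) auto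
          then show ?thesis using True by (simp add: mult.commute)
        qed (simp add: k_def flat_bump_outside[OF R(1)])
      qed
      then show ?thesis by simp
    qed
    finally have "w x0 * \<kappa> \<le> exp \<Lambda> * (F1 / R ^ ?N * (\<integral>z. w z * indicator (ball x0 R) z \<partial>lebesgue))"
      by (simp add: mult_left_mono)
    then have "w x0 \<le> exp \<Lambda> * (F1 / R ^ ?N * (\<integral>z. w z * indicator (ball x0 R) z \<partial>lebesgue)) / \<kappa>"
      using \<kappa> by (simp only: pos_le_divide_eq)
    then show "w x0 \<le> F1 / \<kappa> * exp \<Lambda> / R ^ ?N * (\<integral>z. w z * indicator (ball x0 R) z \<partial>lebesgue)"
      by (simp add: mult_ac)
  qed
qed

subsection \<open>Local bounds and dead cores\<close>

text \<open>The supremum of the weighted function \<open>d powr (N / \<beta>) * w\<close> controls itself: near a point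
  \<open>x\<close> the mean value inequality on the ball of radius \<open>d x / 2\<close> trades the factor
  \<open>w powr (1 - \<beta>)\<close> for a power of the supremum. This lowers the exponent of the mean from 1
  to \<open>\<beta>\<close>.\<close>

lemma weighted_sup_bound:
  obtains C where "C > 0" "\<And>(w::'a::euclidean_space \<Rightarrow> real) d \<Lambda> \<beta> \<iota> B x. integrable lebesgue w \<Longrightarrow> (\<And>z. 0 \<le> w z) \<Longrightarrow> (\<And>z. w z \<le> B)
    \<Longrightarrow> 0 \<le> \<Lambda> \<Longrightarrow> 0 < \<beta> \<Longrightarrow> \<beta> < 1
    \<Longrightarrow> integrable lebesgue (\<lambda>z. w z powr \<beta>) \<Longrightarrow> (\<integral>z. w z powr \<beta> * indicator {z. 0 < d z} z \<partial>lebesgue) \<le> \<iota>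
    \<Longrightarrow> (\<And>x y. \<bar>d x - d y\<bar> \<le> dist x y) \<Longrightarrow> (\<And>z. d z \<le> 1)
    \<Longrightarrow> (\<And>x. 0 < w x \<Longrightarrow> 0 < d x \<Longrightarrow> isCont w x)
    \<Longrightarrow> (\<And>x t. 0 < w x \<Longrightarrow> 0 < t \<Longrightarrow> t \<le> d x / 2 \<Longrightarrow>
        (\<integral>z. w z * laplacian (bump x t) z \<partial>lebesgue) \<ge> - \<Lambda> * (\<integral>z. w z * bump x t z \<partial>lebesgue))
    \<Longrightarrow> 0 < d x
    \<Longrightarrow> w x \<le> (C * exp \<Lambda> * 2 powr (real DIM('a) / \<beta>) * \<iota>) powr (1 / \<beta>) * d x powr - (real DIM('a) / \<beta>)"
proof -
  obtain C where C: "C > 0" and mv: "\<And>(w::'a \<Rightarrow> real) x0 R \<Lambda>. integrable lebesgue w \<Longrightarrow> (\<And>z. 0 \<le> w z)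
    \<Longrightarrow> isCont w x0 \<Longrightarrow> 0 < R \<Longrightarrow> R \<le> 1 \<Longrightarrow> 0 \<le> \<Lambda>
    \<Longrightarrow> (\<And>t. 0 < t \<Longrightarrow> t \<le> R \<Longrightarrow> (\<integral>z. w z * laplacian (bump x0 t) z \<partial>lebesgue) \<ge> - \<Lambda> * (\<integral>z. w z * bump x0 t z \<partial>lebesgue))
    \<Longrightarrow> w x0 \<le> C * exp \<Lambda> / R ^ DIM('a) * (\<integral>z. w z * indicator (ball x0 R) z \<partial>lebesgue)"
    by (fact mean_value_inequality)
  show thesis
  proof
    show "C > 0" by (rule C)
    fix w :: "'a \<Rightarrow> real" and d \<Lambda> \<beta> \<iota> B x
    assume w: "integrable lebesgue w" "\<And>z. 0 \<le> w z" "\<And>z. w z \<le> B" and \<Lambda>: "0 \<le> \<Lambda>" and \<beta>: "0 < \<beta>" "\<beta> < 1"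
      and wb: "integrable lebesgue (\<lambda>z. w z powr \<beta>)" and \<iota>: "(\<integral>z. w z powr \<beta> * indicator {z. 0 < d z} z \<partial>lebesgue) \<le> \<iota>"
      and d: "\<And>x y. \<bar>d x - d y\<bar> \<le> dist x y" "\<And>z. d z \<le> 1"
      and cont: "\<And>x. 0 < w x \<Longrightarrow> 0 < d x \<Longrightarrow> isCont w x"
      and sub: "\<And>x t. 0 < w x \<Longrightarrow> 0 < t \<Longrightarrow> t \<le> d x / 2 \<Longrightarrow>
        (\<integral>z. w z * laplacian (bump x t) z \<partial>lebesgue) \<ge> - \<Lambda> * (\<integral>z. w z * bump x t z \<partial>lebesgue)"
      and dx: "0 < d x"
    \<comment> \<open>The exponent solves \<open>\<gamma> * (1 - \<beta>) + N = \<gamma>\<close>,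
      with N the dimension, so that all powers of the distance cancel in the self-estimate.\<close>
    define \<gamma> where "\<gamma> = real DIM('a) / \<beta>"
    have \<gamma>: "\<gamma> > 0" using \<beta> by (simp add: \<gamma>_def)
    define S where "S = {d y powr \<gamma> * w y | y. 0 < d y}"
    define \<Theta> where "\<Theta> = Sup S"
    \<comment> \<open>The bound \<open>B\<close> only makes the supremum finite, which allows the
      later division; it does not enter the estimate.\<close>
    have bdd: "bdd_above S"
    proof (rule bdd_aboveI)
      fix s assume "s \<in> S"
      then obtain y where y: "s = d y powr \<gamma> * w y" "0 < d y" by (auto simp: S_def)
      have "d y powr \<gamma> \<le> 1" using d(2) y(2) \<gamma> by (intro powr_le1) auto
      then have "s \<le> 1 * w y" unfolding y(1) by (intro mult_right_mono w)
      also have "\<dots> \<le> B" using w(3) by simp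
      finally show "s \<le> B" .
    qed
    have ne: "S \<noteq> {}" using dx by (auto simp: S_def)
    have \<Theta>: "d y powr \<gamma> * w y \<le> \<Theta>" if "0 < d y" for y
      unfolding \<Theta>_def using that by (intro cSup_upper[OF _ bdd]) (auto simp: S_def)
    have \<Theta>0: "0 \<le> \<Theta>" using \<Theta>[OF dx] w(2)[of x] by (smt (verit) mult_nonneg_nonneg powr_ge_zero)
    have wle: "w y \<le> \<Theta> * d y powr - \<gamma>" if "0 < d y" for y
      using \<Theta>[OF that] that by (simp add: powr_minus field_simps)
    define C1 where "C1 = C * exp \<Lambda> * 2 powr \<gamma> * \<iota>"
    have i0: "0 \<le> \<iota>" by (rule order_trans[OF Bochner_Integration.integral_nonneg \<iota>]) simp
    have C10: "0 \<le> C1" using C i0 by (simp add: C1_def)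
    have step: "d y powr \<gamma> * w y \<le> C1 * \<Theta> powr (1 - \<beta>)" if y: "0 < d y" for y
    proof (cases "w y = 0")
      case False
      then have wy: "0 < w y" using w(2)[of y] by linarith
      define r where "r = d y / 2"
      have r: "0 < r" "r \<le> 1" using y d(2)[of y] by (auto simp: r_def)
      define S1 where "S1 = \<Theta> * r powr - \<gamma>"
      have S1: "0 \<le> S1" using \<Theta>0 by (simp add: S1_def)
      \<comment> \<open>\<open>d\<close> is 1-Lipschitz, so on the ball of half its value it loses
        at most half.\<close>
      have dz: "r \<le> d z" if "z \<in> ball y r" for z
        using d(1)[of y z] that by (auto simp: r_def)
      have pt: "w z * indicator (ball y r) z \<le> S1 powr (1 - \<beta>) * (w z powr \<beta> * indicator {z. 0 < d z} z)" for z
      proof (cases "z \<in> ball y r")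
        case True
        have z: "0 < d z" using dz[OF True] r by simp
        have "w z \<le> \<Theta> * d z powr - \<gamma>" by (rule wle[OF z])
        also have "\<dots> \<le> S1"
          unfolding S1_def using dz[OF True] r \<gamma> \<Theta>0 by (intro mult_left_mono powr_mono2') auto
        finally have "w z powr (1 - \<beta>) \<le> S1 powr (1 - \<beta>)" using w(2) \<beta> by (intro powr_mono2) auto
        then have "w z powr (1 - \<beta>) * w z powr \<beta> \<le> S1 powr (1 - \<beta>) * w z powr \<beta>" by (intro mult_right_mono) auto
        moreover have "w z powr (1 - \<beta>) * w z powr \<beta> = w z" using w(2)[of z] by (simp add: powr_add[symmetric])
        ultimately show ?thesis using True z by simp
      qed (use S1 in simp)
      have mset: "{z. 0 < d z} \<in> sets lebesgue"
      proof -
        have "1-lipschitz_on UNIV d" by (rule lipschitz_onI) (use d(1) in \<open>auto simp: dist_real_def\<close>)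
        then have "continuous_on UNIV d" by (rule lipschitz_on_continuous_on)
        then have "open {z. 0 < d z}" by (intro open_Collect_less continuous_on_const)
        then show ?thesis by simp
      qed
      have i1: "integrable lebesgue (\<lambda>z. w z * indicator (ball y r) z)"
        by (rule integrable_times_indicator[OF w(1)]) simp
      have i2: "integrable lebesgue (\<lambda>z. w z powr \<beta> * indicator {z. 0 < d z} z)"
        by (rule integrable_times_indicator[OF wb mset])
      have "(\<integral>z. w z * indicator (ball y r) z \<partial>lebesgue)
          \<le> (\<integral>z. S1 powr (1 - \<beta>) * (w z powr \<beta> * indicator {z. 0 < d z} z) \<partial>lebesgue)"
        by (rule integral_mono[OF i1 integrable_mult_right[OF i2] pt])
      also have "\<dots> \<le> S1 powr (1 - \<beta>) * \<iota>"
        unfolding Bochner_Integration.integral_mult_right_zero by (intro mult_left_mono \<iota>) simp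
      finally have "(\<integral>z. w z * indicator (ball y r) z \<partial>lebesgue) \<le> S1 powr (1 - \<beta>) * \<iota>" .
      moreover have "w y \<le> C * exp \<Lambda> / r ^ DIM('a) * (\<integral>z. w z * indicator (ball y r) z \<partial>lebesgue)"
        by (rule mv[OF w(1,2) cont[OF wy y] r \<Lambda>]) (rule sub[OF wy], auto simp: r_def)
      ultimately have "w y \<le> C * exp \<Lambda> / r ^ DIM('a) * (S1 powr (1 - \<beta>) * \<iota>)"
        using C r by (elim order_trans) (intro mult_left_mono, auto)
      also have "S1 powr (1 - \<beta>) = \<Theta> powr (1 - \<beta>) * r powr (- \<gamma> * (1 - \<beta>))"
        unfolding S1_def using \<Theta>0 r by (simp add: powr_mult powr_powr)
      also have "C * exp \<Lambda> / r ^ DIM('a) * (\<Theta> powr (1 - \<beta>) * r powr (- \<gamma> * (1 - \<beta>)) * \<iota>)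
          = C * exp \<Lambda> * \<iota> * \<Theta> powr (1 - \<beta>) * (r powr (- \<gamma> * (1 - \<beta>)) * r powr - real DIM('a))"
        using r by (simp add: powr_minus powr_realpow field_simps)
      also have "r powr (- \<gamma> * (1 - \<beta>)) * r powr - real DIM('a) = r powr - \<gamma>"
      proof -
        have "- \<gamma> * (1 - \<beta>) + - real DIM('a) = - \<gamma>" using \<beta> by (simp add: \<gamma>_def field_simps)
        then show ?thesis by (simp add: powr_add[symmetric])
      qed
      finally have "d y powr \<gamma> * w y \<le> d y powr \<gamma> * (C * exp \<Lambda> * \<iota> * \<Theta> powr (1 - \<beta>) * r powr - \<gamma>)"
        by (intro mult_left_mono) auto
      also have "\<dots> = C1 * \<Theta> powr (1 - \<beta>)"
        using y by (simp add: C1_def r_def powr_divide powr_minus field_simps)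
      finally show ?thesis .
    qed (use C10 in simp)
    have "Sup S \<le> C1 * \<Theta> powr (1 - \<beta>)"
      by (rule cSup_least[OF ne]) (use step in \<open>auto simp: S_def\<close>)
    then have "\<Theta> \<le> C1 * \<Theta> powr (1 - \<beta>)" unfolding \<Theta>_def[symmetric] .
    have "\<Theta> \<le> C1 powr (1 / \<beta>)"
    proof (cases "\<Theta> = 0")
      case False
      then have p: "\<Theta> > 0" using \<Theta>0 by simp
      have "\<Theta> powr \<beta> * \<Theta> powr (1 - \<beta>) \<le> C1 * \<Theta> powr (1 - \<beta>)"
        using \<open>\<Theta> \<le> C1 * \<Theta> powr (1 - \<beta>)\<close> p by (simp add: powr_add[symmetric])
      then have "\<Theta> powr \<beta> \<le> C1" using p by simp
      then have "(\<Theta> powr \<beta>) powr (1 / \<beta>) \<le> C1 powr (1 / \<beta>)" using \<beta> by (intro powr_mono2) auto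
      then show ?thesis using \<beta> p by (simp add: powr_powr)
    qed simp
    then have "\<Theta> * d x powr - \<gamma> \<le> C1 powr (1 / \<beta>) * d x powr - \<gamma>" by (intro mult_right_mono) auto
    with wle[OF dx] show "w x \<le> (C * exp \<Lambda> * 2 powr (real DIM('a) / \<beta>) * \<iota>) powr (1 / \<beta>) * d x powr - (real DIM('a) / \<beta>)"
      by (simp add: C1_def \<gamma>_def)
  qed
qed

text \<open>Where w is small, half of the absorption survives the linear term. Testing with the bump
  of radius r then bounds the integral of \<open>w powr \<beta>\<close> by
  \<open>S / (\<kappa> * r\<^sup>2)\<close> times the volume, and the mean value inequality on the
  half ball, using \<open>w \<le> S powr (1 - \<beta>) * w powr \<beta>\<close>, gains the factor
  \<open>S powr (1 - \<beta>)\<close>.\<close>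

lemma dead_core_step:
  obtains C where "C > 0" "\<And>(w::'a::euclidean_space \<Rightarrow> real) x r S \<Lambda> \<kappa> \<beta>. integrable lebesgue w \<Longrightarrow> (\<And>z. 0 \<le> w z)
    \<Longrightarrow> isCont w x \<Longrightarrow> 0 < r \<Longrightarrow> r \<le> 1 \<Longrightarrow> 0 \<le> \<Lambda> \<Longrightarrow> 0 < \<kappa> \<Longrightarrow> 0 < \<beta> \<Longrightarrow> \<beta> < 1
    \<Longrightarrow> (\<And>z. z \<in> ball x r \<Longrightarrow> w z \<le> S) \<Longrightarrow> \<Lambda> * S powr (1 - \<beta>) \<le> \<kappa> / 2
    \<Longrightarrow> (\<And>t. 0 < t \<Longrightarrow> t \<le> r \<Longrightarrow> (\<integral>z. w z * laplacian (bump x t) z \<partial>lebesgue)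
        \<ge> (\<integral>z. (\<kappa> * w z powr \<beta> - \<Lambda> * w z) * bump x t z \<partial>lebesgue))
    \<Longrightarrow> w x \<le> C * (S * S powr (1 - \<beta>)) / (\<kappa> * r\<^sup>2)"
proof -
  obtain C0 where C0: "C0 > 0" and mv: "\<And>(w::'a \<Rightarrow> real) x0 R \<Lambda>. integrable lebesgue w \<Longrightarrow> (\<And>z. 0 \<le> w z)
    \<Longrightarrow> isCont w x0 \<Longrightarrow> 0 < R \<Longrightarrow> R \<le> 1 \<Longrightarrow> 0 \<le> \<Lambda>
    \<Longrightarrow> (\<And>t. 0 < t \<Longrightarrow> t \<le> R \<Longrightarrow> (\<integral>z. w z * laplacian (bump x0 t) z \<partial>lebesgue) \<ge> - \<Lambda> * (\<integral>z. w z * bump x0 t z \<partial>lebesgue))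
    \<Longrightarrow> w x0 \<le> C0 * exp \<Lambda> / R ^ DIM('a) * (\<integral>z. w z * indicator (ball x0 R) z \<partial>lebesgue)"
    by (fact mean_value_inequality)
  obtain CL where CL: "CL > 0" "\<And>(x0::'a) r z. r > 0 \<Longrightarrow> \<bar>laplacian (bump x0 r) z\<bar> \<le> CL / r\<^sup>2 * indicator (ball x0 r) z"
    by (fact abs_laplacian_bump_le)
  \<comment> \<open>Lower bound of the bump on the half ball, where its argument is at least 1 -
    1/4.\<close>
  define b0 where "b0 = flat 0 (3 / 4)"
  have b0: "b0 > 0" by (simp add: b0_def flat_0_pos)
  define V where "V = unit_ball_vol (real DIM('a))"
  have V: "V > 0" by (simp add: V_def unit_ball_vol_pos)
  let ?N = "DIM('a)"
  define C where "C = C0 * 2 ^ ?N * CL * V * 2 / b0"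
  show thesis
  proof
    show "C > 0" using C0 CL(1) V b0 by (simp add: C_def)
    fix w :: "'a \<Rightarrow> real" and x r S \<Lambda> \<kappa> \<beta>
    assume w: "integrable lebesgue w" "\<And>z. 0 \<le> w z" and cont: "isCont w x" and r: "0 < r" "r \<le> 1" and \<Lambda>: "0 \<le> \<Lambda>"
      and \<kappa>: "0 < \<kappa>" and \<beta>: "0 < \<beta>" "\<beta> < 1" and S: "\<And>z. z \<in> ball x r \<Longrightarrow> w z \<le> S" and small: "\<Lambda> * S powr (1 - \<beta>) \<le> \<kappa> / 2"
      and sub: "\<And>t. 0 < t \<Longrightarrow> t \<le> r \<Longrightarrow> (\<integral>z. w z * laplacian (bump x t) z \<partial>lebesgue)
        \<ge> (\<integral>z. (\<kappa> * w z powr \<beta> - \<Lambda> * w z) * bump x t z \<partial>lebesgue)"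
    have S0: "0 \<le> S" using S[of x] w(2)[of x] r by (auto intro: order_trans)
    note wm = borel_measurable_integrable[OF w(1)]
    have le: "w z \<le> S powr (1 - \<beta>) * w z powr \<beta>" if "z \<in> ball x r" for z
    proof -
      have "w z powr (1 - \<beta>) * w z powr \<beta> \<le> S powr (1 - \<beta>) * w z powr \<beta>"
        using S[OF that] w(2) \<beta> by (intro mult_right_mono powr_mono2) auto
      moreover have "w z powr (1 - \<beta>) * w z powr \<beta> = w z" using w(2)[of z] by (simp add: powr_add[symmetric])
      ultimately show ?thesis by simp
    qed
    have absorb: "\<kappa> / 2 * w z powr \<beta> \<le> \<kappa> * w z powr \<beta> - \<Lambda> * w z" if z: "z \<in> ball x r" for z
    proof -
      have "\<Lambda> * w z \<le> \<Lambda> * (S powr (1 - \<beta>) * w z powr \<beta>)" using le[OF z] \<Lambda> by (intro mult_left_mono)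
      also have "\<dots> \<le> \<kappa> / 2 * w z powr \<beta>" unfolding mult.assoc[symmetric] by (intro mult_right_mono small) simp
      finally show ?thesis by simp
    qed
    have iball: "integrable lebesgue (\<lambda>z. indicator (ball y s) z * c)" for y :: 'a and s c :: real
    proof -
      have "integrable lborel (\<lambda>z. indicator (ball y s) z * c)"
        using emeasure_lborel_ball_finite[of y s] by (intro integrable_mult_left integrable_real_indicator) auto
      then show ?thesis by (subst integrable_completion) (auto intro!: borel_measurable_times borel_measurable_indicator)
    qed
    \<comment> \<open>Integrability of w does not pass to a power below 1 on the whole space, so the
      bound \<open>S\<close> on the ball is used.\<close>
    have iwb: "integrable lebesgue (\<lambda>z. w z powr \<beta> * (indicator (ball x r) z * h z))"
      if h: "h \<in> borel_measurable lebesgue" "\<And>z. \<bar>h z\<bar> \<le> 1" for h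
    proof (rule Bochner_Integration.integrable_bound[OF iball[of x r "S powr \<beta>"]])
      have "(\<lambda>z. w z powr \<beta>) \<in> borel_measurable lebesgue" using wm by measurable
      then show "(\<lambda>z. w z powr \<beta> * (indicator (ball x r) z * h z)) \<in> borel_measurable lebesgue"
        by (intro borel_measurable_times borel_measurable_indicator h) auto
      show "AE z in lebesgue. norm (w z powr \<beta> * (indicator (ball x r) z * h z)) \<le> norm (indicator (ball x r) z * S powr \<beta>)"
      proof (rule AE_I2)
        fix z
        show "norm (w z powr \<beta> * (indicator (ball x r) z * h z)) \<le> norm (indicator (ball x r) z * S powr \<beta>)"
        proof (cases "z \<in> ball x r")
          case True
          have "w z powr \<beta> * \<bar>h z\<bar> \<le> S powr \<beta> * 1"
            using S[OF True] w(2) \<beta> h(2) by (intro mult_mono powr_mono2) auto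
          then show ?thesis using True by (simp add: abs_mult)
        qed simp
      qed
    qed
    have eqb: "indicator (ball x r) z * bump x t z = bump x t z" if "0 < t" "t \<le> r" for z t
    proof (cases "z \<in> ball x r")
      case False
      then have "z \<notin> ball x t" using that by auto
      then show ?thesis using bump_outside[OF that(1), of z x] by simp
    qed simp
    have ib: "integrable lebesgue (\<lambda>z. w z powr \<beta> * bump x t z)" "integrable lebesgue (\<lambda>z. w z * bump x t z)"
      if t: "0 < t" "t \<le> r" for t
    proof -
      show "integrable lebesgue (\<lambda>z. w z powr \<beta> * bump x t z)"
        using iwb[OF bump_lebesgue_measurable(3), of x t] by (simp add: eqb[OF t] bump_nonneg bump_le_1)
      show "integrable lebesgue (\<lambda>z. w z * bump x t z)"
        by (rule integrable_mult_bounded[OF w(1) bump_lebesgue_measurable(3), of _ _ 1])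
          (simp add: bump_nonneg bump_le_1)
    qed
    have ge: "\<kappa> / 2 * (\<integral>z. w z powr \<beta> * bump x t z \<partial>lebesgue) \<le> (\<integral>z. w z * laplacian (bump x t) z \<partial>lebesgue)"
      if t: "0 < t" "t \<le> r" for t
    proof -
      have "\<kappa> / 2 * (\<integral>z. w z powr \<beta> * bump x t z \<partial>lebesgue) = (\<integral>z. \<kappa> / 2 * (w z powr \<beta> * bump x t z) \<partial>lebesgue)"
        by simp
      also have "\<dots> \<le> (\<integral>z. (\<kappa> * w z powr \<beta> - \<Lambda> * w z) * bump x t z \<partial>lebesgue)"
      proof (rule integral_mono)
        show "integrable lebesgue (\<lambda>z. \<kappa> / 2 * (w z powr \<beta> * bump x t z))" using ib(1)[OF t] by simp
        have "(\<lambda>z. (\<kappa> * w z powr \<beta> - \<Lambda> * w z) * bump x t z) = (\<lambda>z. \<kappa> * (w z powr \<beta> * bump x t z) - \<Lambda> * (w z * bump x t z))"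
          by (auto simp: algebra_simps)
        then show "integrable lebesgue (\<lambda>z. (\<kappa> * w z powr \<beta> - \<Lambda> * w z) * bump x t z)" using ib[OF t] by simp
        fix z
        show "\<kappa> / 2 * (w z powr \<beta> * bump x t z) \<le> (\<kappa> * w z powr \<beta> - \<Lambda> * w z) * bump x t z"
        proof (cases "z \<in> ball x r")
          case True
          show ?thesis unfolding mult.assoc[symmetric] by (intro mult_right_mono absorb[OF True] bump_nonneg)
        next
          case False
          then have "bump x t z = 0" using eqb[OF t, of z] by simp
          then show ?thesis by simp
        qed
      qed
      also have "\<dots> \<le> (\<integral>z. w z * laplacian (bump x t) z \<partial>lebesgue)" by (rule sub[OF t])
      finally show ?thesis .
    qed
    have rr: "0 < r / 2" "r / 2 \<le> 1" using r by auto
    \<comment> \<open>The surviving absorption is nonnegative, so w behaves as a subharmonic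
      function at these radii and the mean value inequality applies with constant 0.\<close>
    have "w x \<le> C0 * exp 0 / (r / 2) ^ ?N * (\<integral>z. w z * indicator (ball x (r / 2)) z \<partial>lebesgue)"
    proof (rule mv[OF w cont rr])
      fix t assume t: "0 < t" "t \<le> r / 2"
      have "0 \<le> \<kappa> / 2 * (\<integral>z. w z powr \<beta> * bump x t z \<partial>lebesgue)"
        using \<kappa> by (intro mult_nonneg_nonneg Bochner_Integration.integral_nonneg) (auto simp: bump_nonneg)
      then show "- 0 * (\<integral>z. w z * bump x t z \<partial>lebesgue) \<le> (\<integral>z. w z * laplacian (bump x t) z \<partial>lebesgue)"
        using ge[of t] t r by simp
    qed simp
    also have "\<dots> = C0 * 2 ^ ?N / r ^ ?N * (\<integral>z. w z * indicator (ball x (r / 2)) z \<partial>lebesgue)"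
      by (simp add: power_divide)
    also have "\<dots> \<le> C0 * 2 ^ ?N / r ^ ?N * (S powr (1 - \<beta>) / b0 * (\<integral>z. w z powr \<beta> * bump x r z \<partial>lebesgue))"
    proof (rule mult_left_mono)
      have "(\<integral>z. w z * indicator (ball x (r / 2)) z \<partial>lebesgue) \<le> (\<integral>z. S powr (1 - \<beta>) / b0 * (w z powr \<beta> * bump x r z) \<partial>lebesgue)"
      proof (rule integral_mono)
        show "integrable lebesgue (\<lambda>z. w z * indicator (ball x (r / 2)) z)"
          by (rule integrable_times_indicator[OF w(1)]) simp
        show "integrable lebesgue (\<lambda>z. S powr (1 - \<beta>) / b0 * (w z powr \<beta> * bump x r z))" using ib(1)[of r] r by simp
        fix z
        show "w z * indicator (ball x (r / 2)) z \<le> S powr (1 - \<beta>) / b0 * (w z powr \<beta> * bump x r z)"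
        proof (cases "z \<in> ball x (r / 2)")
          case True
          then have zr: "z \<in> ball x r" using r by auto
          have "norm (z - x) \<le> r / 2" using True by (simp add: dist_norm norm_minus_commute)
          then have "(norm (z - x))\<^sup>2 \<le> (r / 2)\<^sup>2" by (intro power_mono) auto
          then have "3 / 4 \<le> bump_arg x r z" using r by (simp add: bump_arg_def field_simps power_divide)
          then have bz: "b0 \<le> bump x r z" unfolding b0_def bump_def by (rule flat_0_mono)
          have "w z * 1 \<le> (S powr (1 - \<beta>) * w z powr \<beta>) * (bump x r z / b0)"
            using le[OF zr] bz b0 S0 w(2) by (intro mult_mono) auto
          then show ?thesis using True by (simp add: field_simps)
        next
          case False
          then show ?thesis using b0 S0 bump_nonneg[of x r z] by simp
        qed
      qed
      then show "(\<integral>z. w z * indicator (ball x (r / 2)) z \<partial>lebesgue) \<le> S powr (1 - \<beta>) / b0 * (\<integral>z. w z powr \<beta> * bump x r z \<partial>lebesgue)"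
        by simp
    qed (use C0 r in simp)
    also have "\<dots> \<le> C0 * 2 ^ ?N / r ^ ?N * (S powr (1 - \<beta>) / b0 * (2 / \<kappa> * (S * (CL / r\<^sup>2) * (V * r ^ ?N))))"
    proof (intro mult_left_mono)
      have "(\<integral>z. w z * laplacian (bump x r) z \<partial>lebesgue) \<le> (\<integral>z. indicator (ball x r) z * (S * (CL / r\<^sup>2)) \<partial>lebesgue)"
      proof (rule integral_mono)
        show "integrable lebesgue (\<lambda>z. w z * laplacian (bump x r) z)"
        proof (rule integrable_mult_bounded[OF w(1) bump_lebesgue_measurable(2), of _ _ "CL / r\<^sup>2"])
          fix z
          have "CL / r\<^sup>2 * indicator (ball x r) z \<le> CL / r\<^sup>2 * 1" using CL(1) by (intro mult_left_mono) (auto simp: indicator_def)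
          then show "\<bar>laplacian (bump x r) z\<bar> \<le> CL / r\<^sup>2" using CL(2)[OF r(1), of x z] by simp
        qed
        show "integrable lebesgue (\<lambda>z. indicator (ball x r) z * (S * (CL / r\<^sup>2)))" by (rule iball)
        fix z
        show "w z * laplacian (bump x r) z \<le> indicator (ball x r) z * (S * (CL / r\<^sup>2))"
        proof (cases "z \<in> ball x r")
          case True
          have "w z * laplacian (bump x r) z \<le> w z * \<bar>laplacian (bump x r) z\<bar>" using w(2) by (intro mult_left_mono) auto
          also have "\<dots> \<le> S * (CL / r\<^sup>2)"
            using CL(2)[OF r(1), of x z] True S[OF True] S0 by (intro mult_mono) auto
          finally show ?thesis using True by simp
        next
          case False
          then show ?thesis using CL(2)[OF r(1), of x z] by simp
        qed
      qed
      also have "\<dots> = S * (CL / r\<^sup>2) * (V * r ^ ?N)"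
        using content_ball[of r x] r by (simp add: V_def mult_ac)
      finally have "\<kappa> / 2 * (\<integral>z. w z powr \<beta> * bump x r z \<partial>lebesgue) \<le> S * (CL / r\<^sup>2) * (V * r ^ ?N)"
        by (rule order_trans[OF ge[OF r(1) order_refl]])
      then have "2 / \<kappa> * (\<kappa> / 2 * (\<integral>z. w z powr \<beta> * bump x r z \<partial>lebesgue)) \<le> 2 / \<kappa> * (S * (CL / r\<^sup>2) * (V * r ^ ?N))"
        using \<kappa> by (intro mult_left_mono) auto
      moreover have "2 / \<kappa> * (\<kappa> / 2 * X) = X" for X using \<kappa> by simp
      ultimately show "(\<integral>z. w z powr \<beta> * bump x r z \<partial>lebesgue) \<le> 2 / \<kappa> * (S * (CL / r\<^sup>2) * (V * r ^ ?N))"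
        by (simp only:)
    qed (use C0 r b0 in auto)
    also have "\<dots> = C * (S * S powr (1 - \<beta>)) / (\<kappa> * r\<^sup>2)"
      using r \<kappa> b0 by (simp add: C_def field_simps)
    finally show "w x \<le> C * (S * S powr (1 - \<beta>)) / (\<kappa> * r\<^sup>2)" .
  qed
qed

text \<open>On the concentric balls of radius \<open>R / 2 ^ k\<close> the bound improves by the factor \<open>q\<close> at
  each step, because \<open>q powr (1 - \<beta>) = 1 / 4\<close> compensates for halving the radius.\<close>

lemma dead_core:
  obtains C where "C > 0" "\<And>(w::'a::euclidean_space \<Rightarrow> real) x0 R a \<Lambda> \<kappa> \<beta> q. integrable lebesgue w \<Longrightarrow> (\<And>z. 0 \<le> w z)
    \<Longrightarrow> 0 < R \<Longrightarrow> R \<le> 1 \<Longrightarrow> 0 \<le> \<Lambda> \<Longrightarrow> 0 < \<kappa> \<Longrightarrow> 0 < \<beta> \<Longrightarrow> \<beta> < 1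
    \<Longrightarrow> (\<And>z. z \<in> ball x0 R \<Longrightarrow> w z \<le> a) \<Longrightarrow> q = (1 / 4) powr (1 / (1 - \<beta>))
    \<Longrightarrow> \<Lambda> * a powr (1 - \<beta>) \<le> \<kappa> / 2 \<Longrightarrow> C * 4 * a powr (1 - \<beta>) \<le> q * \<kappa> * R\<^sup>2
    \<Longrightarrow> (\<And>z. z \<in> ball x0 R \<Longrightarrow> 0 < w z \<Longrightarrow> isCont w z)
    \<Longrightarrow> (\<And>z t. 0 < w z \<Longrightarrow> 0 < t \<Longrightarrow> ball z t \<subseteq> ball x0 R \<Longrightarrow> (\<integral>y. w y * laplacian (bump z t) y \<partial>lebesgue)
        \<ge> (\<integral>y. (\<kappa> * w y powr \<beta> - \<Lambda> * w y) * bump z t y \<partial>lebesgue))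
    \<Longrightarrow> w x0 = 0"
proof -
  obtain C where C: "C > 0" and step: "\<And>(w::'a \<Rightarrow> real) x r S \<Lambda> \<kappa> \<beta>. integrable lebesgue w \<Longrightarrow> (\<And>z. 0 \<le> w z)
    \<Longrightarrow> isCont w x \<Longrightarrow> 0 < r \<Longrightarrow> r \<le> 1 \<Longrightarrow> 0 \<le> \<Lambda> \<Longrightarrow> 0 < \<kappa> \<Longrightarrow> 0 < \<beta> \<Longrightarrow> \<beta> < 1
    \<Longrightarrow> (\<And>z. z \<in> ball x r \<Longrightarrow> w z \<le> S) \<Longrightarrow> \<Lambda> * S powr (1 - \<beta>) \<le> \<kappa> / 2
    \<Longrightarrow> (\<And>t. 0 < t \<Longrightarrow> t \<le> r \<Longrightarrow> (\<integral>z. w z * laplacian (bump x t) z \<partial>lebesgue)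
        \<ge> (\<integral>z. (\<kappa> * w z powr \<beta> - \<Lambda> * w z) * bump x t z \<partial>lebesgue))
    \<Longrightarrow> w x \<le> C * (S * S powr (1 - \<beta>)) / (\<kappa> * r\<^sup>2)"
    by (fact dead_core_step)
  show thesis
  proof
    show "C > 0" by (rule C)
    fix w :: "'a \<Rightarrow> real" and x0 R a \<Lambda> \<kappa> \<beta> q
    assume w: "integrable lebesgue w" "\<And>z. 0 \<le> w z" and R: "0 < R" "R \<le> 1" and \<Lambda>: "0 \<le> \<Lambda>" and \<kappa>: "0 < \<kappa>" and \<beta>: "0 < \<beta>" "\<beta> < 1"
      and a: "\<And>z. z \<in> ball x0 R \<Longrightarrow> w z \<le> a" and q: "q = (1 / 4) powr (1 / (1 - \<beta>))"
      and small: "\<Lambda> * a powr (1 - \<beta>) \<le> \<kappa> / 2" "C * 4 * a powr (1 - \<beta>) \<le> q * \<kappa> * R\<^sup>2"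
      and cont: "\<And>z. z \<in> ball x0 R \<Longrightarrow> 0 < w z \<Longrightarrow> isCont w z"
      and sub: "\<And>z t. 0 < w z \<Longrightarrow> 0 < t \<Longrightarrow> ball z t \<subseteq> ball x0 R \<Longrightarrow> (\<integral>y. w y * laplacian (bump z t) y \<partial>lebesgue)
        \<ge> (\<integral>y. (\<kappa> * w y powr \<beta> - \<Lambda> * w y) * bump z t y \<partial>lebesgue)"
    have a0: "0 \<le> a" using a[of x0] w(2)[of x0] R by (auto intro: order_trans)
    have q0: "0 < q" by (simp add: q)
    have q1: "q < 1" unfolding q using powr_less_mono2[of "1 / (1 - \<beta>)" "1 / 4" 1] \<beta> by simp
    have qp: "q powr (1 - \<beta>) = 1 / 4" using \<beta> by (simp add: q powr_powr)
    have bound: "w z \<le> a * q ^ k" if "z \<in> ball x0 (R / 2 ^ k)" for z k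
      using that
    proof (induction k arbitrary: z)
      case 0
      then show ?case using a by simp
    next
      case (Suc k)
      show ?case
      proof (cases "w z = 0")
        case False
        then have wz: "0 < w z" using w(2)[of z] by linarith
        define r where "r = R / 2 ^ Suc k"
        have "R / 2 ^ Suc k \<le> R / 1" using R one_le_power[of "2::real" "Suc k"] by (intro divide_left_mono) auto
        then have "r \<le> R" unfolding r_def by (simp only: div_by_1)
        moreover have "0 < r" using R by (simp add: r_def)
        ultimately have r: "0 < r" "r \<le> 1" using R by auto
        have sb: "ball z r \<subseteq> ball x0 (R / 2 ^ k)"
          using Suc.prems by (intro ball_subset_ball_iff[THEN iffD2] disjI1) (auto simp: r_def dist_commute field_simps)
        have "R / 2 ^ k \<le> R" using R by (simp add: field_simps)
        then have sR: "ball z r \<subseteq> ball x0 R" using sb by fastforce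
        then have zR: "z \<in> ball x0 R" using r centre_in_ball[of z r] by blast
        let ?S = "a * q ^ k"
        \<comment> \<open>The factor 4^k lost by the squared radius is exactly the one gained here;
          the extra 4 in the smallness condition comes from the radius having index k + 1.\<close>
        have Sp: "?S powr (1 - \<beta>) = a powr (1 - \<beta>) / 4 ^ k"
        proof -
          have "(q ^ k) powr (1 - \<beta>) = (q powr (1 - \<beta>)) ^ k"
            using q0 by (simp add: powr_realpow[symmetric] powr_powr powr_power mult.commute)
          then show ?thesis using a0 q0 by (simp add: powr_mult qp power_divide)
        qed
        have "w z \<le> C * (?S * ?S powr (1 - \<beta>)) / (\<kappa> * r\<^sup>2)"
        proof (rule step[OF w cont[OF zR wz] r \<Lambda> \<kappa> \<beta>])
          show "w y \<le> ?S" if "y \<in> ball z r" for y using Suc.IH sb that by blast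
          have "a powr (1 - \<beta>) / 4 ^ k \<le> a powr (1 - \<beta>) / 1" by (intro divide_left_mono) auto
          then have "\<Lambda> * (a powr (1 - \<beta>) / 4 ^ k) \<le> \<Lambda> * a powr (1 - \<beta>)" using \<Lambda> by (intro mult_left_mono) auto
          then show "\<Lambda> * ?S powr (1 - \<beta>) \<le> \<kappa> / 2" unfolding Sp using small(1) by linarith
          show "(\<integral>y. w y * laplacian (bump z t) y \<partial>lebesgue) \<ge> (\<integral>y. (\<kappa> * w y powr \<beta> - \<Lambda> * w y) * bump z t y \<partial>lebesgue)"
            if "0 < t" "t \<le> r" for t
            using that sR by (intro sub wz) (auto dest: subset_ball)
        qed
        also have "\<dots> = ?S * (C * 4 * a powr (1 - \<beta>) / (\<kappa> * R\<^sup>2))"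
        proof -
          have "(2 ^ k :: real) * 2 ^ k = 4 ^ k" by (simp add: power_mult_distrib[symmetric])
          then have r2: "r\<^sup>2 = R\<^sup>2 / (4 * 4 ^ k)" by (simp add: r_def power2_eq_square)
          show ?thesis unfolding Sp r2 using R \<kappa> by (simp add: field_simps)
        qed
        also have "\<dots> \<le> ?S * q"
          using small(2) \<kappa> R a0 q0 by (intro mult_left_mono) (auto simp: field_simps)
        finally show ?thesis by (simp add: mult_ac)
      qed (use a0 q0 in simp)
    qed
    have "(\<lambda>k. a * q ^ k) \<longlonglongrightarrow> a * 0"
      using q0 q1 by (intro tendsto_mult tendsto_const LIMSEQ_power_zero) auto
    then have "w x0 \<le> a * 0"
      by (rule LIMSEQ_le_const) (use bound[of x0] R in auto)
    then show "w x0 = 0" using w(2)[of x0] by simp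
  qed
qed

subsection \<open>Compact support\<close>

text \<open>A limit point at distance at least \<open>\<rho>\<close> from the frontier cannot lie on
  it, hence lies in the open set itself.\<close>

lemma closed_inner_set:
  assumes "open (D :: 'a::euclidean_space set)" "\<rho> > 0"
  shows "closed {x \<in> D. \<rho> \<le> infdist x (frontier D)}"
proof -
  have "{x \<in> D. \<rho> \<le> infdist x (frontier D)} = closure D \<inter> {x. \<rho> \<le> infdist x (frontier D)}"
  proof (intro equalityI subsetI)
    fix x assume x: "x \<in> closure D \<inter> {x. \<rho> \<le> infdist x (frontier D)}"
    then have "infdist x (frontier D) \<noteq> 0" using assms(2) by auto
    then have "x \<notin> frontier D" by (metis infdist_zero)
    then show "x \<in> {x \<in> D. \<rho> \<le> infdist x (frontier D)}"
      using x assms(1) by (auto simp: frontier_def interior_open)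
  qed (use closure_subset in auto)
  moreover have "closed {x. \<rho> \<le> infdist x (frontier D)}"
    by (intro closed_Collect_le continuous_intros)
  ultimately show ?thesis by (simp add: closed_Int)
qed

lemma open_boundary_strip: "open D \<Longrightarrow> open (boundary_strip D \<rho>)"
proof -
  assume "open D"
  moreover have "boundary_strip D \<rho> = D \<inter> {x. infdist x (frontier D) < \<rho>}" by (auto simp: boundary_strip_def)
  moreover have "open {x. infdist x (frontier D) < \<rho>}"
    by (intro open_Collect_less continuous_intros)
  ultimately show ?thesis by (simp add: open_Int)
qed

lemma boundary_strip_nonempty:
  assumes D: "open D" "bounded D" "D \<noteq> {}" and "\<rho> > 0"
  shows "boundary_strip (D :: 'a::euclidean_space set) \<rho> \<noteq> {}"
proof -
  have "frontier D \<noteq> {}" using D not_bounded_UNIV by (auto simp: frontier_eq_empty)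
  then obtain y where y: "y \<in> frontier D" by blast
  then obtain x where x: "x \<in> D" "dist x y < \<rho>"
    using \<open>\<rho> > 0\<close> closure_approachable by (metis DiffD1 frontier_def)
  then have "infdist x (frontier D) < \<rho>" using infdist_le[OF y, of x] by linarith
  then show ?thesis using x by (auto simp: boundary_strip_def)
qed

text \<open>Values of the representative outside \<open>D\<close> are arbitrary, so they are
  overwritten by zero before integrating over balls that cross the frontier.\<close>

definition square_ext :: "'a::euclidean_space set \<Rightarrow> ('a \<Rightarrow> real) \<Rightarrow> 'a \<Rightarrow> real" where
  "square_ext D u x = (if x \<in> D then (u x)\<^sup>2 else 0)"

lemma lebesgue_on_integral:
  fixes f :: "'a::euclidean_space \<Rightarrow> real"
  assumes "open D"
  shows "(\<integral>x. f x \<partial>lebesgue_on D) = (\<integral>x. (if x \<in> D then f x else 0) \<partial>lebesgue)"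
    and "integrable (lebesgue_on D) f \<longleftrightarrow> integrable lebesgue (\<lambda>x. if x \<in> D then f x else 0)"
proof -
  have D: "D \<inter> space lebesgue \<in> sets lebesgue" using assms by simp
  have eq: "(\<lambda>x. indicator D x *\<^sub>R f x) = (\<lambda>x. if x \<in> D then f x else 0)" by auto
  show "(\<integral>x. f x \<partial>lebesgue_on D) = (\<integral>x. (if x \<in> D then f x else 0) \<partial>lebesgue)"
    using integral_restrict_space[OF D, of f] unfolding eq .
  show "integrable (lebesgue_on D) f \<longleftrightarrow> integrable lebesgue (\<lambda>x. if x \<in> D then f x else 0)"
    using integrable_restrict_space[OF D, of f] unfolding eq .
qed

lemma square_powr: "(y\<^sup>2) powr ((\<alpha> + 1) / 2) = \<bar>y\<bar> powr (\<alpha> + 1)" for y \<alpha> :: real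
proof (cases "y = 0")
  case False
  have "y\<^sup>2 = \<bar>y\<bar> powr 2" using False by (simp add: powr_numeral)
  then have "(y\<^sup>2) powr ((\<alpha> + 1) / 2) = \<bar>y\<bar> powr (2 * ((\<alpha> + 1) / 2))" by (simp only: powr_powr)
  also have "2 * ((\<alpha> + 1) / 2) = \<alpha> + 1" by simp
  finally show ?thesis .
qed simp

lemma square_ext_properties:
  fixes u :: "'a::euclidean_space \<Rightarrow> real"
  assumes D: "open D" "bounded D" and u: "u \<in> borel_measurable (lebesgue_on D)" "continuous_on (closure D) u" and \<alpha>: "0 < \<alpha>"
  obtains B where "\<And>x. x \<in> D \<Longrightarrow> \<bar>u x\<bar> \<le> B" "\<And>x. square_ext D u x \<le> B\<^sup>2"
    "integrable lebesgue (square_ext D u)" "integrable lebesgue (\<lambda>x. square_ext D u x powr ((\<alpha> + 1) / 2))"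
    "integrable (lebesgue_on D) (\<lambda>x. (u x)\<^sup>2)" "integrable (lebesgue_on D) (\<lambda>x. \<bar>u x\<bar> powr (\<alpha> + 1))"
    "\<And>x. x \<in> D \<Longrightarrow> isCont (square_ext D u) x"
proof -
  have "compact (u ` closure D)"
    using D u(2) by (intro compact_continuous_image) (auto simp: compact_closure)
  then obtain B where B: "B > 0" "\<forall>y\<in>u ` closure D. norm y \<le> B" using compact_imp_bounded bounded_pos by metis
  then have bd: "\<bar>u x\<bar> \<le> B" if "x \<in> D" for x using that closure_subset by (metis image_eqI real_norm_def subsetD)
  have aeD: "AE x in lebesgue_on D. x \<in> D" by (rule AE_I2) (simp add: space_restrict_space)
  have i2: "integrable (lebesgue_on D) (\<lambda>x. (u x)\<^sup>2)"
  proof (rule integrable_lebesgue_on_bounded[OF D])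
    show "(\<lambda>x. (u x)\<^sup>2) \<in> borel_measurable (lebesgue_on D)" using u(1) by measurable
    show "AE x in lebesgue_on D. \<bar>(u x)\<^sup>2\<bar> \<le> B\<^sup>2"
      using aeD by eventually_elim (use bd B in \<open>auto simp: abs_le_square_iff[symmetric]\<close>)
  qed
  have ip: "integrable (lebesgue_on D) (\<lambda>x. \<bar>u x\<bar> powr (\<alpha> + 1))"
  proof (rule integrable_lebesgue_on_bounded[OF D])
    show "(\<lambda>x. \<bar>u x\<bar> powr (\<alpha> + 1)) \<in> borel_measurable (lebesgue_on D)" using u(1) by measurable
    show "AE x in lebesgue_on D. \<bar>\<bar>u x\<bar> powr (\<alpha> + 1)\<bar> \<le> B powr (\<alpha> + 1)"
      using aeD by eventually_elim (use bd \<alpha> in \<open>auto intro!: powr_mono2\<close>)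
  qed
  show thesis
  proof
    show "\<bar>u x\<bar> \<le> B" if "x \<in> D" for x by (rule bd[OF that])
    show "square_ext D u x \<le> B\<^sup>2" for x
      using bd[of x] B by (auto simp: square_ext_def abs_le_square_iff[symmetric])
    show "integrable lebesgue (square_ext D u)"
      using i2 lebesgue_on_integral(2)[OF D(1), of "\<lambda>x. (u x)\<^sup>2"] by (simp add: square_ext_def[abs_def])
    have "(\<lambda>x. square_ext D u x powr ((\<alpha> + 1) / 2)) = (\<lambda>x. if x \<in> D then \<bar>u x\<bar> powr (\<alpha> + 1) else 0)"
      by (auto simp: square_ext_def square_powr)
    then show "integrable lebesgue (\<lambda>x. square_ext D u x powr ((\<alpha> + 1) / 2))"
      using ip lebesgue_on_integral(2)[OF D(1), of "\<lambda>x. \<bar>u x\<bar> powr (\<alpha> + 1)"] by simp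
    have "continuous_on D (\<lambda>x. (u x)\<^sup>2)"
      by (intro continuous_intros continuous_on_subset[OF u(2) closure_subset])
    then have "continuous_on D (square_ext D u)"
      by (subst continuous_on_cong[OF refl, of D _ "\<lambda>x. (u x)\<^sup>2"]) (auto simp: square_ext_def)
    then show "isCont (square_ext D u) x" if "x \<in> D" for x
      using that D(1) continuous_on_eq_continuous_at by blast
  qed (rule i2, rule ip)
qed

text \<open>Only the part of the ball inside \<open>D\<close> must lie in the strip, as the
  extension vanishes elsewhere. Replacing \<open>\<mu>\<close> by its upper bound
  \<open>\<nu>0\<close> frees the inequality of the parameter.\<close>

lemma square_ext_subsolution:
  assumes D: "open D" "bounded D" and m: "essentially_bounded D m" and \<alpha>: "0 < \<alpha>" "\<alpha> < 1"
    and strip: "AE x in lebesgue_on (boundary_strip D \<rho>0). - m x \<ge> m0"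
    and u: "weak_solution D m \<alpha> \<mu> u" "\<And>x. x \<in> D \<Longrightarrow> 0 \<le> u x" "continuous_on (closure D) u"
    and \<mu>: "\<mu> \<le> \<nu>0" and t: "t > 0" and ball: "\<And>z. z \<in> ball x t \<Longrightarrow> z \<in> D \<Longrightarrow> infdist z (frontier D) < \<rho>0"
  shows "(\<integral>z. square_ext D u z * laplacian (bump x t) z \<partial>lebesgue)
    \<ge> (\<integral>z. (2 * m0 * square_ext D u z powr ((\<alpha> + 1) / 2) - 2 * \<nu>0 * square_ext D u z) * bump x t z \<partial>lebesgue)"
proof -
  let ?M = "lebesgue_on D" and ?p = "\<alpha> + 1"
  have "u \<in> H10 D" using u(1) by (simp add: weak_solution_def)
  then have uL: "u \<in> borel_measurable ?M"
    using H10_H10_grad[OF D(1)] by (auto simp: H10_grad_def L2_def)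
  obtain B where B: "\<And>x. x \<in> D \<Longrightarrow> \<bar>u x\<bar> \<le> B" "integrable ?M (\<lambda>x. (u x)\<^sup>2)" "integrable ?M (\<lambda>x. \<bar>u x\<bar> powr ?p)"
    using square_ext_properties[OF D uL u(3) \<alpha>(1)] by metis
  have Mi: "integrable ?M (\<lambda>x. m x * \<bar>u x\<bar> powr ?p)"
    by (rule M_integrable[OF D m _ uL B(1)]) (use \<alpha> in auto)
  have bt: "bump x t \<in> test_functions UNIV" by (rule bump_test_function[OF t]) simp
  have bm: "bump x t \<in> borel_measurable ?M" by (intro borel_measurable_lebesgue_on test_function_borel[OF bt])
  have b1: "\<bar>bump x t z\<bar> \<le> 1" for z by (simp add: bump_nonneg bump_le_1)
  have "(\<integral>z. (2 * m0 * square_ext D u z powr (?p / 2) - 2 * \<nu>0 * square_ext D u z) * bump x t z \<partial>lebesgue)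
      = (\<integral>z. (2 * m0 * \<bar>u z\<bar> powr ?p - 2 * \<nu>0 * (u z)\<^sup>2) * bump x t z \<partial>?M)"
    unfolding lebesgue_on_integral(1)[OF D(1)]
    by (rule Bochner_Integration.integral_cong) (auto simp: square_ext_def square_powr)
  also have "\<dots> \<le> (\<integral>z. (- 2 * \<mu> * (u z)\<^sup>2 - 2 * (m z * \<bar>u z\<bar> powr ?p)) * bump x t z \<partial>?M)"
  proof (rule integral_mono_AE)
    show "integrable ?M (\<lambda>z. (2 * m0 * \<bar>u z\<bar> powr ?p - 2 * \<nu>0 * (u z)\<^sup>2) * bump x t z)"
      by (rule integrable_mult_bounded[OF _ bm b1]) (use B in simp)
    show "integrable ?M (\<lambda>z. (- 2 * \<mu> * (u z)\<^sup>2 - 2 * (m z * \<bar>u z\<bar> powr ?p)) * bump x t z)"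
      by (rule integrable_mult_bounded[OF _ bm b1]) (use B Mi in simp)
    have "open (boundary_strip D \<rho>0)" by (rule open_boundary_strip[OF D(1)])
    then have "AE z in lebesgue. z \<in> boundary_strip D \<rho>0 \<longrightarrow> m0 \<le> - m z"
      using strip AE_restrict_space_iff[of "boundary_strip D \<rho>0" lebesgue] by simp
    then have "AE z in ?M. z \<in> boundary_strip D \<rho>0 \<longrightarrow> m0 \<le> - m z"
      using D(1) AE_restrict_space_iff[of D lebesgue] by (auto elim!: eventually_mono)
    moreover have "AE z in ?M. z \<in> D" by (rule AE_I2) (simp add: space_restrict_space)
    ultimately show "AE z in ?M. (2 * m0 * \<bar>u z\<bar> powr ?p - 2 * \<nu>0 * (u z)\<^sup>2) * bump x t z
        \<le> (- 2 * \<mu> * (u z)\<^sup>2 - 2 * (m z * \<bar>u z\<bar> powr ?p)) * bump x t z"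
    proof eventually_elim
      case (elim z)
      show ?case
      proof (cases "z \<in> ball x t")
        case True
        then have "m0 \<le> - m z" using elim ball[OF True] by (auto simp: boundary_strip_def)
        then have "m0 * \<bar>u z\<bar> powr ?p \<le> - m z * \<bar>u z\<bar> powr ?p" by (intro mult_right_mono) auto
        moreover have "\<mu> * (u z)\<^sup>2 \<le> \<nu>0 * (u z)\<^sup>2" using \<mu> by (intro mult_right_mono) auto
        ultimately show ?thesis by (intro mult_right_mono bump_nonneg) simp
      next
        case False
        then show ?thesis using bump_outside[OF t, of z x] by simp
      qed
    qed
  qed
  also have "\<dots> \<le> (\<integral>z. (u z)\<^sup>2 * laplacian (bump x t) z \<partial>?M)"
    by (rule weak_solution_square_subsolution[OF D m \<alpha> u(1,2) B(1) bt bump_nonneg])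
  also have "\<dots> = (\<integral>z. square_ext D u z * laplacian (bump x t) z \<partial>lebesgue)"
    unfolding lebesgue_on_integral(1)[OF D(1)]
    by (rule Bochner_Integration.integral_cong) (auto simp: square_ext_def)
  finally show ?thesis .
qed

text \<open>On the strip the weight -m is at least \<open>m0\<close>, and elsewhere -m is still
  nonnegative, so the strip carries at most the whole of -M. The minimal energy enters the local
  estimates through this bound.\<close>

lemma strip_power_integral_le:
  assumes D: "open D" "bounded D" and m: "essentially_bounded D m" "AE x in lebesgue_on D. m x \<le> 0" and \<alpha>: "0 < \<alpha>"
    and strip: "AE x in lebesgue_on (boundary_strip D \<rho>0). - m x \<ge> m0" and m0: "m0 > 0"
    and u: "u \<in> borel_measurable (lebesgue_on D)" "continuous_on (closure D) u"
    and d: "open {z. 0 < d z}" "\<And>z. z \<in> D \<Longrightarrow> 0 < d z \<Longrightarrow> infdist z (frontier D) < \<rho>0"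
  shows "(\<integral>z. square_ext D u z powr ((\<alpha> + 1) / 2) * indicator {z. 0 < d z} z \<partial>lebesgue) \<le> - M_form D m \<alpha> u / m0"
proof -
  let ?M = "lebesgue_on D" and ?p = "\<alpha> + 1"
  obtain B where B: "\<And>x. x \<in> D \<Longrightarrow> \<bar>u x\<bar> \<le> B" "integrable ?M (\<lambda>x. \<bar>u x\<bar> powr ?p)"
    using square_ext_properties[OF D u \<alpha>] by metis
  have Mi: "integrable ?M (\<lambda>x. m x * \<bar>u x\<bar> powr ?p)"
    by (rule M_integrable[OF D m(1) _ u(1) B(1)]) (use \<alpha> in auto)
  have "(\<integral>z. square_ext D u z powr (?p / 2) * indicator {z. 0 < d z} z \<partial>lebesgue)
      = (\<integral>z. \<bar>u z\<bar> powr ?p * indicator {z. 0 < d z} z \<partial>?M)"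
    unfolding lebesgue_on_integral(1)[OF D(1)]
    by (rule Bochner_Integration.integral_cong) (auto simp: square_ext_def square_powr)
  also have "\<dots> \<le> (\<integral>z. (- 1 / m0) * (m z * \<bar>u z\<bar> powr ?p) \<partial>?M)"
  proof (rule integral_mono_AE)
    have "{z. 0 < d z} \<in> sets borel" using d(1) by simp
    then have "(indicator {z. 0 < d z} :: 'a \<Rightarrow> real) \<in> borel_measurable ?M"
      by (intro borel_measurable_lebesgue_on borel_measurable_indicator)
    then show "integrable ?M (\<lambda>z. \<bar>u z\<bar> powr ?p * indicator {z. 0 < d z} z)"
      by (rule integrable_mult_bounded[OF B(2), of _ 1]) (auto simp: indicator_def)
    show "integrable ?M (\<lambda>z. (- 1 / m0) * (m z * \<bar>u z\<bar> powr ?p))" by (intro integrable_mult_right Mi)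
    have "open (boundary_strip D \<rho>0)" by (rule open_boundary_strip[OF D(1)])
    then have "AE z in lebesgue. z \<in> boundary_strip D \<rho>0 \<longrightarrow> m0 \<le> - m z"
      using strip AE_restrict_space_iff[of "boundary_strip D \<rho>0" lebesgue] by simp
    then have "AE z in ?M. z \<in> boundary_strip D \<rho>0 \<longrightarrow> m0 \<le> - m z"
      using D(1) AE_restrict_space_iff[of D lebesgue] by (auto elim!: eventually_mono)
    moreover have "AE z in ?M. z \<in> D" by (rule AE_I2) (simp add: space_restrict_space)
    ultimately show "AE z in ?M. \<bar>u z\<bar> powr ?p * indicator {z. 0 < d z} z \<le> (- 1 / m0) * (m z * \<bar>u z\<bar> powr ?p)"
      using m(2)
    proof eventually_elim
      case (elim z)
      show ?case
      proof (cases "0 < d z")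
        case True
        then have "m0 \<le> - m z" using elim(1,2) d(2)[of z] by (auto simp: boundary_strip_def)
        then have "m0 * \<bar>u z\<bar> powr ?p \<le> - m z * \<bar>u z\<bar> powr ?p" by (intro mult_right_mono) auto
        then show ?thesis using m0 True by (simp add: field_simps)
      next
        case False
        have "m z * \<bar>u z\<bar> powr ?p \<le> 0" using elim(3) by (simp add: mult_nonpos_nonneg)
        then show ?thesis using False m0 by (simp add: divide_nonpos_pos)
      qed
    qed
  qed
  also have "\<dots> = - M_form D m \<alpha> u / m0"
    unfolding Bochner_Integration.integral_mult_right_zero by (simp add: M_form_def)
  finally show ?thesis .
qed

theorem theorem2:
  fixes \<Omega> \<Omega>0 :: "'a::euclidean_space set"
    and m :: "'a \<Rightarrow> real"
    and \<alpha> \<rho>0 m\<rho>0 :: real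
    and u :: "real \<Rightarrow> 'a \<Rightarrow> real"
  assumes "bounded \<Omega>" and "C11_domain \<Omega>"
    and "0 < \<alpha>" and "\<alpha> < 1"
    and "essentially_bounded \<Omega> m"
    and "AE x in lebesgue_on \<Omega>. m x \<le> 0"
    and "\<Omega>0 = interior {x \<in> \<Omega>. m x = 0}"
    and "C11_domain \<Omega>0"
    and "compactly_contained \<Omega>0 \<Omega>"
    and "AE x in lebesgue_on (\<Omega> - closure \<Omega>0). m x < 0"
    and "\<rho>0 > 0" and "m\<rho>0 > 0"
    and "boundary_strip \<Omega> \<rho>0 \<subseteq> {x \<in> \<Omega>. m x < 0}"
    and "AE x in lebesgue_on (boundary_strip \<Omega> \<rho>0). - m x \<ge> m\<rho>0"
    and "\<forall>\<mu>\<in>{first_eigenvalue \<Omega> <..< first_eigenvalue \<Omega>0}.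
           nehari_minus_solution \<Omega> m \<alpha> \<mu> (u \<mu>)"
  shows "\<exists>\<epsilon>>0. \<epsilon> \<le> first_eigenvalue \<Omega>0 - first_eigenvalue \<Omega> \<and>
           (\<forall>\<mu>\<in>{first_eigenvalue \<Omega>0 - \<epsilon> <..< first_eigenvalue \<Omega>0}.
              compact (supp_on \<Omega> (u \<mu>)) \<and> supp_on \<Omega> (u \<mu>) \<subseteq> \<Omega>) \<and>
           (\<exists>\<rho>. 0 < \<rho> \<and> \<rho> < \<rho>0 \<and>
              compactly_contained {x \<in> \<Omega>. infdist x (frontier \<Omega>) \<ge> \<rho>} \<Omega> \<and>
              (\<forall>\<mu>\<in>{first_eigenvalue \<Omega>0 - \<epsilon> <..< first_eigenvalue \<Omega>0}.
                 (\<forall>x\<in>boundary_strip \<Omega> \<rho>. u \<mu> x = 0) \<and>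
                 supp_on \<Omega> (u \<mu>) \<subseteq> {x \<in> \<Omega>. infdist x (frontier \<Omega>) \<ge> \<rho>}))"
proof -
  note \<alpha> = assms(3,4) and m = assms(5,6) and strip = assms(14) and \<rho>0 = assms(11) and m0 = assms(12)
  have \<Omega>: "open \<Omega>" "bounded \<Omega>" "\<Omega> \<noteq> {}" using assms(1,2) by (auto simp: C11_domain_def)
  have \<Omega>0: "open \<Omega>0" "\<Omega>0 \<noteq> {}" using assms(8) by (auto simp: C11_domain_def)
  have m\<Omega>0: "m x = 0" if "x \<in> \<Omega>0" for x using that interior_subset assms(7) by blast
  define \<nu>1 where "\<nu>1 = first_eigenvalue \<Omega>"
  define \<nu>0 where "\<nu>0 = first_eigenvalue \<Omega>0"
  have lt: "\<nu>1 < \<nu>0"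
    unfolding \<nu>1_def \<nu>0_def by (rule first_eigenvalue_strict_mono[OF \<Omega>(1,2) \<Omega>0 assms(9)])
  have \<nu>1: "0 < \<nu>1" unfolding \<nu>1_def by (rule first_eigenvalue_rayleigh(1)[OF \<Omega>])
  let ?S = "boundary_strip \<Omega> \<rho>0" and ?p = "\<alpha> + 1" and ?F = "frontier \<Omega>"
  have oS: "open ?S" by (rule open_boundary_strip[OF \<Omega>(1)])
  \<comment> \<open>The auxiliary function \<open>\<psi>\<close> is placed in the strip, where m is
    negative and which stays away from the inner domain.\<close>
  obtain c r where cr: "r > 0" "cball c r \<subseteq> ?S"
    using boundary_strip_nonempty[OF \<Omega> \<rho>0] oS open_contains_cball by (metis ex_in_conv)
  define \<psi> where "\<psi> = bump c r"
  have S\<Omega>: "?S \<subseteq> \<Omega>" by (auto simp: boundary_strip_def)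
  have \<psi>t: "\<psi> \<in> test_functions \<Omega>"
    unfolding \<psi>_def by (rule bump_test_function[OF cr(1)]) (use cr(2) S\<Omega> in blast)
  have \<psi>0: "\<psi> x = 0" if "x \<notin> cball c r" for x
    using that bump_outside[OF cr(1), of x c] by (auto simp: \<psi>_def)
  have \<psi>M: "M_form \<Omega> m \<alpha> \<psi> < 0"
  proof (rule ccontr)
    let ?f = "\<lambda>x. - (m x * \<bar>\<psi> x\<bar> powr ?p)"
    assume "\<not> M_form \<Omega> m \<alpha> \<psi> < 0"
    then have "M_form \<Omega> m \<alpha> \<psi> = 0" using M_form_nonpos[OF m(2), of \<alpha> \<psi>] by linarith
    then have z: "(\<integral>x. ?f x \<partial>lebesgue_on \<Omega>) = 0" by (simp add: M_form_def)
    have "integrable (lebesgue_on \<Omega>) (\<lambda>x. m x * \<bar>\<psi> x\<bar> powr ?p)"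
      by (rule M_integrable[OF \<Omega>(1,2) m(1), where B = 1])
        (use \<alpha> in \<open>auto simp: \<psi>_def bump_nonneg bump_le_1 intro!: borel_measurable_lebesgue_on
          borel_measurable_continuous_onI smooth_continuous_on smooth_bump\<close>)
    then have "AE x in lebesgue_on \<Omega>. ?f x = 0"
      using z m(2) by (subst (asm) integral_nonneg_eq_0_iff_AE)
        (auto elim!: eventually_mono simp: mult_nonpos_nonneg)
    then have "AE x in lebesgue. x \<in> \<Omega> \<longrightarrow> ?f x = 0"
      using \<Omega>(1) AE_restrict_space_iff[of \<Omega> lebesgue] by simp
    then have "AE x in lebesgue. x \<notin> ball c r"
    proof eventually_elim
      case (elim x)
      show ?case
      proof
        assume x: "x \<in> ball c r"
        then have "x \<in> ?S" using cr(2) by auto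
        then have "m x < 0" "x \<in> \<Omega>" using assms(13) by auto
        then show False using elim bump_pos[OF cr(1) x] by (simp add: \<psi>_def)
      qed
    qed
    then have "ball c r \<in> null_sets lebesgue"
      by (subst (asm) AE_iff_null_sets[symmetric]) auto
    then show False
      using measure_ball_pos[OF cr(1), of c] by (simp add: null_sets_def measure_def)
  qed
  have disj: "cball c r \<inter> closure \<Omega>0 = {}"
  proof -
    \<comment> \<open>m is negative on the strip and zero on the inner domain; an open set disjoint
      from a set is also disjoint from its closure.\<close>
    have "?S \<inter> \<Omega>0 = {}" using assms(13) m\<Omega>0 by fastforce
    then have "?S \<inter> closure \<Omega>0 = {}" using open_Int_closure_eq_empty[OF oS] by blast
    then show ?thesis using cr(2) by blast
  qed
  have \<psi>g0: "gradient \<psi> x = 0" if "x \<notin> cball c r" for x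
    by (rule gradient_zero_outside[OF closed_cball \<psi>0 that])
  obtain C s1 where C: "C > 0" "s1 > 0" and small:
    "\<And>s \<mu>. 0 < s \<Longrightarrow> s < s1 \<Longrightarrow> first_eigenvalue \<Omega>0 - s * first_eigenvalue \<Omega>0 / 2 < \<mu> \<Longrightarrow> \<mu> < first_eigenvalue \<Omega>0
      \<Longrightarrow> \<exists>w\<in>nehari_minus \<Omega> m \<alpha> \<mu>. - M_form \<Omega> m \<alpha> w \<le> C * s powr ?p"
    by (rule nehari_small_M[OF \<Omega>(1,2) \<Omega>0 assms(9) m _ \<alpha> \<psi>t \<psi>M compact_cball _ _ disj])
      (blast intro: m\<Omega>0 \<psi>0 \<psi>g0)+
  obtain Cs where Cs: "Cs > 0" and sup: "\<And>(w::'a \<Rightarrow> real) d \<Lambda> \<beta> \<iota> B x. integrable lebesgue w \<Longrightarrow> (\<And>z. 0 \<le> w z) \<Longrightarrow> (\<And>z. w z \<le> B)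
    \<Longrightarrow> 0 \<le> \<Lambda> \<Longrightarrow> 0 < \<beta> \<Longrightarrow> \<beta> < 1
    \<Longrightarrow> integrable lebesgue (\<lambda>z. w z powr \<beta>) \<Longrightarrow> (\<integral>z. w z powr \<beta> * indicator {z. 0 < d z} z \<partial>lebesgue) \<le> \<iota>
    \<Longrightarrow> (\<And>x y. \<bar>d x - d y\<bar> \<le> dist x y) \<Longrightarrow> (\<And>z. d z \<le> 1)
    \<Longrightarrow> (\<And>x. 0 < w x \<Longrightarrow> 0 < d x \<Longrightarrow> isCont w x)
    \<Longrightarrow> (\<And>x t. 0 < w x \<Longrightarrow> 0 < t \<Longrightarrow> t \<le> d x / 2 \<Longrightarrow>
        (\<integral>z. w z * laplacian (bump x t) z \<partial>lebesgue) \<ge> - \<Lambda> * (\<integral>z. w z * bump x t z \<partial>lebesgue))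
    \<Longrightarrow> 0 < d x
    \<Longrightarrow> w x \<le> (Cs * exp \<Lambda> * 2 powr (real DIM('a) / \<beta>) * \<iota>) powr (1 / \<beta>) * d x powr - (real DIM('a) / \<beta>)"
    by (fact weighted_sup_bound)
  obtain Cd where Cd: "Cd > 0" and dead: "\<And>(w::'a::euclidean_space \<Rightarrow> real) x0 R a \<Lambda> \<kappa> \<beta> q. integrable lebesgue w \<Longrightarrow> (\<And>z. 0 \<le> w z)
    \<Longrightarrow> 0 < R \<Longrightarrow> R \<le> 1 \<Longrightarrow> 0 \<le> \<Lambda> \<Longrightarrow> 0 < \<kappa> \<Longrightarrow> 0 < \<beta> \<Longrightarrow> \<beta> < 1
    \<Longrightarrow> (\<And>z. z \<in> ball x0 R \<Longrightarrow> w z \<le> a) \<Longrightarrow> q = (1 / 4) powr (1 / (1 - \<beta>))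
    \<Longrightarrow> \<Lambda> * a powr (1 - \<beta>) \<le> \<kappa> / 2 \<Longrightarrow> Cd * 4 * a powr (1 - \<beta>) \<le> q * \<kappa> * R\<^sup>2
    \<Longrightarrow> (\<And>z. z \<in> ball x0 R \<Longrightarrow> 0 < w z \<Longrightarrow> isCont w z)
    \<Longrightarrow> (\<And>z t. 0 < w z \<Longrightarrow> 0 < t \<Longrightarrow> ball z t \<subseteq> ball x0 R \<Longrightarrow> (\<integral>y. w y * laplacian (bump z t) y \<partial>lebesgue)
        \<ge> (\<integral>y. (\<kappa> * w y powr \<beta> - \<Lambda> * w y) * bump z t y \<partial>lebesgue))
    \<Longrightarrow> w x0 = 0"
    by (fact dead_core)
  \<comment> \<open>The square turns the exponent \<open>\<alpha> + 1\<close> of u into this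
    exponent of w.\<close>
  define \<beta> where "\<beta> = ?p / 2"
  define \<kappa> where "\<kappa> = 2 * m\<rho>0"
  define \<Lambda> where "\<Lambda> = 2 * \<nu>0"
  define \<rho>1 where "\<rho>1 = min \<rho>0 1"
  \<comment> \<open>For x0 within R of the frontier, all of \<open>ball x0 R\<close> lies within 2
    R, half the width \<open>\<rho>1\<close>. The weighted bound is thus used only where the weight
    exceeds \<open>\<rho>1 / 2\<close>. R also serves as the final \<open>\<rho>\<close>.\<close>
  define R where "R = \<rho>1 / 4"
  define q where "q = (1 / 4 :: real) powr (1 / (1 - \<beta>))"
  define \<gamma> where "\<gamma> = real DIM('a) / \<beta>"
  \<comment> \<open>The larger of the two smallness demands of \<open>dead\<close>, expressed for
    \<open>a powr (1 - \<beta>)\<close>.\<close>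
  define \<eta> where "\<eta> = min (\<kappa> / (2 * \<Lambda>)) (q * \<kappa> * R\<^sup>2 / (4 * Cd))"
  define a where "a = \<eta> powr (1 / (1 - \<beta>))"
  \<comment> \<open>The weighted bound with \<open>s powr (\<alpha> + 1)\<close> taken out; raised
    to the power \<open>1 / \<beta>\<close> that factor becomes s^2, so w is at most E s^2 near the
    frontier.\<close>
  define E where "E = (Cs * exp \<Lambda> * 2 powr \<gamma> * (C / m\<rho>0)) powr (1 / \<beta>) * (\<rho>1 / 2) powr - \<gamma>"
  \<comment> \<open>Small enough for the competitor and for E s^2 to stay below the dead core
    threshold a; nothing here depends on \<open>\<mu>\<close>.\<close>
  define s where "s = min (s1 / 2) (min 1 (a / (E + 1)))"
  \<comment> \<open>The first term is the range in which the competitor for this s exists, the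
    second keeps \<open>\<mu>\<close> above the eigenvalue of the outer domain.\<close>
  define \<epsilon> where "\<epsilon> = min (s * \<nu>0 / 2) (\<nu>0 - \<nu>1)"
  have \<beta>: "0 < \<beta>" "\<beta> < 1" using \<alpha> by (auto simp: \<beta>_def)
  have pos: "\<kappa> > 0" "\<Lambda> > 0" "\<rho>1 > 0" "\<rho>1 \<le> 1" "\<rho>1 \<le> \<rho>0" "R > 0" "R \<le> 1" "q > 0"
    using m0 lt \<nu>1 \<rho>0 by (auto simp: \<kappa>_def \<Lambda>_def \<rho>1_def R_def q_def)
  have \<gamma>: "\<gamma> > 0" using \<beta> by (simp add: \<gamma>_def)
  have \<eta>: "\<eta> > 0" using pos Cd by (simp add: \<eta>_def)
  have a: "a > 0" using \<eta> by (simp add: a_def)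
  have a\<eta>: "a powr (1 - \<beta>) = \<eta>" using \<eta> \<beta> by (simp add: a_def powr_powr)
  have E: "E \<ge> 0" by (simp add: E_def)
  have s: "0 < s" "s < s1" "s \<le> 1" "s \<le> a / (E + 1)" using C(2) a E by (auto simp: s_def)
  have \<epsilon>s: "\<epsilon> \<le> s * \<nu>0 / 2" unfolding \<epsilon>_def by (rule min.cobounded1)
  have \<epsilon>: "0 < \<epsilon>" "\<epsilon> \<le> \<nu>0 - \<nu>1" using s lt \<nu>1 by (auto simp: \<epsilon>_def)
  have Es: "E * s\<^sup>2 \<le> a"
  proof -
    have "E * s\<^sup>2 \<le> (E + 1) * s"
      using s E power_le_one[of s 1] by (intro mult_mono) (auto simp: power2_eq_square mult_left_le)
    also have "\<dots> \<le> a" using s(4) E by (simp add: pos_le_divide_eq mult.commute)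
    finally show ?thesis .
  qed
  \<comment> \<open>The weight is positive exactly at distance less than \<open>\<rho>1\<close> from
    the frontier, on both sides of it, so balls centred in the strip need not stay in the
    domain.\<close>
  define d where "d z = \<rho>1 - infdist z ?F" for z
  have dlip: "\<bar>d x - d y\<bar> \<le> dist x y" for x y
    using infdist_triangle_abs[of x ?F y] by (simp add: d_def abs_minus_commute)
  have d1: "d z \<le> 1" for z using infdist_nonneg[of z ?F] pos by (simp add: d_def)
  have dopen: "open {z. 0 < d z}"
    unfolding d_def by (intro open_Collect_less continuous_intros)
  have zero: "u \<mu> x0 = 0" if \<mu>: "\<nu>0 - \<epsilon> < \<mu>" "\<mu> < \<nu>0" and x0: "x0 \<in> boundary_strip \<Omega> R" for \<mu> x0
  proof -
    have "\<mu> \<in> {\<nu>1<..<\<nu>0}" using \<mu> \<epsilon> by auto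
    then have sol: "nehari_minus_solution \<Omega> m \<alpha> \<mu> (u \<mu>)" using assms(15) by (simp add: \<nu>1_def \<nu>0_def)
    then have ws: "weak_solution \<Omega> m \<alpha> \<mu> (u \<mu>)" and nn: "\<And>x. x \<in> \<Omega> \<Longrightarrow> 0 \<le> u \<mu> x"
      and cu: "continuous_on (closure \<Omega>) (u \<mu>)"
      by (auto simp: nehari_minus_solution_def)
    have um: "u \<mu> \<in> borel_measurable (lebesgue_on \<Omega>)"
      using ws H10_H10_grad[OF \<Omega>(1)] by (auto simp: weak_solution_def H10_grad_def L2_def)
    define w where "w = square_ext \<Omega> (u \<mu>)"
    obtain B where wB: "\<And>x. w x \<le> B\<^sup>2" and wi: "integrable lebesgue w" "integrable lebesgue (\<lambda>x. w x powr \<beta>)"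
      and wc: "\<And>x. x \<in> \<Omega> \<Longrightarrow> isCont w x"
      using square_ext_properties[OF \<Omega>(1,2) um cu \<alpha>(1)] unfolding w_def \<beta>_def by metis
    have w0: "0 \<le> w x" for x by (simp add: w_def square_ext_def)
    have w\<Omega>: "x \<in> \<Omega>" if "0 < w x" for x using that by (auto simp: w_def square_ext_def split: if_splits)
    have sub: "(\<integral>z. w z * laplacian (bump x t) z \<partial>lebesgue) \<ge> (\<integral>z. (\<kappa> * w z powr \<beta> - \<Lambda> * w z) * bump x t z \<partial>lebesgue)"
      if "t > 0" "\<And>z. z \<in> ball x t \<Longrightarrow> z \<in> \<Omega> \<Longrightarrow> infdist z ?F < \<rho>0" for x t
      unfolding w_def \<kappa>_def \<Lambda>_def \<beta>_def
      by (rule square_ext_subsolution[OF \<Omega>(1,2) m(1) \<alpha> strip ws nn cu less_imp_le[OF \<mu>(2)] that])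
    have "\<nu>0 - s * \<nu>0 / 2 < \<mu>" using \<mu>(1) \<epsilon>s by linarith
    from small[folded \<nu>0_def, OF s(1,2) this \<mu>(2)] obtain v where v: "v \<in> nehari_minus \<Omega> m \<alpha> \<mu>" "- M_form \<Omega> m \<alpha> v \<le> C * s powr ?p"
      by blast
    have "- M_form \<Omega> m \<alpha> (u \<mu>) \<le> C * s powr ?p"
      using nehari_minimizer_M_le[OF sol v(1) m(2) \<alpha>] v(2) by linarith
    then have "- M_form \<Omega> m \<alpha> (u \<mu>) / m\<rho>0 \<le> C * s powr ?p / m\<rho>0"
      using m0 by (intro divide_right_mono) auto
    then have \<iota>: "(\<integral>z. w z powr \<beta> * indicator {z. 0 < d z} z \<partial>lebesgue) \<le> C / m\<rho>0 * s powr ?p"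
      using strip_power_integral_le[OF \<Omega>(1,2) m \<alpha>(1) strip m0 um cu dopen] pos(5)
      unfolding w_def \<beta>_def by (fastforce simp: d_def)
    have wa: "w z \<le> a" if z: "z \<in> ball x0 R" for z
    proof (cases "w z = 0")
      case False
      have "infdist z ?F \<le> infdist x0 ?F + dist z x0" by (rule infdist_triangle)
      also have "\<dots> < R + R" using x0 z by (simp add: boundary_strip_def dist_commute)
      finally have dz: "\<rho>1 / 2 < d z" by (simp add: d_def R_def)
      have "w z \<le> (Cs * exp \<Lambda> * 2 powr (real DIM('a) / \<beta>) * (C / m\<rho>0 * s powr ?p)) powr (1 / \<beta>) * d z powr - (real DIM('a) / \<beta>)"
      proof (rule sup[OF wi(1) w0 wB less_imp_le[OF pos(2)] \<beta> wi(2) \<iota> dlip d1])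
        show "isCont w x" if "0 < w x" for x by (rule wc[OF w\<Omega>[OF that]])
        show "- \<Lambda> * (\<integral>z. w z * bump x t z \<partial>lebesgue) \<le> (\<integral>z. w z * laplacian (bump x t) z \<partial>lebesgue)"
          if "0 < w x" "0 < t" "t \<le> d x / 2" for x t
        proof -
          have bb: "\<bar>bump x t z\<bar> \<le> 1" for z by (simp add: bump_nonneg bump_le_1)
          note ib = integrable_mult_bounded[OF wi(1) bump_lebesgue_measurable(3) bb]
            integrable_mult_bounded[OF wi(2) bump_lebesgue_measurable(3) bb]
          \<comment> \<open>For the preliminary bound the absorption is discarded as nonnegative; it
            is used in full only in the dead core argument.\<close>
          have "- \<Lambda> * (\<integral>z. w z * bump x t z \<partial>lebesgue) = (\<integral>z. - \<Lambda> * (w z * bump x t z) \<partial>lebesgue)" by simp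
          also have "\<dots> \<le> (\<integral>z. (\<kappa> * w z powr \<beta> - \<Lambda> * w z) * bump x t z \<partial>lebesgue)"
          proof (rule integral_mono)
            have "(\<lambda>z. (\<kappa> * w z powr \<beta> - \<Lambda> * w z) * bump x t z) = (\<lambda>z. \<kappa> * (w z powr \<beta> * bump x t z) - \<Lambda> * (w z * bump x t z))"
              by (auto simp: algebra_simps)
            then show "integrable lebesgue (\<lambda>z. (\<kappa> * w z powr \<beta> - \<Lambda> * w z) * bump x t z)" using ib by simp
            show "integrable lebesgue (\<lambda>z. - \<Lambda> * (w z * bump x t z))" using ib by simp
            fix z
            have "0 \<le> \<kappa> * w z powr \<beta> * bump x t z" using pos(1) by (intro mult_nonneg_nonneg) (auto simp: bump_nonneg)
            then show "- \<Lambda> * (w z * bump x t z) \<le> (\<kappa> * w z powr \<beta> - \<Lambda> * w z) * bump x t z" by (simp add: algebra_simps)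
          qed
          also have "\<dots> \<le> (\<integral>z. w z * laplacian (bump x t) z \<partial>lebesgue)"
          proof (rule sub[OF that(2)])
            fix y assume "y \<in> ball x t" "y \<in> \<Omega>"
            then have "d y > 0" using dlip[of x y] that by auto
            then show "infdist y ?F < \<rho>0" using pos(5) by (simp add: d_def)
          qed
          finally show ?thesis .
        qed
        show "0 < d z" using dz pos(3) by linarith
      qed
      also have "\<dots> \<le> (Cs * exp \<Lambda> * 2 powr \<gamma> * (C / m\<rho>0 * s powr ?p)) powr (1 / \<beta>) * (\<rho>1 / 2) powr - \<gamma>"
        unfolding \<gamma>_def[symmetric] using dz pos(3) \<gamma> by (intro mult_left_mono powr_mono2') auto
      also have "(Cs * exp \<Lambda> * 2 powr \<gamma> * (C / m\<rho>0 * s powr ?p)) powr (1 / \<beta>)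
          = (Cs * exp \<Lambda> * 2 powr \<gamma> * (C / m\<rho>0)) powr (1 / \<beta>) * (s powr ?p) powr (1 / \<beta>)"
        using Cs C m0 by (subst powr_mult[symmetric]) (auto simp: mult.assoc)
      also have "(s powr ?p) powr (1 / \<beta>) = s\<^sup>2"
      proof -
        have "?p * (1 / \<beta>) = 2" using \<alpha> by (simp add: \<beta>_def field_simps)
        then show ?thesis using s by (simp only: powr_powr) (simp add: powr_numeral)
      qed
      finally have "w z \<le> E * s\<^sup>2" by (simp add: E_def mult_ac)
      then show ?thesis using Es by linarith
    qed (use a in simp)
    have "w x0 = 0"
    proof (rule dead[OF wi(1) w0 pos(6,7) less_imp_le[OF pos(2)] pos(1) \<beta> wa q_def])
      have "\<Lambda> * \<eta> \<le> \<Lambda> * (\<kappa> / (2 * \<Lambda>))" using pos by (intro mult_left_mono) (auto simp: \<eta>_def)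
      then show "\<Lambda> * a powr (1 - \<beta>) \<le> \<kappa> / 2" unfolding a\<eta> using pos by simp
      have "Cd * 4 * \<eta> \<le> Cd * 4 * (q * \<kappa> * R\<^sup>2 / (4 * Cd))" using Cd by (intro mult_left_mono) (auto simp: \<eta>_def)
      then show "Cd * 4 * a powr (1 - \<beta>) \<le> q * \<kappa> * R\<^sup>2" unfolding a\<eta> using Cd by simp
      show "isCont w z" if "0 < w z" for z by (rule wc[OF w\<Omega>[OF that]])
      show "(\<integral>y. (\<kappa> * w y powr \<beta> - \<Lambda> * w y) * bump z t y \<partial>lebesgue) \<le> (\<integral>y. w y * laplacian (bump z t) y \<partial>lebesgue)"
        if "0 < t" "ball z t \<subseteq> ball x0 R" for z t
      proof (rule sub[OF that(1)])
        fix y assume "y \<in> ball z t" "y \<in> \<Omega>"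
        then have "y \<in> ball x0 R" using that by blast
        have "infdist y ?F \<le> infdist x0 ?F + dist y x0" by (rule infdist_triangle)
        also have "\<dots> < R + R" using x0 \<open>y \<in> ball x0 R\<close> by (simp add: boundary_strip_def dist_commute)
        also have "\<dots> \<le> \<rho>0" using pos(3,5) by (simp add: R_def)
        finally show "infdist y ?F < \<rho>0" .
      qed
    qed
    then show ?thesis using x0 by (simp add: w_def square_ext_def boundary_strip_def)
  qed
  let ?T = "{x \<in> \<Omega>. R \<le> infdist x ?F}"
  have clT: "closed ?T" by (rule closed_inner_set[OF \<Omega>(1) pos(6)])
  have cT: "compact ?T"
    using clT bounded_subset[OF \<Omega>(2), of ?T] by (auto simp: compact_eq_bounded_closed)
  have cc: "compactly_contained ?T \<Omega>" using cT clT by (auto simp: compactly_contained_def)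
  have suppT: "supp_on \<Omega> (u \<mu>) \<subseteq> ?T" if "\<nu>0 - \<epsilon> < \<mu>" "\<mu> < \<nu>0" for \<mu>
    unfolding supp_on_def
    by (rule closure_minimal[OF _ clT]) (use zero[OF that] in \<open>force simp: boundary_strip_def not_le\<close>)
  have supp: "compact (supp_on \<Omega> (u \<mu>))" "supp_on \<Omega> (u \<mu>) \<subseteq> \<Omega>" if "\<nu>0 - \<epsilon> < \<mu>" "\<mu> < \<nu>0" for \<mu>
  proof -
    have "closed (supp_on \<Omega> (u \<mu>))" by (simp add: supp_on_def)
    then show "compact (supp_on \<Omega> (u \<mu>))"
      using compact_Int_closed[OF cT, of "supp_on \<Omega> (u \<mu>)"] suppT[OF that] by (simp add: Int_absorb1)
    show "supp_on \<Omega> (u \<mu>) \<subseteq> \<Omega>" using suppT[OF that] by blast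
  qed
  have R0: "R < \<rho>0" using pos by (simp add: R_def)
  show ?thesis
    unfolding \<nu>1_def[symmetric] \<nu>0_def[symmetric]
    using \<epsilon>(1,2) pos(6) R0 cc zero suppT supp
    by (intro exI[of _ \<epsilon>] conjI ballI exI[of _ R]) (auto simp only: greaterThanLessThan_iff)
qed

end
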